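(* Let $u_0\in L^2(\Omega;\mathbb H)$, suppose there are constants $\alpha_{F,0},\alpha_{B,0}$ such that for all $u,v\in\mathbb H$: $\langle u-v,F(u)-F(v)\rangle_{\mathbb H}\le\alpha_{F,0}\|u-v\|_{\mathbb H}^2$ and $\|B(u)-B(v)\|_{HS(U_0;\mathbb H)}\le\alpha_{B,0}\|u-v\|_{\mathbb H}$, and suppose $\sigma_0>\widetilde\alpha_{F,0}+2\widetilde\alpha_{B,0}^2$. Then for sufficiently small $\Delta t>0$, the solution $\{u_k\}_{k\in\mathbb N}$ of the semi-implicit Euler scheme admits a unique invariant measure $\pi^{\Delta t}\in\mathcal P(\mathbb H)$.
   Context: Setting. $\Theta\subset\mathbb R^3$ is a bounded domain with unit outward normal $\mathbf n$, and $\mathbb H:=L^2(\Theta)^3\times L^2(\Theta)^3$ (real Hilbert space, usual inner product). The Maxwell operator is $M(\mathbf E,\mathbf H)=(\nabla\times\mathbf H,-\nabla\times\mathbf E)$ with domain $\mathcal D(M)=H_0(\mathrm{curl},\Theta)\times H(\mathrm{curl},\Theta)$, where $H(\mathrm{curl},\Theta)=\{v\in L^2(\Theta)^3:\nabla\times v\in L^2(\Theta)^3\}$ and $H_0(\mathrm{curl},\Theta)=\{v\in H(\mathrm{curl},\Theta):\mathbf n\times v|_{\partial\Theta}=\mathbf 0\}$; $M$ is skew-adjoint. $W(t)=\sum_{k\ge1}Q^{1/2}e_k\beta_k(t)$ is a $Q$-Wiener process on a filtered probability space $(\Omega,\mathcal F,\{\mathcal F_t\}_{t\ge0},\mathbb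 P)$, with $Q$ a symmetric positive definite operator on $L^2(\Theta)$, $\{e_k\}$ an orthonormal basis of $L^2(\Theta)$ and $\beta_k$ independent real Brownian motions; $U_0:=Q^{1/2}(L^2(\Theta))$; $HS$ denotes Hilbert--Schmidt operators. For given functions $\mathbf J_e,\mathbf J_m,\mathbf J_e^r,\mathbf J_m^r:\Theta\times\mathbb R^3\times\mathbb R^3\to\mathbb R^3$, the Nemytskij operators $F:\mathbb H\to\mathbb H$ and $B:\mathbb H\to HS(U_0;\mathbb H)$ are, for $h=(\mathbf h_1,\mathbf h_2)$ and $v\in U_0$, $F(h)(\mathbf x)=(-\mathbf J_e(\mathbf x,\mathbf h_1(\mathbf x),\mathbf h_2(\mathbf x)),-\mathbf J_m(\mathbf x,\mathbf h_1(\mathbf x),\mathbf h_2(\mathbf x)))$ and $(B(h)v)(\mathbf x)=(-\mathbf J_e^r(\mathbf x,\mathbf h_1(\mathbf x),\mathbf h_2(\mathbf x))v(\mathbf x),-\mathbf J_m^r(\mathbf x,\mathbf h_1(\mathbf x),\mathbf h_2(\mathbf x))v(\mathbf x))$. The semi-implicit Euler scheme with step-size $\Delta t>0$, $t_k=k\Delta t$, $\Delta W_k=W(t_{k+1})-W(t_k)$ and real constant $\sigma_0$, is $u_{k+1}-u_k=\Delta tMu_{k+1}-\sigma_0u_{k+1}\Delta t+\Delta tF(u_{k+1})+B(u_k)\Delta W_k$, $k\in\mathbb N$, and $\{u_k\}$ is its $\{\mathcal F_{t_k}\}$-adapted $\mathbb H$-valued solution. Initial data are $\mathcal F_0$-measurable.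 $\mathcal P(\mathbb H)$ is the set of Borel probability measures on $\mathbb H$; invariance is with respect to the transition kernel of the Markov chain $\{u_k\}$. Constants. $\widetilde\alpha_{F,0}=\frac12\max\{1+2\alpha_{F,0},\|F(0)\|_{\mathbb H}^2\}$, $\widetilde\alpha_{B,0}=\max\{\alpha_{B,0},\|B(0)\|_{HS(U_0;\mathbb H)}\}$. *)

theory Defs
  imports "HOL-Probability.Probability"
begin

section \<open>Square integrable fields\<close>

type_synonym R3 = "real ^ 3"

definition square_integrable :: "(R3 \<Rightarrow> 'b::euclidean_space) \<Rightarrow> bool" where
  "square_integrable f \<longleftrightarrow>
     f \<in> borel_measurable lebesgue \<and> integrable lebesgue (\<lambda>x. (norm (f x))\<^sup>2)"

definition L2_eq :: "(R3 \<Rightarrow> 'b::euclidean_space) \<Rightarrow> (R3 \<Rightarrow> 'b) \<Rightarrow> bool" where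
  "L2_eq f g \<longleftrightarrow>
     square_integrable f \<and> square_integrable g \<and> (AE x in lebesgue. f x = g x)"

lemma square_integrable_zero: "square_integrable (\<lambda>_. 0)"
  by (simp add: square_integrable_def)

lemma square_integrable_add:
  assumes "square_integrable f" "square_integrable g"
  shows "square_integrable (\<lambda>x. f x + g x)"
proof -
  have m [measurable]: "f \<in> borel_measurable lebesgue" "g \<in> borel_measurable lebesgue"
    using assms by (auto simp: square_integrable_def)
  have "integrable lebesgue (\<lambda>x. 2 * (norm (f x))\<^sup>2 + 2 * (norm (g x))\<^sup>2)"
    using assms by (intro Bochner_Integration.integrable_add integrable_mult_right)
      (auto simp: square_integrable_def)
  then have "integrable lebesgue (\<lambda>x. (norm (f x + g x))\<^sup>2)"
  proof (rule Bochner_Integration.integrable_bound)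
    show "(\<lambda>x. (norm (f x + g x))\<^sup>2) \<in> borel_measurable lebesgue" by measurable
    show "AE x in lebesgue. norm ((norm (f x + g x))\<^sup>2)
        \<le> norm (2 * (norm (f x))\<^sup>2 + 2 * (norm (g x))\<^sup>2)"
    proof (rule AE_I2)
      fix x
      have "(norm (f x + g x))\<^sup>2 \<le> (norm (f x) + norm (g x))\<^sup>2"
        by (intro power_mono norm_triangle_ineq) auto
      also have "\<dots> \<le> 2 * (norm (f x))\<^sup>2 + 2 * (norm (g x))\<^sup>2"
        using sum_squares_bound[of "norm (f x)" "norm (g x)"] by (simp add: power2_sum)
      finally show "norm ((norm (f x + g x))\<^sup>2)
          \<le> norm (2 * (norm (f x))\<^sup>2 + 2 * (norm (g x))\<^sup>2)"
        by simp
    qed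
  qed
  then show ?thesis by (simp add: square_integrable_def)
qed

lemma square_integrable_scaleR:
  assumes "square_integrable f"
  shows "square_integrable (\<lambda>x. c *\<^sub>R f x)"
  using assms by (auto simp: square_integrable_def power_mult_distrib)

lemma square_integrable_minus:
  assumes "square_integrable f"
  shows "square_integrable (\<lambda>x. - f x)"
  using square_integrable_scaleR[OF assms, of "-1"] by simp

lemma square_integrable_diff:
  assumes "square_integrable f" "square_integrable g"
  shows "square_integrable (\<lambda>x. f x - g x)"
  using square_integrable_add[OF assms(1) square_integrable_minus[OF assms(2)]] by simp

lemma square_integrable_inner:
  assumes "square_integrable f" "square_integrable g"
  shows "integrable lebesgue (\<lambda>x. f x \<bullet> g x)"
proof -
  have m [measurable]: "f \<in> borel_measurable lebesgue" "g \<in> borel_measurable lebesgue"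
    using assms by (auto simp: square_integrable_def)
  have "integrable lebesgue (\<lambda>x. (norm (f x))\<^sup>2 + (norm (g x))\<^sup>2)"
    using assms by (intro Bochner_Integration.integrable_add) (auto simp: square_integrable_def)
  then show ?thesis
  proof (rule Bochner_Integration.integrable_bound)
    show "(\<lambda>x. f x \<bullet> g x) \<in> borel_measurable lebesgue" by measurable
    show "AE x in lebesgue. norm (f x \<bullet> g x) \<le> norm ((norm (f x))\<^sup>2 + (norm (g x))\<^sup>2)"
    proof (rule AE_I2)
      fix x
      have "\<bar>f x \<bullet> g x\<bar> \<le> norm (f x) * norm (g x)" by (rule Cauchy_Schwarz_ineq2)
      also have "\<dots> \<le> 2 * norm (f x) * norm (g x)" by simp
      also have "\<dots> \<le> (norm (f x))\<^sup>2 + (norm (g x))\<^sup>2" by (rule sum_squares_bound)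
      finally show "norm (f x \<bullet> g x) \<le> norm ((norm (f x))\<^sup>2 + (norm (g x))\<^sup>2)" by simp
    qed
  qed
qed

quotient_type (overloaded) 'b L2 = "R3 \<Rightarrow> 'b::euclidean_space" / partial: "L2_eq"
proof (rule part_equivpI)
  show "\<exists>x. L2_eq x (x :: R3 \<Rightarrow> 'b)"
    by (rule exI[of _ "\<lambda>_. 0"]) (simp add: L2_eq_def square_integrable_zero)
  show "symp (L2_eq :: (R3 \<Rightarrow> 'b) \<Rightarrow> _)"
    by (rule sympI) (auto simp: L2_eq_def elim: AE_mp)
  show "transp (L2_eq :: (R3 \<Rightarrow> 'b) \<Rightarrow> _)"
    by (rule transpI) (auto simp: L2_eq_def elim: AE_mp)
qed

instantiation L2 :: (euclidean_space) real_vector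
begin

lift_definition zero_L2 :: "'a L2" is "\<lambda>_. 0"
  by (simp add: L2_eq_def square_integrable_zero)

lift_definition plus_L2 :: "'a L2 \<Rightarrow> 'a L2 \<Rightarrow> 'a L2" is "\<lambda>f g x. f x + g x"
  by (auto simp: L2_eq_def square_integrable_add)

lift_definition minus_L2 :: "'a L2 \<Rightarrow> 'a L2 \<Rightarrow> 'a L2" is "\<lambda>f g x. f x - g x"
  by (auto simp: L2_eq_def square_integrable_diff)

lift_definition uminus_L2 :: "'a L2 \<Rightarrow> 'a L2" is "\<lambda>f x. - f x"
  by (auto simp: L2_eq_def square_integrable_minus)

lift_definition scaleR_L2 :: "real \<Rightarrow> 'a L2 \<Rightarrow> 'a L2" is "\<lambda>c f x. c *\<^sub>R f x"
  by (auto simp: L2_eq_def square_integrable_scaleR)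

instance
proof
  fix u v w :: "'a L2" and a b :: real
  show "u + v + w = u + (v + w)"
    by transfer (auto simp: L2_eq_def square_integrable_add algebra_simps)
  show "u + v = v + u"
    by transfer (auto simp: L2_eq_def square_integrable_add algebra_simps)
  show "0 + u = u" by transfer (auto simp: L2_eq_def)
  show "- u + u = 0"
    by transfer (auto simp: L2_eq_def square_integrable_zero)
  show "u - v = u + - v"
    by transfer (auto simp: L2_eq_def square_integrable_diff)
  show "a *\<^sub>R (u + v) = a *\<^sub>R u + a *\<^sub>R v"
    by transfer (auto simp: L2_eq_def square_integrable_add square_integrable_scaleR
        scaleR_add_right simp del: scaleR_conv_of_real)
  show "(a + b) *\<^sub>R u = a *\<^sub>R u + b *\<^sub>R u"
    by transfer (auto simp: L2_eq_def square_integrable_add square_integrable_scaleR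
        scaleR_add_left)
  show "a *\<^sub>R b *\<^sub>R u = (a * b) *\<^sub>R u"
    by transfer (auto simp: L2_eq_def square_integrable_scaleR)
  show "1 *\<^sub>R u = u" by transfer (auto simp: L2_eq_def)
qed

end

instantiation L2 :: (euclidean_space) real_inner
begin

lift_definition inner_L2 :: "'a L2 \<Rightarrow> 'a L2 \<Rightarrow> real" is "\<lambda>f g. LINT x|lebesgue. f x \<bullet> g x"
proof -
  fix f f' g g' :: "R3 \<Rightarrow> 'a"
  assume fg: "L2_eq f f'" "L2_eq g g'"
  then have [measurable]:
    "f \<in> borel_measurable lebesgue" "f' \<in> borel_measurable lebesgue"
    "g \<in> borel_measurable lebesgue" "g' \<in> borel_measurable lebesgue"
    by (auto simp: L2_eq_def square_integrable_def)
  have "AE x in lebesgue. f x = f' x" "AE x in lebesgue. g x = g' x"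
    using fg by (auto simp: L2_eq_def)
  then have "AE x in lebesgue. f x \<bullet> g x = f' x \<bullet> g' x" by eventually_elim simp
  then show "(LINT x|lebesgue. f x \<bullet> g x) = (LINT x|lebesgue. f' x \<bullet> g' x)"
    by (intro integral_cong_AE) measurable
qed

definition norm_L2 :: "'a L2 \<Rightarrow> real" where "norm_L2 v = sqrt (inner v v)"

definition sgn_L2 :: "'a L2 \<Rightarrow> 'a L2" where "sgn_L2 v = v /\<^sub>R norm v"

definition dist_L2 :: "'a L2 \<Rightarrow> 'a L2 \<Rightarrow> real" where "dist_L2 v w = norm (v - w)"

definition uniformity_L2 :: "('a L2 \<times> 'a L2) filter" where
  "uniformity_L2 = (INF e\<in>{0 <..}. principal {(v, w). dist v w < e})"

definition open_L2 :: "'a L2 set \<Rightarrow> bool" where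
  "open_L2 U \<longleftrightarrow> (\<forall>v\<in>U. eventually (\<lambda>(v', w). v' = v \<longrightarrow> w \<in> U) uniformity)"

instance
proof
  fix u v w :: "'a L2" and a :: real
  show "dist v w = norm (v - w)" by (rule dist_L2_def)
  show "sgn u = u /\<^sub>R norm u" by (rule sgn_L2_def)
  show "(uniformity :: ('a L2 \<times> 'a L2) filter) =
      (INF e\<in>{0 <..}. principal {(v, w). dist v w < e})"
    by (rule uniformity_L2_def)
  show "open U = (\<forall>v\<in>U. \<forall>\<^sub>F (v', w) in uniformity. v' = v \<longrightarrow> w \<in> U)" for U :: "'a L2 set"
    by (rule open_L2_def)
  show "u \<bullet> v = v \<bullet> u" by transfer (simp add: inner_commute)
  show "(u + v) \<bullet> w = u \<bullet> w + v \<bullet> w"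
    by transfer (auto simp: L2_eq_def inner_add_left square_integrable_inner
        intro!: Bochner_Integration.integral_add)
  show "(a *\<^sub>R u) \<bullet> v = a * (u \<bullet> v)" by transfer simp
  show "0 \<le> u \<bullet> u" by transfer (auto intro: integral_nonneg_AE)
  show "(u \<bullet> u = 0) = (u = 0)"
  proof transfer
    fix f :: "R3 \<Rightarrow> 'a"
    assume "L2_eq f f"
    then have f: "square_integrable f" by (simp add: L2_eq_def)
    have "((LINT x|lebesgue. f x \<bullet> f x) = 0) \<longleftrightarrow> (AE x in lebesgue. f x \<bullet> f x = 0)"
      by (intro integral_nonneg_eq_0_iff_AE square_integrable_inner f) auto
    then show "((LINT x|lebesgue. f x \<bullet> f x) = 0) = L2_eq f (\<lambda>_. 0)"
      using f by (simp add: L2_eq_def square_integrable_zero)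
  qed
  show "norm u = sqrt (u \<bullet> u)" by (rule norm_L2_def)
qed

end

definition L2_fun :: "'b::euclidean_space L2 \<Rightarrow> R3 \<Rightarrow> 'b" where
  "L2_fun v = rep_L2 v"

text \<open>
  \<open>L\<^sup>2(\<Theta>)\<close> is realised, isometrically via extension by zero, as the closed subspace of the
  fields that vanish almost everywhere outside \<open>\<Theta>\<close>.
\<close>

definition L2_on :: "R3 set \<Rightarrow> 'b::euclidean_space L2 set" where
  "L2_on \<Theta> = {v. AE x in lebesgue. x \<notin> \<Theta> \<longrightarrow> L2_fun v x = 0}"

definition ext0 :: "R3 set \<Rightarrow> (R3 \<Rightarrow> 'b::euclidean_space) \<Rightarrow> R3 \<Rightarrow> 'b" where
  "ext0 \<Theta> f x = (if x \<in> \<Theta> then f x else 0)"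

definition in_L2 :: "R3 set \<Rightarrow> (R3 \<Rightarrow> 'b::euclidean_space) \<Rightarrow> bool" where
  "in_L2 \<Theta> f \<longleftrightarrow> square_integrable (ext0 \<Theta> f)"

text \<open>The class in \<open>L\<^sup>2(\<Theta>)\<close> of a function \<open>f\<close>; meaningful only if \<open>in_L2 \<Theta> f\<close>.\<close>

definition L2_class :: "R3 set \<Rightarrow> (R3 \<Rightarrow> 'b::euclidean_space) \<Rightarrow> 'b L2" where
  "L2_class \<Theta> f = abs_L2 (ext0 \<Theta> f)"

type_synonym field_pair = "R3 L2 \<times> R3 L2"

definition HH :: "R3 set \<Rightarrow> field_pair set" where
  "HH \<Theta> = L2_on \<Theta> \<times> L2_on \<Theta>"

definition HH_borel :: "R3 set \<Rightarrow> field_pair measure" where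
  "HH_borel \<Theta> = restrict_space borel (HH \<Theta>)"


section \<open>The Maxwell operator\<close>

definition partial_deriv :: "3 \<Rightarrow> (R3 \<Rightarrow> R3) \<Rightarrow> R3 \<Rightarrow> R3" where
  "partial_deriv i \<phi> x = frechet_derivative \<phi> (at x) (axis i 1)"

definition curl :: "(R3 \<Rightarrow> R3) \<Rightarrow> R3 \<Rightarrow> R3" where
  "curl \<phi> x = vector
     [partial_deriv 2 \<phi> x $ 3 - partial_deriv 3 \<phi> x $ 2,
      partial_deriv 3 \<phi> x $ 1 - partial_deriv 1 \<phi> x $ 3,
      partial_deriv 1 \<phi> x $ 2 - partial_deriv 2 \<phi> x $ 1]"

primrec C_k :: "nat \<Rightarrow> (R3 \<Rightarrow> R3) \<Rightarrow> bool" where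
  "C_k 0 \<phi> \<longleftrightarrow> continuous_on UNIV \<phi>"
| "C_k (Suc k) \<phi> \<longleftrightarrow> (\<forall>x. \<phi> differentiable (at x)) \<and>
     (\<forall>d. C_k k (\<lambda>x. frechet_derivative \<phi> (at x) d))"

definition test_fields :: "R3 set \<Rightarrow> (R3 \<Rightarrow> R3) set" where
  "test_fields \<Theta> = {\<phi>. (\<forall>k. C_k k \<phi>) \<and>
     compact (closure {x. \<phi> x \<noteq> 0}) \<and> closure {x. \<phi> x \<noteq> 0} \<subseteq> \<Theta>}"

definition has_weak_curl :: "R3 set \<Rightarrow> R3 L2 \<Rightarrow> R3 L2 \<Rightarrow> bool" where
  "has_weak_curl \<Theta> v w \<longleftrightarrow> v \<in> L2_on \<Theta> \<and> w \<in> L2_on \<Theta> \<and>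
     (\<forall>\<phi>\<in>test_fields \<Theta>.
        (LINT x|lebesgue_on \<Theta>. L2_fun w x \<bullet> \<phi> x) =
        (LINT x|lebesgue_on \<Theta>. L2_fun v x \<bullet> curl \<phi> x))"

definition H_curl :: "R3 set \<Rightarrow> R3 L2 set" where
  "H_curl \<Theta> = {v. \<exists>w. has_weak_curl \<Theta> v w}"

text \<open>
  The field \<open>w\<close> is unique when it exists, by the fundamental lemma of the calculus of variations.
\<close>

definition weak_curl :: "R3 set \<Rightarrow> R3 L2 \<Rightarrow> R3 L2" where
  "weak_curl \<Theta> v = (SOME w. has_weak_curl \<Theta> v w)"

text \<open>
  The tangential trace \<open>n \<times> v\<close> of \<open>v \<in> H(curl)\<close> exists only as a functional, given by Green's
  formula: for fields that are smooth up to a regular boundary with outward normal \<open>n\<close>,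
  \<open>\<integral>\<^sub>\<Theta> (curl v \<cdot> \<phi> - v \<cdot> curl \<phi>) dx = \<integral>\<^sub>\<partial>\<^sub>\<Theta> (n \<times> v) \<cdot> \<phi> dS\<close>.
  Pairing with all of \<open>H(curl)\<close> keeps this meaningful on any bounded domain.
\<close>

definition tangential_trace :: "R3 set \<Rightarrow> R3 L2 \<Rightarrow> R3 L2 \<Rightarrow> real" where
  "tangential_trace \<Theta> v \<phi> = weak_curl \<Theta> v \<bullet> \<phi> - v \<bullet> weak_curl \<Theta> \<phi>"

definition H0_curl :: "R3 set \<Rightarrow> R3 L2 set" where
  "H0_curl \<Theta> = {v \<in> H_curl \<Theta>. \<forall>\<phi>\<in>H_curl \<Theta>. tangential_trace \<Theta> v \<phi> = 0}"

definition maxwell_dom :: "R3 set \<Rightarrow> field_pair set" where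
  "maxwell_dom \<Theta> = H0_curl \<Theta> \<times> H_curl \<Theta>"

definition maxwell :: "R3 set \<Rightarrow> field_pair \<Rightarrow> field_pair" where
  "maxwell \<Theta> = (\<lambda>(E, H). (weak_curl \<Theta> H, - weak_curl \<Theta> E))"


section \<open>The covariance operator and Hilbert--Schmidt operators\<close>

definition operator_on :: "'a::real_normed_vector set \<Rightarrow> ('a \<Rightarrow> 'a) \<Rightarrow> bool" where
  "operator_on S A \<longleftrightarrow> (\<forall>v\<in>S. A v \<in> S) \<and>
     (\<forall>v\<in>S. \<forall>w\<in>S. A (v + w) = A v + A w) \<and> (\<forall>c. \<forall>v\<in>S. A (c *\<^sub>R v) = c *\<^sub>R A v) \<and>
     (\<exists>C. \<forall>v\<in>S. norm (A v) \<le> C * norm v)"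

definition symmetric_on :: "'a::real_inner set \<Rightarrow> ('a \<Rightarrow> 'a) \<Rightarrow> bool" where
  "symmetric_on S A \<longleftrightarrow> (\<forall>v\<in>S. \<forall>w\<in>S. A v \<bullet> w = v \<bullet> A w)"

definition covariance_operator :: "'a::real_inner set \<Rightarrow> ('a \<Rightarrow> 'a) \<Rightarrow> bool" where
  "covariance_operator S Q \<longleftrightarrow>
     operator_on S Q \<and> symmetric_on S Q \<and> (\<forall>v\<in>S. v \<noteq> 0 \<longrightarrow> 0 < Q v \<bullet> v)"

text \<open>The square root is unique as an operator on \<open>S\<close>; its values outside \<open>S\<close> are irrelevant.\<close>

definition op_sqrt :: "'a::real_inner set \<Rightarrow> ('a \<Rightarrow> 'a) \<Rightarrow> 'a \<Rightarrow> 'a" where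
  "op_sqrt S Q = (SOME R. operator_on S R \<and> symmetric_on S R \<and> (\<forall>v\<in>S. 0 \<le> R v \<bullet> v) \<and>
     (\<forall>v\<in>S. R (R v) = Q v))"

definition orthonormal_basis :: "'a::real_inner set \<Rightarrow> (nat \<Rightarrow> 'a) \<Rightarrow> bool" where
  "orthonormal_basis S e \<longleftrightarrow> (\<forall>j. e j \<in> S) \<and>
     (\<forall>i j. e i \<bullet> e j = (if i = j then 1 else 0)) \<and> S \<subseteq> closure (span (range e))"

text \<open>\<open>U\<^sub>0\<close> is the range of \<open>Q\<^sup>1\<^sup>/\<^sup>2\<close> with the norm that makes \<open>Q\<^sup>1\<^sup>/\<^sup>2\<close> an isometry onto it.\<close>

definition U0 :: "R3 set \<Rightarrow> (real L2 \<Rightarrow> real L2) \<Rightarrow> real L2 set" where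
  "U0 \<Theta> Q = op_sqrt (L2_on \<Theta>) Q ` L2_on \<Theta>"

definition U0_norm :: "R3 set \<Rightarrow> (real L2 \<Rightarrow> real L2) \<Rightarrow> real L2 \<Rightarrow> real" where
  "U0_norm \<Theta> Q v = norm (inv_into (L2_on \<Theta>) (op_sqrt (L2_on \<Theta>) Q) v)"

text \<open>
  The Hilbert--Schmidt norm does not depend on the orthonormal basis of \<open>U\<^sub>0\<close>; it is computed
  in \<open>Q\<^sup>1\<^sup>/\<^sup>2 e\<^sub>j\<close>.
\<close>

definition Hilbert_Schmidt ::
  "R3 set \<Rightarrow> (real L2 \<Rightarrow> real L2) \<Rightarrow> (nat \<Rightarrow> real L2) \<Rightarrow> (real L2 \<Rightarrow> field_pair) \<Rightarrow> bool" where
  "Hilbert_Schmidt \<Theta> Q e T \<longleftrightarrow>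
     (\<forall>v\<in>U0 \<Theta> Q. T v \<in> HH \<Theta>) \<and>
     (\<forall>v\<in>U0 \<Theta> Q. \<forall>w\<in>U0 \<Theta> Q. T (v + w) = T v + T w) \<and>
     (\<forall>c. \<forall>v\<in>U0 \<Theta> Q. T (c *\<^sub>R v) = c *\<^sub>R T v) \<and>
     (\<exists>C. \<forall>v\<in>U0 \<Theta> Q. norm (T v) \<le> C * U0_norm \<Theta> Q v) \<and>
     summable (\<lambda>j. (norm (T (op_sqrt (L2_on \<Theta>) Q (e j))))\<^sup>2)"

definition HS_norm ::
  "R3 set \<Rightarrow> (real L2 \<Rightarrow> real L2) \<Rightarrow> (nat \<Rightarrow> real L2) \<Rightarrow> (real L2 \<Rightarrow> field_pair) \<Rightarrow> real" where
  "HS_norm \<Theta> Q e T = sqrt (\<Sum>j. (norm (T (op_sqrt (L2_on \<Theta>) Q (e j))))\<^sup>2)"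


section \<open>Nemytskij operators\<close>

definition superpos :: "(R3 \<Rightarrow> R3 \<Rightarrow> R3 \<Rightarrow> R3) \<Rightarrow> field_pair \<Rightarrow> R3 \<Rightarrow> R3" where
  "superpos J h x = J x (L2_fun (fst h) x) (L2_fun (snd h) x)"

definition F_op ::
  "R3 set \<Rightarrow> (R3 \<Rightarrow> R3 \<Rightarrow> R3 \<Rightarrow> R3) \<Rightarrow> (R3 \<Rightarrow> R3 \<Rightarrow> R3 \<Rightarrow> R3) \<Rightarrow> field_pair \<Rightarrow> field_pair" where
  "F_op \<Theta> Je Jm h =
     (L2_class \<Theta> (\<lambda>x. - superpos Je h x), L2_class \<Theta> (\<lambda>x. - superpos Jm h x))"

definition B_op ::
  "R3 set \<Rightarrow> (R3 \<Rightarrow> R3 \<Rightarrow> R3 \<Rightarrow> R3) \<Rightarrow> (R3 \<Rightarrow> R3 \<Rightarrow> R3 \<Rightarrow> R3) \<Rightarrow>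
     field_pair \<Rightarrow> real L2 \<Rightarrow> field_pair" where
  "B_op \<Theta> Jer Jmr h v =
     (L2_class \<Theta> (\<lambda>x. - (L2_fun v x *\<^sub>R superpos Jer h x)),
      L2_class \<Theta> (\<lambda>x. - (L2_fun v x *\<^sub>R superpos Jmr h x)))"

definition F_well_defined ::
  "R3 set \<Rightarrow> (R3 \<Rightarrow> R3 \<Rightarrow> R3 \<Rightarrow> R3) \<Rightarrow> (R3 \<Rightarrow> R3 \<Rightarrow> R3 \<Rightarrow> R3) \<Rightarrow> bool" where
  "F_well_defined \<Theta> Je Jm \<longleftrightarrow>
     (\<forall>h\<in>HH \<Theta>. in_L2 \<Theta> (superpos Je h) \<and> in_L2 \<Theta> (superpos Jm h))"

definition B_well_defined ::
  "R3 set \<Rightarrow> (real L2 \<Rightarrow> real L2) \<Rightarrow> (nat \<Rightarrow> real L2) \<Rightarrow>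
     (R3 \<Rightarrow> R3 \<Rightarrow> R3 \<Rightarrow> R3) \<Rightarrow> (R3 \<Rightarrow> R3 \<Rightarrow> R3 \<Rightarrow> R3) \<Rightarrow> bool" where
  "B_well_defined \<Theta> Q e Jer Jmr \<longleftrightarrow>
     (\<forall>h\<in>HH \<Theta>.
        (\<forall>v\<in>U0 \<Theta> Q. in_L2 \<Theta> (\<lambda>x. L2_fun v x *\<^sub>R superpos Jer h x) \<and>
                      in_L2 \<Theta> (\<lambda>x. L2_fun v x *\<^sub>R superpos Jmr h x)) \<and>
        Hilbert_Schmidt \<Theta> Q e (B_op \<Theta> Jer Jmr h))"


section \<open>The driving noise\<close>

definition filtered_prob_space :: "'w measure \<Rightarrow> (real \<Rightarrow> 'w measure) \<Rightarrow> bool" where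
  "filtered_prob_space P Fil \<longleftrightarrow> prob_space P \<and> (\<forall>t\<ge>0. subalgebra P (Fil t)) \<and>
     (\<forall>s t. 0 \<le> s \<and> s \<le> t \<longrightarrow> subalgebra (Fil t) (Fil s))"

definition brownian_motion ::
  "'w measure \<Rightarrow> (real \<Rightarrow> 'w measure) \<Rightarrow> (real \<Rightarrow> 'w \<Rightarrow> real) \<Rightarrow> bool" where
  "brownian_motion P Fil b \<longleftrightarrow>
     (\<forall>t\<ge>0. b t \<in> borel_measurable (Fil t)) \<and>
     (AE \<omega> in P. b 0 \<omega> = 0) \<and>
     (AE \<omega> in P. continuous_on {0..} (\<lambda>t. b t \<omega>)) \<and>
     (\<forall>s t. 0 \<le> s \<and> s < t \<longrightarrow>
        distributed P lborel (\<lambda>\<omega>. b t \<omega> - b s \<omega>) (normal_density 0 (sqrt (t - s))) \<and>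
        prob_space.indep_set P (sets (Fil s))
          (sets (vimage_algebra (space P) (\<lambda>\<omega>. b t \<omega> - b s \<omega>) borel)))"

text \<open>
  The coordinate processes \<open>\<beta>\<^sub>j\<close> of \<open>W = \<Sum>\<^sub>j Q\<^sup>1\<^sup>/\<^sup>2 e\<^sub>j \<beta>\<^sub>j\<close>. The last condition says that \<open>W\<close> is a
  Wiener process with respect to the filtration: for an increment of \<open>W\<close> all coordinates
  must be jointly independent of the past.
\<close>

definition wiener_coordinates ::
  "'w measure \<Rightarrow> (real \<Rightarrow> 'w measure) \<Rightarrow> (nat \<Rightarrow> real \<Rightarrow> 'w \<Rightarrow> real) \<Rightarrow> bool" where
  "wiener_coordinates P Fil \<beta> \<longleftrightarrow>
     (\<forall>j. brownian_motion P Fil (\<beta> j)) \<and>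
     prob_space.indep_vars P (\<lambda>_. PiM {0..} (\<lambda>_. borel)) (\<lambda>j \<omega>. \<lambda>t\<in>{0..}. \<beta> j t \<omega>) UNIV \<and>
     (\<forall>s t. 0 \<le> s \<and> s < t \<longrightarrow>
        prob_space.indep_set P (sets (Fil s))
          (sets (vimage_algebra (space P) (\<lambda>\<omega> j. \<beta> j t \<omega> - \<beta> j s \<omega>) (PiM UNIV (\<lambda>_. borel)))))"

text \<open>
  \<open>N = \<Phi> (W(t) - W(s))\<close> for a random Hilbert--Schmidt operator \<open>\<Phi>\<close> on \<open>U\<^sub>0\<close>. The increment
  \<open>W(t) - W(s)\<close> does not take values in \<open>U\<^sub>0\<close>, so the product is the stochastic integral of the
  integrand \<open>\<Phi>\<close> over \<open>(s, t]\<close>, i.e. the mean square limit of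
  \<open>\<Sum>\<^sub>j (\<beta>\<^sub>j(t) - \<beta>\<^sub>j(s)) \<Phi> (Q\<^sup>1\<^sup>/\<^sup>2 e\<^sub>j)\<close>; this does not require \<open>Q\<close> to be of trace class.
\<close>

definition applied_to_increment ::
  "R3 set \<Rightarrow> 'w measure \<Rightarrow> (real L2 \<Rightarrow> real L2) \<Rightarrow> (nat \<Rightarrow> real L2) \<Rightarrow>
     (nat \<Rightarrow> real \<Rightarrow> 'w \<Rightarrow> real) \<Rightarrow> ('w \<Rightarrow> real L2 \<Rightarrow> field_pair) \<Rightarrow> real \<Rightarrow> real \<Rightarrow>
     ('w \<Rightarrow> field_pair) \<Rightarrow> bool" where
  "applied_to_increment \<Theta> P Q e \<beta> \<Phi> s t N \<longleftrightarrow>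
     N \<in> measurable P (HH_borel \<Theta>) \<and>
     (\<lambda>n. \<integral>\<^sup>+\<omega>. ennreal ((norm ((\<Sum>j<n. (\<beta> j t \<omega> - \<beta> j s \<omega>) *\<^sub>R \<Phi> \<omega> (op_sqrt (L2_on \<Theta>) Q (e j)))
                            - N \<omega>))\<^sup>2) \<partial>P) \<longlonglongrightarrow> 0"


section \<open>The scheme, its transition kernel and invariant measures\<close>

definition euler_solution ::
  "R3 set \<Rightarrow> 'w measure \<Rightarrow> (real \<Rightarrow> 'w measure) \<Rightarrow> (real L2 \<Rightarrow> real L2) \<Rightarrow> (nat \<Rightarrow> real L2) \<Rightarrow>
     (nat \<Rightarrow> real \<Rightarrow> 'w \<Rightarrow> real) \<Rightarrow> (field_pair \<Rightarrow> field_pair) \<Rightarrow>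
     (field_pair \<Rightarrow> real L2 \<Rightarrow> field_pair) \<Rightarrow> real \<Rightarrow> real \<Rightarrow>
     ('w \<Rightarrow> field_pair) \<Rightarrow> (nat \<Rightarrow> 'w \<Rightarrow> field_pair) \<Rightarrow> bool" where
  "euler_solution \<Theta> P Fil Q e \<beta> F B \<sigma>0 \<Delta>t \<eta> u \<longleftrightarrow>
     u 0 = \<eta> \<and>
     (\<forall>k. u k \<in> measurable (Fil (real k * \<Delta>t)) (HH_borel \<Theta>)) \<and>
     (\<forall>k. \<exists>N.
        applied_to_increment \<Theta> P Q e \<beta> (\<lambda>\<omega>. B (u k \<omega>)) (real k * \<Delta>t) (real (Suc k) * \<Delta>t) N \<and>
        (AE \<omega> in P. u (Suc k) \<omega> \<in> maxwell_dom \<Theta> \<and>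
           u (Suc k) \<omega> - u k \<omega> =
             \<Delta>t *\<^sub>R maxwell \<Theta> (u (Suc k) \<omega>) - (\<sigma>0 * \<Delta>t) *\<^sub>R u (Suc k) \<omega>
             + \<Delta>t *\<^sub>R F (u (Suc k) \<omega>) + N \<omega>))"

text \<open>
  The scheme is time homogeneous, so its transition kernel is the law of \<open>u\<^sub>1\<close> for the solution
  started at the deterministic point \<open>x\<close>; this law does not depend on the version of the solution.
\<close>

definition euler_kernel ::
  "R3 set \<Rightarrow> 'w measure \<Rightarrow> (real \<Rightarrow> 'w measure) \<Rightarrow> (real L2 \<Rightarrow> real L2) \<Rightarrow> (nat \<Rightarrow> real L2) \<Rightarrow>
     (nat \<Rightarrow> real \<Rightarrow> 'w \<Rightarrow> real) \<Rightarrow> (field_pair \<Rightarrow> field_pair) \<Rightarrow>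
     (field_pair \<Rightarrow> real L2 \<Rightarrow> field_pair) \<Rightarrow> real \<Rightarrow> real \<Rightarrow> field_pair \<Rightarrow> field_pair measure" where
  "euler_kernel \<Theta> P Fil Q e \<beta> F B \<sigma>0 \<Delta>t x =
     (THE \<mu>. \<exists>u. euler_solution \<Theta> P Fil Q e \<beta> F B \<sigma>0 \<Delta>t (\<lambda>_. x) u \<and>
                 \<mu> = distr P (HH_borel \<Theta>) (u 1))"

definition markov_chain ::
  "'w measure \<Rightarrow> (nat \<Rightarrow> 'w measure) \<Rightarrow> 'h measure \<Rightarrow> ('h \<Rightarrow> 'h measure) \<Rightarrow>
     (nat \<Rightarrow> 'w \<Rightarrow> 'h) \<Rightarrow> bool" where
  "markov_chain P G X \<kappa> u \<longleftrightarrow>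
     \<kappa> \<in> measurable X (prob_algebra X) \<and> (\<forall>k. u k \<in> measurable (G k) X) \<and>
     (\<forall>k. \<forall>A\<in>sets X. AE \<omega> in P.
        real_cond_exp P (G k) (\<lambda>\<omega>'. indicator A (u (Suc k) \<omega>')) \<omega> = measure (\<kappa> (u k \<omega>)) A)"

definition invariant_measure :: "'h measure \<Rightarrow> ('h \<Rightarrow> 'h measure) \<Rightarrow> 'h measure \<Rightarrow> bool" where
  "invariant_measure X \<kappa> \<pi> \<longleftrightarrow> \<pi> \<in> space (prob_algebra X) \<and>
     (\<forall>A\<in>sets X. (\<integral>\<^sup>+x. emeasure (\<kappa> x) A \<partial>\<pi>) = emeasure \<pi> A)"

end

theory Submission
  imports Defs
begin

text \<open>
  By skew-symmetry of the Maxwell operator and the one-sided Lipschitz bound, the implicit part of a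
  step expands distances by the factor \<open>1 + (\<sigma>0 - \<alpha>F) \<Delta>t\<close>, while the noise increases mean square
  distances by at most \<open>1 + \<alpha>B\<^sup>2 \<Delta>t\<close>. Hence two solutions driven by the same noise contract in mean
  square. Tested against bounded Lipschitz functions, the kernel therefore forgets its starting point
  (uniqueness), and composing independent copies of the random one-step map in the reverse order gives
  an almost surely convergent sequence whose limit has an invariant law (existence).
\<close>

text \<open>Two obstacles shape the proof. The residual of the implicit step is known to expand
  distances, but its range is not at hand, so a step cannot be written as a measurable function of
  the old state and the noise: solutions are picked separately for each starting point, each up to a
  null set. Measurability in the starting point is recovered from Lipschitz dependence in mean
  square, through test functions for the kernel and through a dense sequence for the random map.
  Moreover, the noise term of a random state is an L2 limit and cannot be evaluated by freezing the
  state. The Markov property is therefore shown for noise truncated to finitely many coordinates,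
  where the dependence is explicit, and survives the limit once a test function composed with the
  inverse residual has been extended to the whole space. An invariant measure comes without moments,
  which is why all comparisons use bounded test functions. Borel measurability of all these maps
  rests on the fields forming a complete, second countable space.\<close>

section \<open>Almost sure convergence from geometrically decaying second moments\<close>

text \<open>The decay rate of the second moments is split in two: after division by
  \<open>r ^ n\<close> the squares still have summable integrals, so they are summable almost
  everywhere. The inequality between arithmetic and geometric mean then bounds \<open>d n x\<close>
  by \<open>r ^ n\<close> plus the weighted square.\<close>

lemma AE_summable_of_nn_integral_le:
  fixes d :: "nat \<Rightarrow> 'a \<Rightarrow> real"
  assumes [measurable]: "\<And>n. d n \<in> borel_measurable M" and nonneg: "\<And>n x. 0 \<le> d n x"
    and r: "0 < r" "r < 1" and C: "0 \<le> C"
    and le: "\<And>n. (\<integral>\<^sup>+x. ennreal ((d n x)\<^sup>2) \<partial>M) \<le> ennreal (C * (r ^ n)\<^sup>2)"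
  shows "AE x in M. summable (\<lambda>n. d n x)"
proof -
  let ?g = "\<lambda>n x. (d n x)\<^sup>2 / r ^ n"
  have "(\<integral>\<^sup>+x. (\<Sum>n. ennreal (?g n x)) \<partial>M) = (\<Sum>n. \<integral>\<^sup>+x. ennreal (?g n x) \<partial>M)"
    by (rule nn_integral_suminf) measurable
  also have "\<dots> \<le> (\<Sum>n. ennreal (C * r ^ n))"
  proof (intro suminf_le summableI)
    fix n
    have "(\<integral>\<^sup>+x. ennreal (?g n x) \<partial>M) = (\<integral>\<^sup>+x. ennreal (1 / r ^ n) * ennreal ((d n x)\<^sup>2) \<partial>M)"
      using r by (intro nn_integral_cong) (simp flip: ennreal_mult)
    also have "\<dots> = ennreal (1 / r ^ n) * (\<integral>\<^sup>+x. ennreal ((d n x)\<^sup>2) \<partial>M)"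
      by (rule nn_integral_cmult) measurable
    also have "\<dots> \<le> ennreal (1 / r ^ n) * ennreal (C * (r ^ n)\<^sup>2)"
      by (rule mult_left_mono[OF le]) simp
    also have "\<dots> = ennreal (C * r ^ n)"
      using r C by (simp add: power2_eq_square flip: ennreal_mult)
    finally show "(\<integral>\<^sup>+x. ennreal (?g n x) \<partial>M) \<le> ennreal (C * r ^ n)" .
  qed
  also have "\<dots> < \<infinity>"
  proof -
    have "summable (\<lambda>n. C * r ^ n)" using r by (intro summable_mult summable_geometric) auto
    then show ?thesis using C r by (subst suminf_ennreal2) auto
  qed
  finally have fin: "(\<integral>\<^sup>+x. (\<Sum>n. ennreal (?g n x)) \<partial>M) \<noteq> \<infinity>" by simp
  have "AE x in M. (\<Sum>n. ennreal (?g n x)) \<noteq> \<infinity>"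
    by (rule nn_integral_PInf_AE[OF _ fin]) measurable
  then show ?thesis
  proof eventually_elim
    fix x assume "(\<Sum>n. ennreal (?g n x)) \<noteq> \<infinity>"
    then have "summable (\<lambda>n. ?g n x)"
      using r by (intro summable_suminf_not_top) auto
    then have s: "summable (\<lambda>n. r ^ n + ?g n x)"
      using r by (intro summable_add summable_geometric) auto
    have "norm (d n x) \<le> r ^ n + ?g n x" for n
    proof -
      have rn: "0 < r ^ n" using r by simp
      have "0 \<le> d n x * r ^ n" using rn nonneg[of n x] by simp
      then have "d n x * r ^ n \<le> r ^ n * r ^ n + (d n x)\<^sup>2"
        using sum_squares_bound[of "d n x" "r ^ n"] unfolding power2_eq_square by linarith
      then have "d n x \<le> (r ^ n * r ^ n + (d n x)\<^sup>2) / r ^ n"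
        using rn by (simp add: pos_le_divide_eq)
      then show ?thesis using rn r nonneg[of n x] by (simp add: add_divide_distrib)
    qed
    then show "summable (\<lambda>n. d n x)" by (intro summable_comparison_test'[OF s]) auto
  qed
qed

lemma convergent_if_summable_norm_diff:
  fixes f :: "nat \<Rightarrow> 'b::banach"
  assumes "summable (\<lambda>n. norm (f (Suc n) - f n))"
  shows "convergent f"
proof -
  have "summable (\<lambda>n. f (Suc n) - f n)" by (rule summable_norm_cancel[OF assms])
  then have "convergent (\<lambda>n. \<Sum>i<n. f (Suc i) - f i)" by (simp add: summable_iff_convergent)
  then have "convergent (\<lambda>n. f n - f 0)" by (simp add: sum_lessThan_telescope)
  then have "convergent (\<lambda>n. (f n - f 0) + f 0)" by (intro convergent_add convergent_const)
  then show ?thesis by simp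
qed

text \<open>Serves twice: with \<open>r = 1/2\<close> for the completeness of L2, and with the
  contraction rate for the backward iterates.\<close>

lemma AE_convergent_of_nn_integral_le:
  fixes f :: "nat \<Rightarrow> 'a \<Rightarrow> 'b::{banach, second_countable_topology}"
  assumes [measurable]: "\<And>n. f n \<in> borel_measurable M"
    and r: "0 < r" "r < 1" "0 \<le> C"
    and le: "\<And>n. (\<integral>\<^sup>+x. ennreal ((norm (f (Suc n) x - f n x))\<^sup>2) \<partial>M) \<le> ennreal (C * (r ^ n)\<^sup>2)"
  shows "AE x in M. convergent (\<lambda>n. f n x)"
proof -
  have "AE x in M. summable (\<lambda>n. norm (f (Suc n) x - f n x))"
    by (rule AE_summable_of_nn_integral_le[OF _ _ r le]) auto
  then show ?thesis by eventually_elim (rule convergent_if_summable_norm_diff)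
qed


subsection \<open>The space of square integrable fields is Polish\<close>

lemma L2_fun_square_integrable: "square_integrable (L2_fun v)"
  using Quotient3_rep_reflp[OF Quotient3_L2, of v] by (simp add: L2_fun_def L2_eq_def)

lemma abs_L2_fun: "abs_L2 (L2_fun v) = v"
  using Quotient3_abs_rep[OF Quotient3_L2, of v] by (simp add: L2_fun_def)

lemma L2_fun_abs:
  assumes "square_integrable f"
  shows "AE x in lebesgue. L2_fun (abs_L2 f) x = f x"
  using Quotient3_rep_abs[OF Quotient3_L2, of f] assms by (simp add: L2_fun_def L2_eq_def)

lemma abs_L2_add:
  assumes "square_integrable f" "square_integrable g"
  shows "abs_L2 f + abs_L2 g = abs_L2 (\<lambda>x. f x + g x)"
  using assms by (intro plus_L2.abs_eq) (auto simp: L2_eq_def)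

lemma abs_L2_diff:
  assumes "square_integrable f" "square_integrable g"
  shows "abs_L2 f - abs_L2 g = abs_L2 (\<lambda>x. f x - g x)"
  using assms by (intro minus_L2.abs_eq) (auto simp: L2_eq_def)

lemma abs_L2_scaleR:
  assumes "square_integrable f"
  shows "c *\<^sub>R abs_L2 f = abs_L2 (\<lambda>x. c *\<^sub>R f x)"
  using assms by (intro scaleR_L2.abs_eq) (auto simp: L2_eq_def)

lemma L2_fun_measurable [measurable]: "L2_fun v \<in> borel_measurable lebesgue"
  using L2_fun_square_integrable[of v] by (simp add: square_integrable_def)

lemma L2_fun_diff: "AE x in lebesgue. L2_fun (v - w) x = L2_fun v x - L2_fun w x"
  using L2_fun_abs[OF square_integrable_diff[OF L2_fun_square_integrable L2_fun_square_integrable], of v w]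
    abs_L2_diff[OF L2_fun_square_integrable L2_fun_square_integrable, of v w]
  by (simp add: abs_L2_fun)

lemma norm_abs_L2:
  assumes "square_integrable f"
  shows "ennreal ((norm (abs_L2 f))\<^sup>2) = (\<integral>\<^sup>+x. ennreal ((norm (f x))\<^sup>2) \<partial>lebesgue)"
proof -
  have "(norm (abs_L2 f))\<^sup>2 = abs_L2 f \<bullet> abs_L2 f" by (simp add: power2_norm_eq_inner)
  also have "\<dots> = (LINT x|lebesgue. f x \<bullet> f x)"
    using assms by (intro inner_L2.abs_eq) (auto simp: L2_eq_def)
  also have "\<dots> = (LINT x|lebesgue. (norm (f x))\<^sup>2)" by (simp add: power2_norm_eq_inner)
  finally show ?thesis
    using assms by (subst nn_integral_eq_integral) (auto simp: square_integrable_def)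
qed

lemma norm_L2_fun: "ennreal ((norm v)\<^sup>2) = (\<integral>\<^sup>+x. ennreal ((norm (L2_fun v x))\<^sup>2) \<partial>lebesgue)"
  using norm_abs_L2[OF L2_fun_square_integrable, of v] by (simp add: abs_L2_fun)

text \<open>With nonnegative integrals, Fatou's lemma and comparison apply before integrability is
  known.\<close>

lemma square_integrable_iff_nn_integral:
  "square_integrable f \<longleftrightarrow> f \<in> borel_measurable lebesgue \<and>
     (\<integral>\<^sup>+x. ennreal ((norm (f x))\<^sup>2) \<partial>lebesgue) < \<infinity>"
proof -
  have "(\<lambda>x. (norm (f x))\<^sup>2) \<in> borel_measurable lebesgue" if "f \<in> borel_measurable lebesgue"
    using that by measurable
  then show ?thesis by (auto simp: square_integrable_def integrable_iff_bounded)
qed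

lemma tendsto_L2I:
  assumes "\<And>n. square_integrable (f n)" "square_integrable g"
    and lim: "(\<lambda>n. \<integral>\<^sup>+x. ennreal ((norm (f n x - g x))\<^sup>2) \<partial>lebesgue) \<longlonglongrightarrow> 0"
  shows "(\<lambda>n. abs_L2 (f n)) \<longlonglongrightarrow> abs_L2 g"
proof -
  have "(\<lambda>n. ennreal ((norm (abs_L2 (f n) - abs_L2 g))\<^sup>2)) \<longlonglongrightarrow> ennreal 0"
    using lim assms by (simp add: abs_L2_diff norm_abs_L2 square_integrable_diff)
  then have "(\<lambda>n. (norm (abs_L2 (f n) - abs_L2 g))\<^sup>2) \<longlonglongrightarrow> 0"
    by (subst (asm) tendsto_ennreal_iff) auto
  then have "(\<lambda>n. sqrt ((norm (abs_L2 (f n) - abs_L2 g))\<^sup>2)) \<longlonglongrightarrow> sqrt 0" by (rule tendsto_real_sqrt)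
  then have "(\<lambda>n. norm (abs_L2 (f n) - abs_L2 g)) \<longlonglongrightarrow> 0" by simp
  then show ?thesis by (simp add: LIM_zero_iff tendsto_norm_zero_iff)
qed

text \<open>Riesz-Fischer: a rapidly Cauchy subsequence has representatives that converge almost
  everywhere, Fatou's lemma turns the pointwise limit into a mean square limit, and a Cauchy
  sequence with a convergent subsequence converges.\<close>

instance L2 :: (euclidean_space) complete_space
proof
  fix X :: "nat \<Rightarrow> 'a L2" assume X: "Cauchy X"
  have "\<exists>N. \<forall>m\<ge>N. \<forall>k\<ge>N. norm (X m - X k) < (1/2)^n" for n :: nat
    using X unfolding Cauchy_def dist_norm by (auto dest: spec[of _ "(1/2)^n"])
  then obtain N where N: "\<And>n m k. m \<ge> N n \<Longrightarrow> k \<ge> N n \<Longrightarrow> norm (X m - X k) < (1/2)^n"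
    by metis
  \<comment> \<open>The thresholds \<open>N n\<close> need not increase. Adding \<open>n\<close> and
    all earlier thresholds makes \<open>r\<close> strictly increasing while \<open>r n\<close> still
    dominates \<open>N n\<close>.\<close>
  define r where "r n = n + (\<Sum>i\<le>n. N i)" for n
  have r: "strict_mono r" by (rule strict_monoI_Suc) (simp add: r_def)
  have rN: "N n \<le> r n" for n
    unfolding r_def by (simp add: trans_le_add2 member_le_sum)
  have rm: "r n \<le> r m" if "n \<le> m" for n m using r that by (simp add: strict_mono_less_eq)
  have cl: "norm (X (r m) - X (r n)) \<le> (1/2)^n" if "n \<le> m" for n m
    using N[of n "r m" "r n"] rN[of n] rm[OF that] by simp
  define f where "f n = L2_fun (X (r n))" for n
  have fs: "square_integrable (f n)" for n by (simp add: f_def L2_fun_square_integrable)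
  then have [measurable]: "f n \<in> borel_measurable lebesgue" for n by (simp add: square_integrable_def)
  have fX: "abs_L2 (f n) = X (r n)" for n by (simp add: f_def abs_L2_fun)
  have fd: "(\<integral>\<^sup>+x. ennreal ((norm (f m x - f n x))\<^sup>2) \<partial>lebesgue) = ennreal ((norm (X (r m) - X (r n)))\<^sup>2)" for m n
    using norm_abs_L2[OF square_integrable_diff[OF fs fs], of m n]
    by (simp add: fX flip: abs_L2_diff[OF fs fs])
  have fd_le: "(\<integral>\<^sup>+x. ennreal ((norm (f m x - f n x))\<^sup>2) \<partial>lebesgue) \<le> ennreal (((1/2)^n)\<^sup>2)" if "n \<le> m" for m n
    unfolding fd by (intro ennreal_leI power_mono cl that) simp
  have conv: "AE x in lebesgue. convergent (\<lambda>n. f n x)"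
    using fd_le by (intro AE_convergent_of_nn_integral_le[of _ _ "1/2" 1]) auto
  define g where "g x = lim (\<lambda>n. f n x)" for x
  have [measurable]: "g \<in> borel_measurable lebesgue" unfolding g_def by measurable
  have lim: "AE x in lebesgue. (\<lambda>n. f n x) \<longlonglongrightarrow> g x"
    using conv unfolding g_def by eventually_elim (simp add: convergent_LIMSEQ_iff)
  \<comment> \<open>Fatou's lemma in \<open>m\<close> with \<open>n\<close> fixed. The bound at
    \<open>n = 0\<close> also yields that \<open>g\<close> is square integrable, as
    \<open>f 0\<close> minus a square integrable function.\<close>
  have gn: "(\<integral>\<^sup>+x. ennreal ((norm (f n x - g x))\<^sup>2) \<partial>lebesgue) \<le> ennreal (((1/2)^n)\<^sup>2)" for n
  proof -
    have "(\<integral>\<^sup>+x. ennreal ((norm (f n x - g x))\<^sup>2) \<partial>lebesgue) =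
        (\<integral>\<^sup>+x. liminf (\<lambda>m. ennreal ((norm (f m x - f n x))\<^sup>2)) \<partial>lebesgue)"
    proof (rule nn_integral_cong_AE, use lim in eventually_elim)
      fix x assume "(\<lambda>n. f n x) \<longlonglongrightarrow> g x"
      then have "(\<lambda>m. ennreal ((norm (f m x - f n x))\<^sup>2)) \<longlonglongrightarrow> ennreal ((norm (g x - f n x))\<^sup>2)"
        by (intro tendsto_intros)
      then show "ennreal ((norm (f n x - g x))\<^sup>2) = liminf (\<lambda>m. ennreal ((norm (f m x - f n x))\<^sup>2))"
        by (simp only: lim_imp_Liminf[OF sequentially_bot] norm_minus_commute)
    qed
    also have "\<dots> \<le> liminf (\<lambda>m. \<integral>\<^sup>+x. ennreal ((norm (f m x - f n x))\<^sup>2) \<partial>lebesgue)"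
      by (rule nn_integral_liminf) measurable
    also have "\<dots> \<le> ennreal (((1/2)^n)\<^sup>2)"
      by (rule Liminf_le) (auto intro!: eventually_sequentiallyI[of n] fd_le)
    finally show ?thesis .
  qed
  have "square_integrable (\<lambda>x. f 0 x - g x)"
    using gn[of 0] by (auto simp: square_integrable_iff_nn_integral intro: le_less_trans)
  from square_integrable_diff[OF fs[of 0] this] have gs: "square_integrable g" by simp
  have "(\<lambda>n. ennreal (((1/2)^n)\<^sup>2)) \<longlonglongrightarrow> ennreal (0\<^sup>2)"
    by (intro tendsto_intros LIMSEQ_realpow_zero) auto
  then have "(\<lambda>n. ennreal (((1/2)^n)\<^sup>2)) \<longlonglongrightarrow> 0" by simp
  from tendsto_sandwich[OF _ _ tendsto_const this] gn
  have "(\<lambda>n. \<integral>\<^sup>+x. ennreal ((norm (f n x - g x))\<^sup>2) \<partial>lebesgue) \<longlonglongrightarrow> 0" by auto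
  from tendsto_L2I[OF fs gs this] have "(X \<circ> r) \<longlonglongrightarrow> abs_L2 g" by (simp add: fX comp_def)
  from Cauchy_converges_subseq[OF X r this] show "convergent X" by (rule convergentI)
qed

instance L2 :: (euclidean_space) banach ..


section \<open>Separability and second countability of L2\<close>

lemma abs_L2_sum:
  assumes "finite I" "\<And>i. i \<in> I \<Longrightarrow> square_integrable (f i)"
  shows "square_integrable (\<lambda>x. \<Sum>i\<in>I. f i x) \<and> abs_L2 (\<lambda>x. \<Sum>i\<in>I. f i x) = (\<Sum>i\<in>I. abs_L2 (f i))"
  using assms
proof (induction I rule: finite_induct)
  case empty
  then show ?case by (simp add: square_integrable_zero zero_L2.abs_eq L2_eq_def zero_L2_def)
next
  case (insert i I)
  then have "square_integrable (f i)" and *: "square_integrable (\<lambda>x. \<Sum>i\<in>I. f i x)"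
      "abs_L2 (\<lambda>x. \<Sum>i\<in>I. f i x) = (\<Sum>i\<in>I. abs_L2 (f i))" by auto
  then show ?case
    using insert.hyps abs_L2_add[of "f i" "\<lambda>x. \<Sum>i\<in>I. f i x"] by (simp add: square_integrable_add)
qed

lemma square_integrable_indicator:
  assumes "A \<in> sets lebesgue" "emeasure lebesgue A < \<infinity>"
  shows "square_integrable (\<lambda>x. indicator A x *\<^sub>R y)"
proof -
  have "(\<integral>\<^sup>+x. ennreal ((norm (indicator A x *\<^sub>R y))\<^sup>2) \<partial>lebesgue) =
      (\<integral>\<^sup>+x. ennreal ((norm y)\<^sup>2) * indicator A x \<partial>lebesgue)"
    by (intro nn_integral_cong) (auto split: split_indicator)
  also have "\<dots> < \<infinity>" using assms by (simp add: nn_integral_cmult_indicator ennreal_mult_less_top)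
  finally show ?thesis using assms(1) by (auto simp: square_integrable_iff_nn_integral)
qed

text \<open>The squared distance of the two classes is the squared norm of \<open>y\<close> times
  the measure of the symmetric difference.\<close>

lemma tendsto_L2_indicator:
  assumes A: "A \<in> sets lebesgue" "emeasure lebesgue A < \<infinity>"
    and B: "\<And>n. B n \<in> sets lebesgue" "\<And>n. emeasure lebesgue (B n) < \<infinity>"
    and lim: "(\<lambda>n. emeasure lebesgue ((A - B n) \<union> (B n - A))) \<longlonglongrightarrow> 0"
  shows "(\<lambda>n. abs_L2 (\<lambda>x. indicator (B n) x *\<^sub>R y)) \<longlonglongrightarrow> abs_L2 (\<lambda>x. indicator A x *\<^sub>R y)"
proof (rule tendsto_L2I)
  have "(\<integral>\<^sup>+x. ennreal ((norm (indicator (B n) x *\<^sub>R y - indicator A x *\<^sub>R y))\<^sup>2) \<partial>lebesgue) =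
      ennreal ((norm y)\<^sup>2) * emeasure lebesgue ((A - B n) \<union> (B n - A))" for n
  proof -
    have "(\<integral>\<^sup>+x. ennreal ((norm (indicator (B n) x *\<^sub>R y - indicator A x *\<^sub>R y))\<^sup>2) \<partial>lebesgue) =
        (\<integral>\<^sup>+x. ennreal ((norm y)\<^sup>2) * indicator ((A - B n) \<union> (B n - A)) x \<partial>lebesgue)"
      by (intro nn_integral_cong) (auto split: split_indicator)
    also have "\<dots> = ennreal ((norm y)\<^sup>2) * emeasure lebesgue ((A - B n) \<union> (B n - A))"
      using A B by (intro nn_integral_cmult_indicator) auto
    finally show ?thesis .
  qed
  then have eq: "(\<lambda>n. \<integral>\<^sup>+x. ennreal ((norm (indicator (B n) x *\<^sub>R y - indicator A x *\<^sub>R y))\<^sup>2) \<partial>lebesgue) =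
      (\<lambda>n. ennreal ((norm y)\<^sup>2) * emeasure lebesgue ((A - B n) \<union> (B n - A)))" by auto
  have "(\<lambda>n. ennreal ((norm y)\<^sup>2) * emeasure lebesgue ((A - B n) \<union> (B n - A)))
      \<longlonglongrightarrow> ennreal ((norm y)\<^sup>2) * 0"
    by (rule ennreal_tendsto_cmult[OF _ lim]) simp
  then show "(\<lambda>n. \<integral>\<^sup>+x. ennreal ((norm (indicator (B n) x *\<^sub>R y - indicator A x *\<^sub>R y))\<^sup>2) \<partial>lebesgue) \<longlonglongrightarrow> 0"
    unfolding eq by simp
qed (intro square_integrable_indicator A B)+

text \<open>\<open>D\<close> consists of the rational linear combinations of \<open>C\<close>.
  Coding them as lists of coefficient-index pairs makes countability immediate, addition
  concatenation, and rational scaling a \<open>map\<close>; density of the rationals gives real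
  scalars in the closure.\<close>

lemma countable_dense_in_span:
  fixes C :: "'a::real_normed_vector set"
  assumes "countable C"
  obtains D where "countable D" "subspace (closure D)" "C \<subseteq> closure D"
proof -
  \<comment> \<open>The inserted 0 makes the enumerated set nonempty, so an empty \<open>C\<close>
    needs no separate case.\<close>
  define c where "c = from_nat_into (insert 0 C)"
  have c: "C \<subseteq> range c"
    using assms range_from_nat_into[of "insert 0 C"] by (auto simp: c_def)
  define S :: "(rat \<times> nat) list \<Rightarrow> 'a" where "S l = (\<Sum>(q, i)\<leftarrow>l. real_of_rat q *\<^sub>R c i)" for l
  have S_scale: "S (map (\<lambda>(p, i). (q * p, i)) l) = real_of_rat q *\<^sub>R S l" for q l
    by (induction l) (auto simp: S_def scaleR_add_right of_rat_mult)
  have "subspace (closure (range S))"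
  proof (rule subspaceI)
    have "0 = S []" by (simp add: S_def)
    then have "0 \<in> range S" by simp
    then show "0 \<in> closure (range S)" using closure_subset[of "range S"] by force
  next
    fix x y assume x: "x \<in> closure (range S)" and y: "y \<in> closure (range S)"
    from x obtain f where f: "\<forall>n. f n \<in> range S" "f \<longlonglongrightarrow> x" by (auto simp: closure_sequential)
    from y obtain g where g: "\<forall>n. g n \<in> range S" "g \<longlonglongrightarrow> y" by (auto simp: closure_sequential)
    have "u + v \<in> range S" if uv: "u \<in> range S" "v \<in> range S" for u v
    proof -
      obtain l where l: "u = S l" using uv(1) by (rule rangeE)
      obtain m where m: "v = S m" using uv(2) by (rule rangeE)
      have "u + v = S (l @ m)" unfolding l m by (simp add: S_def)
      then show ?thesis by simp
    qed
    then have "\<forall>n. f n + g n \<in> range S" using f g by simp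
    with tendsto_add[OF f(2) g(2)] show "x + y \<in> closure (range S)"
      unfolding closure_sequential by (intro exI[of _ "\<lambda>n. f n + g n"] conjI)
  next
    fix r :: real and x assume x: "x \<in> closure (range S)"
    from x obtain f where f: "\<forall>n. f n \<in> range S" "f \<longlonglongrightarrow> x" by (auto simp: closure_sequential)
    have "r \<in> closure \<rat>" by (simp add: Rats_closure_real)
    then obtain q where q: "\<forall>n. q n \<in> \<rat>" "q \<longlonglongrightarrow> r" unfolding closure_sequential by blast
    have "t *\<^sub>R u \<in> range S" if tu: "t \<in> \<rat>" "u \<in> range S" for t u
    proof -
      obtain l where l: "u = S l" using tu(2) by (rule rangeE)
      obtain p where p: "t = real_of_rat p" using tu(1) by (rule Rats_cases)
      show ?thesis unfolding l p S_scale[symmetric] by (rule rangeI)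
    qed
    then have "\<forall>n. q n *\<^sub>R f n \<in> range S" using f q by simp
    with tendsto_scaleR[OF q(2) f(2)] show "r *\<^sub>R x \<in> closure (range S)"
      unfolding closure_sequential by (intro exI[of _ "\<lambda>n. q n *\<^sub>R f n"] conjI)
  qed
  moreover have "C \<subseteq> closure (range S)"
  proof
    fix x assume "x \<in> C"
    then obtain i where "x = c i" using c by auto
    then have "x = S [(1, i)]" by (simp add: S_def)
    then have "x \<in> range S" by simp
    then show "x \<in> closure (range S)" using closure_subset[of "range S"] by force
  qed
  ultimately show ?thesis using that[of "range S"] by simp
qed

text \<open>Four approximations in a row: a field by simple functions, a simple function by
  combinations of indicators, a set of finite measure by open supersets (outer regularity), and an
  open set by finite unions of members of a countable base. Membership in \<open>closure D\<close>
  passes back along this chain.\<close>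

lemma L2_separable: "\<exists>D :: 'b::euclidean_space L2 set. countable D \<and> closure D = UNIV"
proof -
  obtain \<B> :: "R3 set set" where B: "countable \<B>" "topological_basis \<B>"
    using ex_countable_basis by blast
  \<comment> \<open>A finite union may have infinite measure, and then its class is an arbitrary
    element of L2. This is harmless: the approximation below only picks unions that lie inside a set
    of finite measure.\<close>
  define C where "C = (\<lambda>(F, b). abs_L2 (\<lambda>x. indicator (\<Union>F) x *\<^sub>R b :: 'b)) ` ({F. finite F \<and> F \<subseteq> \<B>} \<times> Basis)"
  have "countable {F. finite F \<and> F \<subseteq> \<B>}" using countable_Collect_finite_subset[OF B(1)] by simp
  then have "countable C" unfolding C_def by (intro countable_image countable_SIGMA countable_finite[of Basis]) auto
  then obtain D where D: "countable D" "subspace (closure D)" "C \<subseteq> closure D"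
    by (rule countable_dense_in_span)
  have lim_D: "x \<in> closure D" if "f \<longlonglongrightarrow> x" "\<And>n. f n \<in> closure D" for f x
    using that closed_sequentially[of "closure D" f x] by auto
  have open_D: "abs_L2 (\<lambda>x. indicator U x *\<^sub>R b) \<in> closure D"
    if U: "open U" "emeasure lebesgue U < \<infinity>" and b: "b \<in> Basis" for U and b :: 'b
  proof -
    obtain B' where B': "B' \<subseteq> \<B>" "\<Union>B' = U" using B(2) U(1) unfolding topological_basis_def by blast
    \<comment> \<open>Inserting the empty set covers an empty or finite \<open>B'\<close> without
      changing the union.\<close>
    define h where "h = from_nat_into (insert {} B')"
    have cB': "countable B'" using B(1) B'(1) countable_subset by blast
    have h: "range h = insert {} B'" using cB' by (auto simp: h_def range_from_nat_into)
    define V where "V n = \<Union>(h ` {..<n})" for n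
    have openh: "open (h i)" for i
    proof -
      have "h i \<in> insert {} B'" using h by blast
      then have "h i = {} \<or> h i \<in> \<B>" using B'(1) by blast
      then show ?thesis using topological_basis_open[OF B(2), of "h i"] by (elim disjE) simp_all
    qed
    have Vs [measurable]: "V n \<in> sets lebesgue" for n
      unfolding V_def using openh by (intro sets_completionI_sets) (auto intro!: borel_open)
    have hU: "h i \<subseteq> U" for i
    proof -
      have "h i \<in> insert {} B'" using h by blast
      then show ?thesis using B'(2) by blast
    qed
    then have VU: "V n \<subseteq> U" for n by (auto simp: V_def)
    have inc: "incseq V" by (fastforce simp: V_def incseq_def)
    have UV: "(\<Union>n. V n) = U"
    proof
      show "U \<subseteq> (\<Union>n. V n)"
      proof
        fix x assume "x \<in> U"
        then obtain b where "b \<in> B'" "x \<in> b" using B'(2) by blast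
        then have "b \<in> range h" using h by blast
        then obtain i where "x \<in> h i" using \<open>x \<in> b\<close> by blast
        then have "x \<in> V (Suc i)" by (auto simp: V_def)
        then show "x \<in> (\<Union>n. V n)" by blast
      qed
    qed (use VU in auto)
    have Um [measurable]: "U \<in> sets lebesgue" using U(1) by (simp add: sets_completionI_sets)
    have "(\<lambda>n. emeasure lebesgue (U - V n)) \<longlonglongrightarrow> emeasure lebesgue (\<Inter>n. U - V n)"
    proof (rule Lim_emeasure_decseq)
      show "decseq (\<lambda>n. U - V n)" using inc by (fastforce simp: decseq_def incseq_def)
      show "emeasure lebesgue (U - V n) \<noteq> \<infinity>" for n
      proof -
        have "emeasure lebesgue (U - V n) \<le> emeasure lebesgue U" by (intro emeasure_mono Um) auto
        with U(2) show ?thesis by auto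
      qed
    qed (use Um Vs in auto)
    moreover have "(\<Inter>n. U - V n) = {}" using UV by auto
    moreover have "(U - V n) \<union> (V n - U) = U - V n" for n using VU by auto
    ultimately have "(\<lambda>n. emeasure lebesgue ((U - V n) \<union> (V n - U))) \<longlonglongrightarrow> 0"
      by (simp only: emeasure_empty)
    moreover have "emeasure lebesgue (V n) < \<infinity>" for n
      using le_less_trans[OF emeasure_mono[OF VU[of n] Um] U(2)] .
    ultimately have "(\<lambda>n. abs_L2 (\<lambda>x. indicator (V n) x *\<^sub>R b)) \<longlonglongrightarrow> abs_L2 (\<lambda>x. indicator U x *\<^sub>R b)"
      using U by (intro tendsto_L2_indicator) auto
    moreover have "abs_L2 (\<lambda>x. indicator (V n) x *\<^sub>R b) \<in> closure D" for n
    proof -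
      \<comment> \<open>The empty set inserted into the enumeration need not belong to the base, so
        it is taken out again before membership in \<open>C\<close> is claimed.\<close>
      have "V n = \<Union>(h ` {..<n} - {{}})" by (auto simp: V_def)
      moreover have "h ` {..<n} - {{}} \<subseteq> \<B>" using h B'(1) by auto
      ultimately have "abs_L2 (\<lambda>x. indicator (V n) x *\<^sub>R b) \<in> C"
        using b unfolding C_def by (intro image_eqI[of _ _ "(h ` {..<n} - {{}}, b)"]) auto
      then show ?thesis using D(3) by blast
    qed
    ultimately show ?thesis by (rule lim_D)
  qed
  have ind_D: "abs_L2 (\<lambda>x. indicator A x *\<^sub>R b) \<in> closure D"
    if A: "A \<in> sets lebesgue" "emeasure lebesgue A < \<infinity>" and b: "b \<in> Basis" for A and b :: 'b
  proof -
    have "\<exists>T. open T \<and> A \<subseteq> T \<and> emeasure lebesgue (T - A) < ennreal (1 / Suc n)" for n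
    proof -
      obtain T where "open T" "A \<subseteq> T" "emeasure lebesgue (T - A) < ennreal (1 / Suc n)"
        using sets_lebesgue_outer_open[OF A(1), of "1 / Suc n"] of_nat_0_less_iff zero_less_Suc
        by (metis divide_pos_pos zero_less_one)
      then show ?thesis by (intro exI[of _ T] conjI)
    qed
    then obtain T where T: "\<And>n. open (T n)" "\<And>n. A \<subseteq> T n"
        "\<And>n. emeasure lebesgue (T n - A) < ennreal (1 / Suc n)" by metis
    have [measurable]: "T n \<in> sets lebesgue" for n using T(1) by (simp add: sets_completionI_sets)
    have fin: "emeasure lebesgue (T n) < \<infinity>" for n
    proof -
      have "emeasure lebesgue (T n) = emeasure lebesgue (A \<union> (T n - A))"
        using T(2)[of n] by (simp add: Un_absorb1)
      also have "\<dots> \<le> emeasure lebesgue A + emeasure lebesgue (T n - A)"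
        using A by (intro emeasure_subadditive) auto
      also have "\<dots> < \<infinity>" using A(2) T(3)[of n] by (auto simp: less_top[symmetric] ennreal_add_eq_top)
      finally show ?thesis .
    qed
    have "(\<lambda>n. ennreal (1 / Suc n)) \<longlonglongrightarrow> ennreal 0"
      by (intro tendsto_ennrealI lim_inverse_n' LIMSEQ_Suc)
    then have z: "(\<lambda>n. ennreal (1 / Suc n)) \<longlonglongrightarrow> 0" by simp
    have "(A - T n) \<union> (T n - A) = T n - A" for n using T(2)[of n] by auto
    then have "(\<lambda>n. emeasure lebesgue ((A - T n) \<union> (T n - A))) \<longlonglongrightarrow> 0"
      using less_imp_le[OF T(3)]
      by (intro tendsto_sandwich[OF always_eventually always_eventually tendsto_const z] allI) simp_all
    then have "(\<lambda>n. abs_L2 (\<lambda>x. indicator (T n) x *\<^sub>R b)) \<longlonglongrightarrow> abs_L2 (\<lambda>x. indicator A x *\<^sub>R b)"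
      using A fin by (intro tendsto_L2_indicator) auto
    then show ?thesis by (rule lim_D) (intro open_D T(1) fin b)
  qed
  have ind_D': "abs_L2 (\<lambda>x. indicator A x *\<^sub>R y) \<in> closure D"
    if A: "A \<in> sets lebesgue" "emeasure lebesgue A < \<infinity>" for A and y :: 'b
  proof -
    have s: "square_integrable (\<lambda>x. (y \<bullet> b) *\<^sub>R indicator A x *\<^sub>R b)" for b
      by (intro square_integrable_scaleR square_integrable_indicator A)
    have "(\<lambda>x. indicator A x *\<^sub>R y) = (\<lambda>x. \<Sum>b\<in>Basis. (y \<bullet> b) *\<^sub>R indicator A x *\<^sub>R b)"
      by (subst (1) euclidean_representation[of y, symmetric])
        (simp add: scaleR_sum_right mult.commute)
    then have "abs_L2 (\<lambda>x. indicator A x *\<^sub>R y) = (\<Sum>b\<in>Basis. abs_L2 (\<lambda>x. (y \<bullet> b) *\<^sub>R indicator A x *\<^sub>R b))"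
      using abs_L2_sum[of Basis "\<lambda>b x. (y \<bullet> b) *\<^sub>R indicator A x *\<^sub>R b"] s by simp
    also have "\<dots> = (\<Sum>b\<in>Basis. (y \<bullet> b) *\<^sub>R abs_L2 (\<lambda>x. indicator A x *\<^sub>R b))"
      by (intro sum.cong refl abs_L2_scaleR[symmetric] square_integrable_indicator A)
    also have "\<dots> \<in> closure D"
      using D(2) ind_D[OF A] by (intro subspace_sum subspace_scale) auto
    finally show ?thesis .
  qed
  have "v \<in> closure D" for v :: "'b L2"
  proof -
    let ?f = "L2_fun v"
    have fs: "square_integrable ?f" by (rule L2_fun_square_integrable)
    obtain s where s: "\<And>i. simple_function lebesgue (s i)" "\<And>x. (\<lambda>i. s i x) \<longlonglongrightarrow> ?f x"
        "\<And>i x. norm (s i x) \<le> 2 * norm (?f x)"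
      using borel_measurable_implies_sequence_metric[OF L2_fun_measurable[of v], of 0] by auto
    have sm [measurable]: "s i \<in> borel_measurable lebesgue" for i
      using s(1) by (rule borel_measurable_simple_function)
    have fint: "(\<integral>\<^sup>+x. ennreal ((norm (?f x))\<^sup>2) \<partial>lebesgue) < \<infinity>"
      using fs by (simp add: square_integrable_iff_nn_integral)
    have s_le: "(norm (s i x))\<^sup>2 \<le> 4 * (norm (?f x))\<^sup>2" for i x
      using power_mono[OF s(3)[of i x], of 2] by simp
    have dom: "(\<integral>\<^sup>+x. ennreal (c * (norm (?f x))\<^sup>2) \<partial>lebesgue) < \<infinity>" if "c \<ge> 0" for c
      using that fint by (simp add: ennreal_mult nn_integral_cmult ennreal_mult_less_top)
    have ssq: "square_integrable (s i)" for i
    proof -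
      have "(\<integral>\<^sup>+x. ennreal ((norm (s i x))\<^sup>2) \<partial>lebesgue) \<le> (\<integral>\<^sup>+x. ennreal (4 * (norm (?f x))\<^sup>2) \<partial>lebesgue)"
        by (intro nn_integral_mono ennreal_leI s_le)
      also have "\<dots> < \<infinity>" by (rule dom) simp
      finally show ?thesis by (simp add: square_integrable_iff_nn_integral)
    qed
    \<comment> \<open>Dominated convergence. The constant 9 is the square of 2 + 1, because the
      simple functions were chosen with norm at most twice that of the field.\<close>
    have "(\<lambda>i. \<integral>\<^sup>+x. ennreal ((norm (s i x - ?f x))\<^sup>2) \<partial>lebesgue) \<longlonglongrightarrow> (\<integral>\<^sup>+(x::R3). 0 \<partial>lebesgue)"
    proof (rule nn_integral_dominated_convergence[of
        "\<lambda>i x. ennreal ((norm (s i x - ?f x))\<^sup>2)" lebesgue "\<lambda>_. 0" "\<lambda>x. ennreal (9 * (norm (?f x))\<^sup>2)"])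
      show "AE x in lebesgue. ennreal ((norm (s i x - ?f x))\<^sup>2) \<le> ennreal (9 * (norm (?f x))\<^sup>2)" for i
      proof (intro AE_I2 ennreal_leI)
        fix x
        have "norm (s i x - ?f x) \<le> 3 * norm (?f x)"
          using norm_triangle_ineq4[of "s i x" "?f x"] s(3)[of i x] by linarith
        from power_mono[OF this, of 2] show "(norm (s i x - ?f x))\<^sup>2 \<le> 9 * (norm (?f x))\<^sup>2" by simp
      qed
      show "AE x in lebesgue. (\<lambda>i. ennreal ((norm (s i x - ?f x))\<^sup>2)) \<longlonglongrightarrow> 0"
      proof (rule AE_I2)
        fix x
        have "(\<lambda>i. ennreal ((norm (s i x - ?f x))\<^sup>2)) \<longlonglongrightarrow> ennreal ((norm (?f x - ?f x))\<^sup>2)"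
          by (intro tendsto_intros s(2))
        then show "(\<lambda>i. ennreal ((norm (s i x - ?f x))\<^sup>2)) \<longlonglongrightarrow> 0" by simp
      qed
    qed (use dom[of 9] in auto)
    then have "(\<lambda>i. abs_L2 (s i)) \<longlonglongrightarrow> abs_L2 ?f" using ssq fs by (intro tendsto_L2I) auto
    moreover have "abs_L2 (s i) \<in> closure D" for i
    proof -
      define A where "A y = s i -` {y}" for y
      have Am: "A y \<in> sets lebesgue" for y
        using simple_functionD(2)[OF s(1), of i "{y}"] by (simp add: A_def)
      have fin: "finite (range (s i))" using simple_functionD(1)[OF s(1), of i] by simp
      \<comment> \<open>Chebyshev's argument on a level set. It breaks down for the value 0, whose
        level set may have infinite measure but contributes the zero class.\<close>
      have Af: "emeasure lebesgue (A y) < \<infinity>" if "y \<noteq> 0" for y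
      proof -
        have "ennreal ((norm y)\<^sup>2) * emeasure lebesgue (A y) = (\<integral>\<^sup>+x. ennreal ((norm y)\<^sup>2) * indicator (A y) x \<partial>lebesgue)"
          using Am by (simp add: nn_integral_cmult_indicator)
        also have "\<dots> \<le> (\<integral>\<^sup>+x. ennreal ((norm (s i x))\<^sup>2) \<partial>lebesgue)"
          by (intro nn_integral_mono) (auto simp: A_def split: split_indicator)
        also have "\<dots> < \<infinity>" using ssq by (simp add: square_integrable_iff_nn_integral)
        finally show ?thesis using that by (auto simp: ennreal_mult_less_top)
      qed
      have sq: "square_integrable (\<lambda>x. indicator (A y) x *\<^sub>R y)" for y
        by (cases "y = 0") (auto simp: square_integrable_zero intro!: square_integrable_indicator Am Af)
      have "s i = (\<lambda>x. \<Sum>y\<in>range (s i). indicator (A y) x *\<^sub>R y)"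
      proof
        fix x
        have "(\<Sum>y\<in>range (s i). indicator (A y) x *\<^sub>R y) = (\<Sum>y\<in>range (s i). if y = s i x then y else 0)"
          by (intro sum.cong) (auto simp: A_def split: split_indicator)
        then show "s i x = (\<Sum>y\<in>range (s i). indicator (A y) x *\<^sub>R y)" using fin by simp
      qed
      then have "abs_L2 (s i) = (\<Sum>y\<in>range (s i). abs_L2 (\<lambda>x. indicator (A y) x *\<^sub>R y))"
        using abs_L2_sum[of "range (s i)" "\<lambda>y x. indicator (A y) x *\<^sub>R y"] fin sq by simp
      also have "\<dots> \<in> closure D"
      proof (intro subspace_sum D(2))
        fix y
        show "abs_L2 (\<lambda>x. indicator (A y) x *\<^sub>R y) \<in> closure D"
        proof (cases "y = 0")
          case True
          then show ?thesis using subspace_0[OF D(2)] by (simp add: zero_L2_def)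
        next
          case False
          then show ?thesis by (intro ind_D' Am Af)
        qed
      qed
      finally show ?thesis .
    qed
    ultimately have "abs_L2 ?f \<in> closure D" by (rule lim_D)
    then show ?thesis by (simp add: abs_L2_fun)
  qed
  then show ?thesis using D(1) by blast
qed



lemma countable_basis_of_countable_dense:
  fixes D :: "'a::metric_space set"
  assumes D: "countable D" "closure D = UNIV"
  shows "\<exists>B::'a set set. countable B \<and> open = generate_topology B"
proof -
  let ?B = "(\<lambda>(x, n). ball x (1 / Suc n)) ` (D \<times> (UNIV :: nat set))"
  have "topological_basis ?B"
  proof (rule topological_basisI)
    fix U and x :: 'a assume U: "open U" "x \<in> U"
    then obtain e where e: "0 < e" "ball x e \<subseteq> U" using openE by blast
    obtain n where n: "1 / Suc n < e / 2" using e nat_approx_posE[of "e / 2"] by auto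
    have "x \<in> closure D" using D by simp
    then obtain y where y: "y \<in> D" "dist y x < 1 / Suc n"
      unfolding closure_approachable by (metis divide_pos_pos of_nat_0_less_iff zero_less_Suc zero_less_one)
    have "ball y (1 / Suc n) \<subseteq> ball x e"
    proof
      fix z assume "z \<in> ball y (1 / Suc n)"
      then show "z \<in> ball x e"
        using n y(2) dist_triangle[of x z y] by (simp add: dist_commute)
    qed
    then show "\<exists>B'\<in>?B. x \<in> B' \<and> B' \<subseteq> U" using y e by (intro bexI[of _ "ball y (1 / Suc n)"]) auto
  qed auto
  then show ?thesis
    using D(1) by (intro exI[of _ ?B]) (auto intro!: topological_basis_imp_subbasis)
qed

text \<open>Second countability makes sums, scalar multiples and norms of random fields Borel
  measurable. The product type \<open>field_pair\<close> inherits it, together with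
  completeness.\<close>

instance L2 :: (euclidean_space) second_countable_topology
proof
  obtain D :: "'a L2 set" where "countable D" "closure D = UNIV"
    using L2_separable by blast
  then show "\<exists>B::'a L2 set set. countable B \<and> open = generate_topology B"
    by (rule countable_basis_of_countable_dense)
qed

subsection \<open>Lipschitz test functions\<close>

text \<open>Multiples of the distance to the complement, cut off at 1, increase to the indicator
  because that distance is positive exactly on the open set.\<close>

lemma lipschitz_approx_open:
  fixes U :: "'a::metric_space set"
  assumes "open U"
  obtains g :: "nat \<Rightarrow> 'a \<Rightarrow> real" where "\<And>n. (real n)-lipschitz_on UNIV (g n)"
    "\<And>n x. 0 \<le> g n x" "\<And>n x. g n x \<le> 1" "\<And>x. incseq (\<lambda>n. ennreal (g n x))"
    "\<And>x. (SUP n. ennreal (g n x)) = indicator U x"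
proof (cases "U = UNIV")
  \<comment> \<open>\<open>infdist\<close> to the empty set is 0 by convention, so the general
    formula would give the zero function here.\<close>
  case True
  show ?thesis
    by (rule that[of "\<lambda>_ _. 1"]) (auto simp: True incseq_def intro: lipschitz_onI)
next
  case False
  define g where "g n x = min 1 (real n * infdist x (- U))" for n x
  show ?thesis
  proof (rule that[of g])
    show "(real n)-lipschitz_on UNIV (g n)" for n
    proof (rule lipschitz_onI)
      fix x y
      have "dist (g n x) (g n y) \<le> \<bar>real n * infdist x (- U) - real n * infdist y (- U)\<bar>"
        unfolding g_def dist_real_def by linarith
      also have "\<dots> = real n * \<bar>infdist x (- U) - infdist y (- U)\<bar>"
        by (simp add: abs_mult flip: right_diff_distrib)
      also have "\<dots> \<le> real n * dist x y" by (intro mult_left_mono infdist_triangle_abs) simp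
      finally show "dist (g n x) (g n y) \<le> real n * dist x y" .
    qed simp
    show nonneg: "0 \<le> g n x" and le1: "g n x \<le> 1" for n x by (simp_all add: g_def infdist_nonneg)
    show inc: "incseq (\<lambda>n. ennreal (g n x))" for x
      unfolding g_def incseq_def
      by (intro allI impI ennreal_leI min.mono mult_right_mono) (auto simp: infdist_nonneg)
    show "(SUP n. ennreal (g n x)) = indicator U x" for x
    proof (cases "x \<in> U")
      case True
      have cl: "closed (- U)" "- U \<noteq> {}" using assms False by auto
      then have "infdist x (- U) > 0"
        using True in_closed_iff_infdist_zero[OF cl, of x] infdist_nonneg[of x "- U"] by simp
      then obtain n where "1 < real n * infdist x (- U)"
        using ex_less_of_nat_mult by blast
      then have "ennreal (g n x) = 1" by (simp add: g_def)
      moreover have "ennreal (g m x) \<le> 1" for m using le1[of m x] by (simp add: ennreal_le_1)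
      ultimately show ?thesis using True by (intro antisym SUP_least) (auto intro: SUP_upper2[of n])
    next
      case F: False
      then have "g n x = 0" for n by (simp add: g_def infdist_zero)
      with F show ?thesis by simp
    qed
  qed
qed

lemma sets_restrict_borel:
  assumes "S \<in> sets borel"
  shows "sets (restrict_space borel S) = sigma_sets S ((\<inter>) S ` {U. open U})"
proof -
  have "S \<in> sigma_sets UNIV {U. open U}" using assms by (simp add: sets_borel)
  then show ?thesis by (simp add: sets_restrict_space sets_borel sigma_sets_Int)
qed

lemma Int_stable_restrict_open: "Int_stable ((\<inter>) S ` {U. open U})"
proof (rule Int_stableI)
  fix a b assume "a \<in> (\<inter>) S ` {U. open U}" "b \<in> (\<inter>) S ` {U. open U}"
  then obtain U V where "open U" "open V" "a = S \<inter> U" "b = S \<inter> V" by blast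
  then show "a \<inter> b \<in> (\<inter>) S ` {U. open U}"
    by (intro image_eqI[of _ _ "U \<inter> V"]) auto
qed

lemma emeasure_restrict_open_eq_SUP:
  assumes S: "S \<in> sets borel" and M: "sets M = sets (restrict_space borel S)" and U: "open U"
    and g: "\<And>n. (real n)-lipschitz_on UNIV (g n)" "\<And>x. incseq (\<lambda>n. ennreal (g n x))"
      "\<And>x. (SUP n. ennreal (g n x)) = indicator U x"
  shows "emeasure M (S \<inter> U) = (SUP n. \<integral>\<^sup>+x. ennreal (g n x) \<partial>M)"
proof -
  have sp: "space M = S" using sets_eq_imp_space_eq[OF M] by (simp add: space_restrict_space)
  have "S \<inter> U \<in> sets M" using S U by (simp add: M sets_restrict_space)
  then have "emeasure M (S \<inter> U) = (\<integral>\<^sup>+x. indicator (S \<inter> U) x \<partial>M)" by simp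
  also have "\<dots> = (\<integral>\<^sup>+x. (SUP n. ennreal (g n x)) \<partial>M)"
    by (intro nn_integral_cong) (simp add: g sp indicator_def)
  also have "\<dots> = (SUP n. \<integral>\<^sup>+x. ennreal (g n x) \<partial>M)"
  proof (rule nn_integral_monotone_convergence_SUP)
    show "incseq (\<lambda>n x. ennreal (g n x))" using g(2) by (simp add: incseq_def le_fun_def)
    fix n
    have "g n \<in> borel_measurable borel"
      using lipschitz_on_continuous_on[OF g(1)] by (rule borel_measurable_continuous_onI)
    then have "(\<lambda>x. ennreal (g n x)) \<in> borel_measurable (restrict_space borel S)"
      by (intro measurable_restrict_space1) measurable
    then show "(\<lambda>x. ennreal (g n x)) \<in> borel_measurable M" using M measurable_cong_sets by blast
  qed
  finally show ?thesis .
qed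

text \<open>Lipschitz functions with values in the unit interval increase to indicators of open
  sets, whose traces on \<open>S\<close> form an intersection-stable generator. Such functions are
  the right test class because the Markov operator of a mean square contraction preserves it,
  whereas indicators are not preserved.\<close>

lemma measure_eqI_lipschitz:
  fixes S :: "'a::metric_space set"
  assumes S: "S \<in> sets borel" and M: "sets M = sets (restrict_space borel S)"
    and N: "sets N = sets (restrict_space borel S)" and fin: "finite_measure M"
    and eq: "\<And>g :: 'a \<Rightarrow> real. \<And>L. L-lipschitz_on UNIV g \<Longrightarrow> (\<And>x. 0 \<le> g x) \<Longrightarrow> (\<And>x. g x \<le> 1) \<Longrightarrow>
      (\<integral>\<^sup>+x. ennreal (g x) \<partial>M) = (\<integral>\<^sup>+x. ennreal (g x) \<partial>N)"
  shows "M = N"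
proof (rule measure_eqI_generator_eq[OF Int_stable_restrict_open])
  show "(\<inter>) S ` {U. open U} \<subseteq> Pow S" by auto
  fix X assume "X \<in> (\<inter>) S ` {U. open U}"
  then obtain U where U: "open U" "X = S \<inter> U" by auto
  obtain g :: "nat \<Rightarrow> 'a \<Rightarrow> real" where g: "\<And>n. (real n)-lipschitz_on UNIV (g n)"
    "\<And>n x. 0 \<le> g n x" "\<And>n x. g n x \<le> 1" "\<And>x. incseq (\<lambda>n. ennreal (g n x))"
    "\<And>x. (SUP n. ennreal (g n x)) = indicator U x"
    using lipschitz_approx_open[OF U(1)] by blast
  show "emeasure M X = emeasure N X"
    unfolding U(2) emeasure_restrict_open_eq_SUP[OF S M U(1) g(1,4,5)]
      emeasure_restrict_open_eq_SUP[OF S N U(1) g(1,4,5)] using eq[OF g(1-3)] by simp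
next
  show "sets M = sigma_sets S ((\<inter>) S ` {U. open U})" "sets N = sigma_sets S ((\<inter>) S ` {U. open U})"
    by (simp_all add: M N sets_restrict_borel[OF S])
  show "range (\<lambda>_. S) \<subseteq> (\<inter>) S ` {U. open U}" by (auto intro: image_eqI[of _ _ UNIV])
  show "emeasure M S \<noteq> \<infinity>" using finite_measure.emeasure_finite[OF fin] by auto
qed auto

text \<open>Reduces measurability of a kernel to its action on test functions. For the kernel below
  this action is Lipschitz in the starting point, even though the underlying random variables are
  chosen point by point.\<close>

lemma measurable_prob_algebra_lipschitz:
  fixes S :: "'a::metric_space set"
  assumes S: "S \<in> sets borel" and K: "\<And>a. a \<in> space M \<Longrightarrow> prob_space (K a)"
      "\<And>a. a \<in> space M \<Longrightarrow> sets (K a) = sets (restrict_space borel S)"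
    and meas: "\<And>g :: 'a \<Rightarrow> real. \<And>L. L-lipschitz_on UNIV g \<Longrightarrow> (\<And>x. 0 \<le> g x) \<Longrightarrow> (\<And>x. g x \<le> 1) \<Longrightarrow>
      (\<lambda>a. \<integral>\<^sup>+x. ennreal (g x) \<partial>K a) \<in> borel_measurable M"
  shows "K \<in> measurable M (prob_algebra (restrict_space borel S))"
proof (rule measurable_prob_algebra_generated[OF sets_restrict_borel[OF S] Int_stable_restrict_open _ K])
  fix X assume "X \<in> (\<inter>) S ` {U. open U}"
  then obtain U where U: "open U" "X = S \<inter> U" by auto
  obtain g :: "nat \<Rightarrow> 'a \<Rightarrow> real" where g: "\<And>n. (real n)-lipschitz_on UNIV (g n)"
    "\<And>n x. 0 \<le> g n x" "\<And>n x. g n x \<le> 1" "\<And>x. incseq (\<lambda>n. ennreal (g n x))"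
    "\<And>x. (SUP n. ennreal (g n x)) = indicator U x"
    using lipschitz_approx_open[OF U(1)] by blast
  have "(\<lambda>a. SUP n. \<integral>\<^sup>+x. ennreal (g n x) \<partial>K a) \<in> borel_measurable M"
    by (intro borel_measurable_SUP meas[OF g(1)] g) auto
  then show "(\<lambda>a. emeasure (K a) X) \<in> borel_measurable M"
    unfolding U(2)
    by (rule measurable_cong[THEN iffD1, rotated])
      (simp add: emeasure_restrict_open_eq_SUP[OF S K(2) U(1) g(1,4,5)])
qed auto

text \<open>McShane's extension, truncated at 1.\<close>

lemma lipschitz_extension_bounded:
  fixes g :: "'a::metric_space \<Rightarrow> real"
  assumes g: "L-lipschitz_on D g" and bd: "\<And>x. x \<in> D \<Longrightarrow> 0 \<le> g x" "\<And>x. x \<in> D \<Longrightarrow> g x \<le> 1"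
  obtains G where "L-lipschitz_on UNIV G" "\<And>x. 0 \<le> G x" "\<And>x. G x \<le> 1" "\<And>x. x \<in> D \<Longrightarrow> G x = g x"
proof (cases "D = {}")
  case True
  show ?thesis
    by (rule that[of "\<lambda>_. 0"]) (use lipschitz_on_nonneg[OF g] in \<open>auto simp: True intro!: lipschitz_onI\<close>)
next
  case False
  have L: "0 \<le> L" by (rule lipschitz_on_nonneg[OF g])
  define h where "h x = (INF y\<in>D. g y + L * dist x y)" for x
  have bb: "bdd_below ((\<lambda>y. g y + L * dist x y) ` D)" for x
    using bd L by (intro bdd_belowI[of _ 0]) auto
  have h0: "0 \<le> h x" for x
    unfolding h_def using bd L False by (intro cINF_greatest) auto
  have hle: "h x \<le> h z + L * dist x z" for x z
  proof -
    have "h x - L * dist x z \<le> g y + L * dist z y" if "y \<in> D" for y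
    proof -
      have "h x \<le> g y + L * dist x y" unfolding h_def by (rule cINF_lower[OF bb that])
      also have "\<dots> \<le> g y + L * (dist x z + dist z y)"
        by (intro add_left_mono mult_left_mono L dist_triangle)
      finally show ?thesis by (simp add: algebra_simps)
    qed
    then have "h x - L * dist x z \<le> h z" unfolding h_def[of z] by (intro cINF_greatest False)
    then show ?thesis by simp
  qed
  have hg: "h x = g x" if x: "x \<in> D" for x
  proof (rule antisym)
    show "h x \<le> g x" unfolding h_def using cINF_lower[OF bb x, of x] by simp
    show "g x \<le> h x" unfolding h_def
    proof (intro cINF_greatest False)
      fix y assume "y \<in> D"
      then show "g x \<le> g y + L * dist x y"
        using lipschitz_onD[OF g x \<open>y \<in> D\<close>] by (simp add: dist_real_def)
    qed
  qed
  show ?thesis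
  proof (rule that[of "\<lambda>x. min 1 (h x)"])
    show "L-lipschitz_on UNIV (\<lambda>x. min 1 (h x))"
    proof (intro lipschitz_onI L)
      fix x y
      show "dist (min 1 (h x)) (min 1 (h y)) \<le> L * dist x y"
        using hle[of x y] hle[of y x] by (simp add: dist_real_def dist_commute[of y x] min_def abs_le_iff)
    qed
  qed (use h0 hg bd in auto)
qed

subsection \<open>Contractive random maps\<close>

text \<open>Cauchy-Schwarz against the constant 1, whose second moment is 1 on a probability
  space.\<close>

lemma (in prob_space) expectation_le_L2:
  fixes f :: "'a \<Rightarrow> real"
  assumes [measurable]: "f \<in> borel_measurable M" and nonneg: "\<And>x. 0 \<le> f x" and c: "0 \<le> c"
    and le: "(\<integral>\<^sup>+x. ennreal ((f x)\<^sup>2) \<partial>M) \<le> ennreal (c\<^sup>2)"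
  shows "(\<integral>\<^sup>+x. ennreal (f x) \<partial>M) \<le> ennreal c"
proof -
  have "(\<integral>\<^sup>+x. ennreal (f x) \<partial>M)\<^sup>2 \<le> (\<integral>\<^sup>+x. (ennreal (f x))\<^sup>2 \<partial>M) * (\<integral>\<^sup>+x. 1\<^sup>2 \<partial>M)"
    using Cauchy_Schwarz_nn_integral[of "\<lambda>x. ennreal (f x)" M "\<lambda>_. 1"] by simp
  also have "\<dots> = (\<integral>\<^sup>+x. ennreal ((f x)\<^sup>2) \<partial>M)"
    using nonneg by (simp add: ennreal_power emeasure_space_1)
  also have "\<dots> \<le> (ennreal c)\<^sup>2" using le c by (simp add: ennreal_power)
  finally have sq: "(\<integral>\<^sup>+x. ennreal (f x) \<partial>M)\<^sup>2 \<le> (ennreal c)\<^sup>2" .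
  show ?thesis
  proof (cases "\<integral>\<^sup>+x. ennreal (f x) \<partial>M")
    case (real r)
    with sq c show ?thesis by (auto simp: ennreal_power intro: power2_le_imp_le)
  next
    case top
    with sq c show ?thesis by (simp add: ennreal_power power_eq_top_ennreal top_unique)
  qed
qed

text \<open>A coupling bound: both variables live on the same space, and a Lipschitz function cannot
  separate them by more than their expected distance. Measurability of the compositions is assumed
  rather than derived, since \<open>g\<close> is controlled on \<open>S\<close> only.\<close>

lemma (in prob_space) Lipschitz_expectation:
  fixes X Y :: "'a \<Rightarrow> 'h::{banach, second_countable_topology}" and g :: "'h \<Rightarrow> real"
  assumes X: "X \<in> borel_measurable M" "\<And>\<omega>. \<omega> \<in> space M \<Longrightarrow> X \<omega> \<in> S"
    and Y: "Y \<in> borel_measurable M" "\<And>\<omega>. \<omega> \<in> space M \<Longrightarrow> Y \<omega> \<in> S"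
    and gX: "(\<lambda>\<omega>. g (X \<omega>)) \<in> borel_measurable M" and gY: "(\<lambda>\<omega>. g (Y \<omega>)) \<in> borel_measurable M"
    and g: "L-lipschitz_on S g" "\<And>x. x \<in> S \<Longrightarrow> 0 \<le> g x" "\<And>x. x \<in> S \<Longrightarrow> g x \<le> 1" and c: "0 \<le> c"
    and le: "(\<integral>\<^sup>+\<omega>. ennreal ((norm (X \<omega> - Y \<omega>))\<^sup>2) \<partial>M) \<le> ennreal (c\<^sup>2)"
  shows "\<bar>(\<integral>\<omega>. g (X \<omega>) \<partial>M) - (\<integral>\<omega>. g (Y \<omega>) \<partial>M)\<bar> \<le> L * c"
proof -
  note [measurable] = X(1) Y(1) gX gY
  have L: "0 \<le> L" using lipschitz_on_nonneg[OF g(1)] .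
  have n1: "(\<integral>\<^sup>+\<omega>. ennreal (norm (X \<omega> - Y \<omega>)) \<partial>M) \<le> ennreal c"
    by (rule expectation_le_L2[OF _ _ c le]) auto
  then have i: "integrable M (\<lambda>\<omega>. norm (X \<omega> - Y \<omega>))"
    by (intro integrableI_bounded) (auto intro: le_less_trans)
  have e: "(\<integral>\<omega>. norm (X \<omega> - Y \<omega>) \<partial>M) \<le> c"
    using n1 c by (subst (asm) nn_integral_eq_integral[OF i]) auto
  have ig: "integrable M (\<lambda>\<omega>. g (X \<omega>))" "integrable M (\<lambda>\<omega>. g (Y \<omega>))"
    using g X Y by (auto intro!: integrable_const_bound[of _ 1])
  have "\<bar>(\<integral>\<omega>. g (X \<omega>) \<partial>M) - (\<integral>\<omega>. g (Y \<omega>) \<partial>M)\<bar> = \<bar>\<integral>\<omega>. g (X \<omega>) - g (Y \<omega>) \<partial>M\<bar>"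
    using ig by simp
  also have "\<dots> \<le> (\<integral>\<omega>. \<bar>g (X \<omega>) - g (Y \<omega>)\<bar> \<partial>M)" by (rule integral_abs_bound)
  also have "\<dots> \<le> (\<integral>\<omega>. L * norm (X \<omega> - Y \<omega>) \<partial>M)"
    using ig i X(2) Y(2) lipschitz_onD[OF g(1)]
    by (intro integral_mono) (auto simp: dist_real_def dist_norm)
  also have "\<dots> = L * (\<integral>\<omega>. norm (X \<omega> - Y \<omega>) \<partial>M)" by simp
  also have "\<dots> \<le> L * c" by (intro mult_left_mono e L)
  finally show ?thesis .
qed

lemma lipschitz_on_measurable_restrict:
  fixes g :: "'h::metric_space \<Rightarrow> real"
  assumes "L-lipschitz_on S g"
  shows "g \<in> borel_measurable (restrict_space borel S)"
  by (rule borel_measurable_continuous_on_restrict[OF lipschitz_on_continuous_on[OF assms]])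

text \<open>The variables \<open>Z x\<close> are measurable in the sample point for each fixed
  \<open>x\<close>; nothing is said about measurability in \<open>x\<close>. The state space is a
  closed subset because the fields supported in a domain form only a subspace of their type. The
  moment condition at \<open>x0\<close> supplies the size of the first increment in the backward
  iteration.\<close>

locale contractive_random_map = prob_space P for P :: "'w measure" +
  fixes S :: "'h::{banach, second_countable_topology} set" and Z :: "'h \<Rightarrow> 'w \<Rightarrow> 'h"
    and \<rho> :: real and x0 :: 'h
  assumes closed_S: "closed S" and x0: "x0 \<in> S" and \<rho>: "0 < \<rho>" "\<rho> < 1"
    and Z_measurable: "\<And>x. x \<in> S \<Longrightarrow> Z x \<in> P \<rightarrow>\<^sub>M restrict_space borel S"
    and contraction: "\<And>x y. x \<in> S \<Longrightarrow> y \<in> S \<Longrightarrow>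
      (\<integral>\<^sup>+\<omega>. ennreal ((norm (Z x \<omega> - Z y \<omega>))\<^sup>2) \<partial>P) \<le> ennreal ((\<rho> * norm (x - y))\<^sup>2)"
    and moment: "(\<integral>\<^sup>+\<omega>. ennreal ((norm (Z x0 \<omega> - x0))\<^sup>2) \<partial>P) < \<infinity>"
begin

abbreviation X :: "'h measure" where "X \<equiv> restrict_space borel S"

definition kernel :: "'h \<Rightarrow> 'h measure" where "kernel x = distr P X (Z x)"

definition transition :: "('h \<Rightarrow> real) \<Rightarrow> 'h \<Rightarrow> real" where
  "transition g x = (\<integral>\<omega>. g (Z x \<omega>) \<partial>P)"

text \<open>Constrains \<open>g\<close> on \<open>S\<close> only: iterates of
  \<open>transition\<close> are controlled there and nowhere else.\<close>

definition test :: "real \<Rightarrow> ('h \<Rightarrow> real) \<Rightarrow> bool" where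
  "test L g \<longleftrightarrow> L-lipschitz_on S g \<and> (\<forall>x\<in>S. 0 \<le> g x \<and> g x \<le> 1)"

lemma S_borel: "S \<in> sets borel" using closed_S by simp

lemma space_X: "space X = S" by (simp add: space_restrict_space)

lemma X_borel: "f \<in> M \<rightarrow>\<^sub>M X \<Longrightarrow> f \<in> borel_measurable M"
  by (rule measurable_compose[of f M X "\<lambda>x. x", simplified]) (auto intro: measurable_restrict_space1)

lemma Z_in_S: "x \<in> S \<Longrightarrow> \<omega> \<in> space P \<Longrightarrow> Z x \<omega> \<in> S"
  using measurable_space[OF Z_measurable] by (simp add: space_X)

lemma Z_borel: "x \<in> S \<Longrightarrow> Z x \<in> borel_measurable P" by (rule X_borel[OF Z_measurable])

lemma test_measurable: "test L g \<Longrightarrow> g \<in> borel_measurable X"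
  by (auto simp: test_def intro: lipschitz_on_measurable_restrict)

lemma test_integrable:
  assumes "test L g" "prob_space M" "f \<in> M \<rightarrow>\<^sub>M X"
  shows "integrable M (\<lambda>\<omega>. g (f \<omega>))"
proof -
  interpret M: prob_space M by fact
  have "\<And>\<omega>. \<omega> \<in> space M \<Longrightarrow> f \<omega> \<in> S" using measurable_space[OF assms(3)] by (simp add: space_X)
  then show ?thesis
    using assms(1) measurable_compose[OF assms(3) test_measurable[OF assms(1)]]
    by (intro M.integrable_const_bound[of _ 1]) (auto simp: test_def)
qed

lemma test_nn_integral:
  assumes "test L g" "prob_space M" "f \<in> M \<rightarrow>\<^sub>M X"
  shows "(\<integral>\<^sup>+\<omega>. ennreal (g (f \<omega>)) \<partial>M) = ennreal (\<integral>\<omega>. g (f \<omega>) \<partial>M)"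
proof -
  have "\<And>\<omega>. \<omega> \<in> space M \<Longrightarrow> f \<omega> \<in> S" using measurable_space[OF assms(3)] by (simp add: space_X)
  then show ?thesis
    using assms(1) by (intro nn_integral_eq_integral test_integrable[OF assms]) (auto simp: test_def)
qed

text \<open>The two starting points are coupled through the same sample point, so the mean square
  contraction bounds the expected distance of the images and the Lipschitz constant shrinks by
  \<rho>.\<close>

lemma test_transition:
  assumes g: "test L g"
  shows "test (L * \<rho>) (transition g)"
  unfolding test_def
proof (intro conjI ballI)
  have L: "0 \<le> L" using g lipschitz_on_nonneg by (auto simp: test_def)
  have gZ: "(\<lambda>\<omega>. g (Z x \<omega>)) \<in> borel_measurable P" if "x \<in> S" for x
    using measurable_compose[OF Z_measurable[OF that] test_measurable[OF g]] .
  show "(L * \<rho>)-lipschitz_on S (transition g)"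
  proof (rule lipschitz_onI)
    fix x y assume xy: "x \<in> S" "y \<in> S"
    have "\<bar>transition g x - transition g y\<bar> \<le> L * (\<rho> * norm (x - y))"
      unfolding transition_def
      using g \<rho> xy by (intro Lipschitz_expectation[where S = S] contraction gZ Z_borel Z_in_S) (auto simp: test_def)
    then show "dist (transition g x) (transition g y) \<le> L * \<rho> * dist x y"
      by (simp add: dist_real_def dist_norm)
  qed (use L \<rho> in simp)
  fix x assume x: "x \<in> S"
  show "0 \<le> transition g x"
    unfolding transition_def using g Z_in_S[OF x] by (intro Bochner_Integration.integral_nonneg) (auto simp: test_def)
  have "transition g x \<le> (\<integral>\<omega>. 1 \<partial>P)"
    unfolding transition_def
    using g Z_in_S[OF x] by (intro integral_mono test_integrable[OF g prob_space_axioms Z_measurable[OF x]]) (auto simp: test_def)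
  then show "transition g x \<le> 1" by (simp add: prob_space)
qed

lemma nn_integral_kernel:
  assumes "test L g" "x \<in> S"
  shows "(\<integral>\<^sup>+y. ennreal (g y) \<partial>kernel x) = ennreal (transition g x)"
  unfolding kernel_def transition_def
  using assms Z_measurable test_measurable[OF assms(1)]
  by (subst nn_integral_distr) (auto intro!: test_nn_integral prob_space_axioms)

lemma kernel_prob: "x \<in> S \<Longrightarrow> prob_space (kernel x)"
  unfolding kernel_def by (intro prob_space_distr Z_measurable)

lemma sets_kernel [simp]: "sets (kernel x) = sets X" by (simp add: kernel_def)

lemma test_UNIV:
  assumes "L-lipschitz_on UNIV g" "\<And>x. 0 \<le> g x" "\<And>x. g x \<le> 1"
  shows "test L g"
  using assms lipschitz_on_subset[OF assms(1)] by (auto simp: test_def)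

lemma kernel_measurable: "kernel \<in> X \<rightarrow>\<^sub>M prob_algebra X"
proof (rule measurable_prob_algebra_lipschitz[OF S_borel])
  fix g :: "'h \<Rightarrow> real" and L assume "L-lipschitz_on UNIV g" "\<And>x. 0 \<le> g x" "\<And>x. g x \<le> 1"
  then have g: "test L g" by (rule test_UNIV)
  have "(\<lambda>a. ennreal (transition g a)) \<in> borel_measurable X"
    using test_measurable[OF test_transition[OF g]] by measurable
  then show "(\<lambda>a. \<integral>\<^sup>+x. ennreal (g x) \<partial>kernel a) \<in> borel_measurable X"
    by (rule measurable_cong[THEN iffD1, rotated]) (simp add: space_X nn_integral_kernel[OF g])
qed (auto simp: space_X kernel_prob)

lemma invariant_measure_iff_bind:
  assumes \<pi>: "\<pi> \<in> space (prob_algebra X)"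
  shows "invariant_measure X kernel \<pi> \<longleftrightarrow> \<pi> \<bind> kernel = \<pi>"
proof -
  have s: "sets (\<pi> \<bind> kernel) = sets X" by (rule sets_bind'[OF \<pi> kernel_measurable])
  have "\<pi> \<bind> kernel = \<pi> \<longleftrightarrow> (\<forall>A\<in>sets X. emeasure (\<pi> \<bind> kernel) A = emeasure \<pi> A)"
    using \<pi> s by (auto simp: space_prob_algebra intro: measure_eqI)
  then show ?thesis
    using \<pi> by (simp add: invariant_measure_def emeasure_bind_prob_algebra[OF \<pi> kernel_measurable])
qed

lemma nn_integral_bind_kernel:
  assumes \<pi>: "\<pi> \<in> space (prob_algebra X)" and g: "test L g"
  shows "(\<integral>\<^sup>+x. ennreal (g x) \<partial>(\<pi> \<bind> kernel)) = ennreal (\<integral>x. transition g x \<partial>\<pi>)"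
proof -
  have sets: "sets \<pi> = sets X" and p: "prob_space \<pi>" using \<pi> by (auto simp: space_prob_algebra)
  have k: "kernel \<in> \<pi> \<rightarrow>\<^sub>M subprob_algebra X"
    using measurable_prob_algebraD[OF kernel_measurable] measurable_cong_sets[OF sets refl] by blast
  have sp: "space \<pi> = S" using sets_eq_imp_space_eq[OF sets] by (simp add: space_X)
  have "(\<integral>\<^sup>+x. ennreal (g x) \<partial>(\<pi> \<bind> kernel)) = (\<integral>\<^sup>+x. \<integral>\<^sup>+y. ennreal (g y) \<partial>kernel x \<partial>\<pi>)"
    using test_measurable[OF g] by (intro nn_integral_bind[OF _ k]) measurable
  also have "\<dots> = (\<integral>\<^sup>+x. ennreal (transition g x) \<partial>\<pi>)"
    by (intro nn_integral_cong nn_integral_kernel[OF g]) (simp add: sp)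
  also have "\<dots> = ennreal (\<integral>x. transition g x \<partial>\<pi>)"
    using test_nn_integral[OF test_transition[OF g] p, of "\<lambda>x. x"] sets
    by (simp add: measurable_ident_sets)
  finally show ?thesis .
qed

lemma invariant_measureI:
  assumes \<pi>: "\<pi> \<in> space (prob_algebra X)"
    and eq: "\<And>g L. test L g \<Longrightarrow> (\<integral>x. transition g x \<partial>\<pi>) = (\<integral>x. g x \<partial>\<pi>)"
  shows "invariant_measure X kernel \<pi>"
  unfolding invariant_measure_iff_bind[OF \<pi>]
proof (rule measure_eqI_lipschitz[OF S_borel sets_bind'[OF \<pi> kernel_measurable]])
  have sets: "sets \<pi> = sets X" and p: "prob_space \<pi>" using \<pi> by (auto simp: space_prob_algebra)
  show "sets \<pi> = sets X" by fact
  interpret b: prob_space "\<pi> \<bind> kernel" by (rule prob_space_bind'[OF \<pi> kernel_measurable])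
  show "finite_measure (\<pi> \<bind> kernel)" by (rule b.finite_measure_axioms)
  fix g :: "'h \<Rightarrow> real" and L assume "L-lipschitz_on UNIV g" "\<And>x. 0 \<le> g x" "\<And>x. g x \<le> 1"
  then have g: "test L g" by (rule test_UNIV)
  show "(\<integral>\<^sup>+x. ennreal (g x) \<partial>(\<pi> \<bind> kernel)) = (\<integral>\<^sup>+x. ennreal (g x) \<partial>\<pi>)"
    using nn_integral_bind_kernel[OF \<pi> g] eq[OF g] test_nn_integral[OF g p, of "\<lambda>x. x"] sets
    by (simp add: measurable_ident_sets)
qed

lemma invariant_measure_transition:
  assumes inv: "invariant_measure X kernel \<pi>" and g: "test L g"
  shows "(\<integral>x. transition g x \<partial>\<pi>) = (\<integral>x. g x \<partial>\<pi>)"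
proof -
  have \<pi>: "\<pi> \<in> space (prob_algebra X)" using inv by (simp add: invariant_measure_def)
  have sets: "sets \<pi> = sets X" and p: "prob_space \<pi>" using \<pi> by (auto simp: space_prob_algebra)
  have sp: "space \<pi> = S" using sets_eq_imp_space_eq[OF sets] by (simp add: space_X)
  have "ennreal (\<integral>x. transition g x \<partial>\<pi>) = ennreal (\<integral>x. g x \<partial>\<pi>)"
    using nn_integral_bind_kernel[OF \<pi> g] inv test_nn_integral[OF g p, of "\<lambda>x. x"] sets
    by (simp add: invariant_measure_iff_bind[OF \<pi>] measurable_ident_sets)
  then show ?thesis
    using g test_transition[OF g]
    by (subst (asm) ennreal_inj) (auto simp: test_def sp intro!: Bochner_Integration.integral_nonneg)
qed

lemma test_transition_funpow: "test L g \<Longrightarrow> test (L * \<rho> ^ n) ((transition ^^ n) g)"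
proof (induction n)
  case (Suc n)
  from test_transition[OF Suc.IH[OF Suc.prems]] show ?case by (simp add: mult_ac)
qed simp

lemma invariant_measure_transition_funpow:
  assumes inv: "invariant_measure X kernel \<pi>" and g: "test L g"
  shows "(\<integral>x. (transition ^^ n) g x \<partial>\<pi>) = (\<integral>x. g x \<partial>\<pi>)"
  by (induction n) (simp_all add: invariant_measure_transition[OF inv test_transition_funpow[OF g]])

text \<open>The iterates at \<open>x\<close> and at \<open>x0\<close> differ by at most
  \<open>L * \<rho> ^ n * dist x x0\<close>. Integrating this bound would require a first moment of
  \<pi>; since the iterates stay in the unit interval, dominated convergence is used instead. The
  left side does not mention \<pi>, which is the source of uniqueness.\<close>

lemma transition_funpow_tendsto:
  assumes inv: "invariant_measure X kernel \<pi>" and g: "test L g"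
  shows "(\<lambda>n. (transition ^^ n) g x0) \<longlonglongrightarrow> (\<integral>x. g x \<partial>\<pi>)"
proof -
  have \<pi>: "\<pi> \<in> space (prob_algebra X)" using inv by (simp add: invariant_measure_def)
  have sets: "sets \<pi> = sets X" and p: "prob_space \<pi>" using \<pi> by (auto simp: space_prob_algebra)
  interpret \<pi>: prob_space \<pi> by fact
  have sp: "space \<pi> = S" using sets_eq_imp_space_eq[OF sets] by (simp add: space_X)
  have m: "(transition ^^ n) g \<in> borel_measurable \<pi>" for n
    using test_measurable[OF test_transition_funpow[OF g]] measurable_cong_sets[OF sets refl] by blast
  have bd: "0 \<le> (transition ^^ n) g x \<and> (transition ^^ n) g x \<le> 1" if "x \<in> S" for n x
    using test_transition_funpow[OF g] that by (simp add: test_def)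
  have i: "integrable \<pi> ((transition ^^ n) g)" for n
    using bd m by (intro \<pi>.integrable_const_bound[of _ 1]) (auto simp: sp)
  have "(\<lambda>n. \<integral>x. (transition ^^ n) g x - (transition ^^ n) g x0 \<partial>\<pi>) \<longlonglongrightarrow> (\<integral>x. 0 \<partial>\<pi>)"
  proof (rule integral_dominated_convergence[where w = "\<lambda>_. 1"])
    show "AE x in \<pi>. (\<lambda>n. (transition ^^ n) g x - (transition ^^ n) g x0) \<longlonglongrightarrow> 0"
    proof (rule AE_I2)
      fix x assume "x \<in> space \<pi>"
      then have x: "x \<in> S" by (simp add: sp)
      have "(\<lambda>n. L * \<rho> ^ n * dist x x0) \<longlonglongrightarrow> L * 0 * dist x x0"
        using \<rho> by (intro tendsto_intros LIMSEQ_realpow_zero) auto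
      then have lim: "(\<lambda>n. L * \<rho> ^ n * dist x x0) \<longlonglongrightarrow> 0" by simp
      have "\<forall>n. norm ((transition ^^ n) g x - (transition ^^ n) g x0) \<le> L * \<rho> ^ n * dist x x0"
      proof
        fix n
        show "norm ((transition ^^ n) g x - (transition ^^ n) g x0) \<le> L * \<rho> ^ n * dist x x0"
          using lipschitz_onD[of "L * \<rho> ^ n" S "(transition ^^ n) g" x x0] test_transition_funpow[OF g, of n] x x0
          by (simp add: test_def dist_real_def)
      qed
      then show "(\<lambda>n. (transition ^^ n) g x - (transition ^^ n) g x0) \<longlonglongrightarrow> 0"
        by (rule Lim_null_comparison[OF always_eventually lim])
    qed
    show "AE x in \<pi>. norm ((transition ^^ n) g x - (transition ^^ n) g x0) \<le> 1" for n
    proof (rule AE_I2)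
      fix x assume "x \<in> space \<pi>"
      then show "norm ((transition ^^ n) g x - (transition ^^ n) g x0) \<le> 1"
        using bd[of x n] bd[OF x0, of n] by (simp add: sp abs_le_iff)
    qed
  qed (use m in auto)
  then have "(\<lambda>n. (\<integral>x. g x \<partial>\<pi>) - (transition ^^ n) g x0) \<longlonglongrightarrow> 0"
    using i by (simp add: \<pi>.prob_space invariant_measure_transition_funpow[OF inv g])
  from tendsto_diff[OF tendsto_const[of "\<integral>x. g x \<partial>\<pi>"] this] show ?thesis by simp
qed

lemma invariant_measure_unique:
  assumes "invariant_measure X kernel \<pi>" "invariant_measure X kernel \<pi>'"
  shows "\<pi> = \<pi>'"
proof (rule measure_eqI_lipschitz[OF S_borel])
  have p: "sets \<pi> = sets X" "prob_space \<pi>" "sets \<pi>' = sets X" "prob_space \<pi>'"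
    using assms by (auto simp: invariant_measure_def space_prob_algebra)
  show "sets \<pi> = sets X" "sets \<pi>' = sets X" by fact+
  show "finite_measure \<pi>" using p(2) by (simp add: prob_space.finite_measure)
  fix g :: "'h \<Rightarrow> real" and L assume "L-lipschitz_on UNIV g" "\<And>x. 0 \<le> g x" "\<And>x. g x \<le> 1"
  then have g: "test L g" by (rule test_UNIV)
  have "(\<integral>x. g x \<partial>\<pi>) = (\<integral>x. g x \<partial>\<pi>')"
    using LIMSEQ_unique[OF transition_funpow_tendsto[OF assms(1) g] transition_funpow_tendsto[OF assms(2) g]] .
  then show "(\<integral>\<^sup>+x. ennreal (g x) \<partial>\<pi>) = (\<integral>\<^sup>+x. ennreal (g x) \<partial>\<pi>')"
    using test_nn_integral[OF g p(2), of "\<lambda>x. x"] test_nn_integral[OF g p(4), of "\<lambda>x. x"] p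
    by (simp add: measurable_ident_sets)
qed

end

section \<open>Backward iteration of the random map\<close>

text \<open>The head of the stream drives the outermost map, and the starting point sits innermost.
  Passing from \<open>n\<close> to \<open>n + 1\<close> changes only the innermost argument, which
  then runs through \<open>n\<close> contracting maps.\<close>

primrec backward :: "('h \<times> 'w \<Rightarrow> 'h) \<Rightarrow> 'h \<Rightarrow> nat \<Rightarrow> 'w stream \<Rightarrow> 'h" where
  "backward \<Phi> x 0 s = x"
| "backward \<Phi> x (Suc n) s = \<Phi> (backward \<Phi> x n (stl s), shd s)"

text \<open>Head and tail of a stream of independent samples are independent, and the tail has the
  law of the whole stream.\<close>

lemma (in prob_space) nn_integral_stream_shift:
  assumes [measurable]: "h \<in> borel_measurable (stream_space M \<Otimes>\<^sub>M M)"
  shows "(\<integral>\<^sup>+s. h (stl s, shd s) \<partial>stream_space M) = (\<integral>\<^sup>+s. \<integral>\<^sup>+\<omega>. h (s, \<omega>) \<partial>M \<partial>stream_space M)"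
proof -
  interpret S: prob_space "stream_space M" by (rule prob_space_stream_space)
  interpret pair_sigma_finite "stream_space M" M ..
  have "(\<integral>\<^sup>+s. h (stl s, shd s) \<partial>stream_space M) = (\<integral>\<^sup>+\<omega>. \<integral>\<^sup>+s. h (s, \<omega>) \<partial>stream_space M \<partial>M)"
    by (subst nn_integral_stream_space) auto
  also have "\<dots> = (\<integral>\<^sup>+s. \<integral>\<^sup>+\<omega>. h (s, \<omega>) \<partial>M \<partial>stream_space M)"
    by (rule Fubini) measurable
  finally show ?thesis .
qed

context contractive_random_map
begin

text \<open>The default value \<open>x0\<close> off the convergence set keeps the limit inside
  \<open>S\<close> everywhere; closedness of \<open>S\<close> takes care of the convergence
  set.\<close>

lemma measurable_if_lim:
  assumes f: "\<And>k. f k \<in> M \<rightarrow>\<^sub>M X"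
  shows "(\<lambda>p. if Cauchy (\<lambda>k. f k p) then lim (\<lambda>k. f k p) else x0) \<in> M \<rightarrow>\<^sub>M X"
proof (rule measurable_restrict_space2)
  have [measurable]: "f k \<in> borel_measurable M" for k by (rule X_borel[OF f])
  have fS: "f k p \<in> S" if "p \<in> space M" for k p
    using measurable_space[OF f that] by (simp add: space_X)
  have "lim (\<lambda>k. f k p) \<in> S" if "Cauchy (\<lambda>k. f k p)" "p \<in> space M" for p
    using closed_sequentially[OF closed_S fS[OF that(2)]] that(1)
    by (simp add: Cauchy_convergent_iff convergent_LIMSEQ_iff)
  then show "(\<lambda>p. if Cauchy (\<lambda>k. f k p) then lim (\<lambda>k. f k p) else x0) \<in> space M \<rightarrow> S"
    using x0 by auto
  show "(\<lambda>p. if Cauchy (\<lambda>k. f k p) then lim (\<lambda>k. f k p) else x0) \<in> borel_measurable M"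
    by measurable
qed

text \<open>Since \<open>x \<mapsto> Z x\<close> is Lipschitz into \<open>L\<^sup>2(P)\<close>, evaluating it at points of a countable dense set
  that approach \<open>x\<close> geometrically fast converges almost surely.\<close>

lemma jointly_measurable_version:
  obtains \<Phi> where "\<Phi> \<in> X \<Otimes>\<^sub>M P \<rightarrow>\<^sub>M X" "\<And>x. x \<in> S \<Longrightarrow> AE \<omega> in P. \<Phi> (x, \<omega>) = Z x \<omega>"
proof -
  obtain T where T: "countable T" "T \<subseteq> S" "S \<subseteq> closure T" by (rule separable)
  have "T \<noteq> {}" using T x0 by auto
  define dd where "dd = from_nat_into T"
  have dd: "range dd = T" unfolding dd_def using T(1) \<open>T \<noteq> {}\<close> by (rule range_from_nat_into[rotated])
  \<comment> \<open>The first point of the dense sequence within distance \<open>(1/2)^k\<close> of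
    \<open>x\<close>. It depends measurably on \<open>x\<close> and takes countably many values, so
    \<open>Z\<close> evaluated at it is jointly measurable.\<close>
  define idx where "idx k x = (LEAST i. norm (x - dd i) < (1/2)^k)" for k :: nat and x
  have idx [measurable]: "idx k \<in> borel \<rightarrow>\<^sub>M count_space UNIV" for k unfolding idx_def by measurable
  have ddS: "dd i \<in> S" for i using dd T(2) by blast
  have near: "norm (x - dd (idx k x)) < (1/2)^k" if "x \<in> S" for k x
  proof -
    have "x \<in> closure T" using T(3) that by blast
    then obtain y where "y \<in> T" "dist y x < (1/2)^k"
      unfolding closure_approachable by (metis zero_less_power half_gt_zero zero_less_one)
    moreover from this have "y \<in> range dd" by (simp add: dd)
    ultimately have "\<exists>i. norm (x - dd i) < (1/2)^k" by (auto simp: dist_norm norm_minus_commute)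
    then show ?thesis unfolding idx_def by (rule LeastI_ex)
  qed
  define f where "f k p = Z (dd (idx k (fst p))) (snd p)" for k p
  have f: "f k \<in> X \<Otimes>\<^sub>M P \<rightarrow>\<^sub>M X" for k
    unfolding f_def
  proof (rule measurable_compose_countable)
    show "(\<lambda>p. Z (dd i) (snd p)) \<in> X \<Otimes>\<^sub>M P \<rightarrow>\<^sub>M X" for i
      by (rule measurable_compose[OF measurable_snd Z_measurable[OF ddS]])
    show "(\<lambda>p. idx k (fst p)) \<in> X \<Otimes>\<^sub>M P \<rightarrow>\<^sub>M count_space UNIV"
      by (rule measurable_compose[OF X_borel[OF measurable_fst] idx])
  qed
  define \<Phi> where "\<Phi> p = (if Cauchy (\<lambda>k. f k p) then lim (\<lambda>k. f k p) else x0)" for p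
  show ?thesis
  proof (rule that[of \<Phi>])
    show "\<Phi> \<in> X \<Otimes>\<^sub>M P \<rightarrow>\<^sub>M X" unfolding \<Phi>_def by (rule measurable_if_lim[OF f])
    fix x assume x: "x \<in> S"
    note [measurable] = Z_borel[OF x] Z_borel[OF ddS]
    have "AE \<omega> in P. summable (\<lambda>k. norm (Z (dd (idx k x)) \<omega> - Z x \<omega>))"
    proof (rule AE_summable_of_nn_integral_le[where r = "1/2" and C = "\<rho>\<^sup>2"])
      fix k
      have "(\<integral>\<^sup>+\<omega>. ennreal ((norm (Z (dd (idx k x)) \<omega> - Z x \<omega>))\<^sup>2) \<partial>P)
          \<le> ennreal ((\<rho> * norm (dd (idx k x) - x))\<^sup>2)" by (rule contraction[OF ddS x])
      also have "\<dots> \<le> ennreal ((\<rho> * (1/2)^k)\<^sup>2)"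
        using near[OF x, of k] \<rho> by (intro ennreal_leI power_mono mult_left_mono) (auto simp: norm_minus_commute)
      also have "\<dots> = ennreal (\<rho>\<^sup>2 * ((1/2)^k)\<^sup>2)" by (simp add: power_mult_distrib)
      finally show "(\<integral>\<^sup>+\<omega>. ennreal ((norm (Z (dd (idx k x)) \<omega> - Z x \<omega>))\<^sup>2) \<partial>P) \<le> \<dots>" .
    qed auto
    then show "AE \<omega> in P. \<Phi> (x, \<omega>) = Z x \<omega>"
    proof eventually_elim
      fix \<omega> assume "summable (\<lambda>k. norm (Z (dd (idx k x)) \<omega> - Z x \<omega>))"
      then have "(\<lambda>k. Z (dd (idx k x)) \<omega> - Z x \<omega>) \<longlonglongrightarrow> 0"
        using summable_LIMSEQ_zero tendsto_norm_zero_iff by blast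
      then have "(\<lambda>k. f k (x, \<omega>)) \<longlonglongrightarrow> Z x \<omega>" unfolding f_def by (simp add: LIM_zero_iff)
      then show "\<Phi> (x, \<omega>) = Z x \<omega>"
        unfolding \<Phi>_def using LIMSEQ_imp_Cauchy limI by auto
    qed
  qed
qed

text \<open>Composing independent copies of the random map in the reverse order gives a sequence that
  converges almost surely, unlike the forward Markov chain.\<close>

lemma invariant_measure_exists: "\<exists>\<pi>. invariant_measure X kernel \<pi>"
proof -
  obtain \<Phi> where \<Phi> [measurable]: "\<Phi> \<in> X \<Otimes>\<^sub>M P \<rightarrow>\<^sub>M X" and \<Phi>_Z: "\<And>x. x \<in> S \<Longrightarrow> AE \<omega> in P. \<Phi> (x, \<omega>) = Z x \<omega>"
    by (rule jointly_measurable_version) blast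
  let ?SS = "stream_space P"
  interpret SS: prob_space ?SS by (rule prob_space_stream_space)
  define V where "V = backward \<Phi> x0"
  have V [measurable]: "V n \<in> ?SS \<rightarrow>\<^sub>M X" for n
  proof (induction n)
    case 0
    show ?case using x0 by (simp add: V_def space_X)
  next
    case (Suc n)
    note [measurable] = Suc
    have "(\<lambda>s. \<Phi> (V n (stl s), shd s)) \<in> ?SS \<rightarrow>\<^sub>M X" by measurable
    then show ?case by (simp add: V_def)
  qed
  have VS: "V n s \<in> S" if "s \<in> space ?SS" for n s
    using measurable_space[OF V that] by (simp add: space_X)
  note X_borel[OF V, measurable] X_borel[OF \<Phi>, measurable]
  define C where "C = enn2real (\<integral>\<^sup>+\<omega>. ennreal ((norm (Z x0 \<omega> - x0))\<^sup>2) \<partial>P)"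
  have C: "(\<integral>\<^sup>+\<omega>. ennreal ((norm (Z x0 \<omega> - x0))\<^sup>2) \<partial>P) = ennreal C" "0 \<le> C"
    using moment by (auto simp: C_def)
  \<comment> \<open>Both iterates have the same outermost map, driven by the head and independent of
    the tails inside. Integrating out the head first gains one factor \<open>\<rho>\<^sup>2\<close>
    and shortens both by one.\<close>
  have step: "(\<integral>\<^sup>+s. ennreal ((norm (V (Suc n) s - V n s))\<^sup>2) \<partial>?SS) \<le> ennreal (C * (\<rho> ^ n)\<^sup>2)" for n
  proof (induction n)
    case 0
    have "(\<integral>\<^sup>+s. ennreal ((norm (V (Suc 0) s - V 0 s))\<^sup>2) \<partial>?SS) =
        (\<integral>\<^sup>+s. (\<lambda>(s, \<omega>). ennreal ((norm (\<Phi> (V 0 s, \<omega>) - x0))\<^sup>2)) (stl s, shd s) \<partial>?SS)"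
      by (simp add: V_def)
    also have "\<dots> = (\<integral>\<^sup>+s. \<integral>\<^sup>+\<omega>. (\<lambda>(s, \<omega>). ennreal ((norm (\<Phi> (V 0 s, \<omega>) - x0))\<^sup>2)) (s, \<omega>) \<partial>P \<partial>?SS)"
      by (rule nn_integral_stream_shift) measurable
    also have "\<dots> = (\<integral>\<^sup>+s. \<integral>\<^sup>+\<omega>. ennreal ((norm (Z x0 \<omega> - x0))\<^sup>2) \<partial>P \<partial>?SS)"
      using \<Phi>_Z[OF x0] by (intro nn_integral_cong nn_integral_cong_AE) (auto simp: V_def elim!: eventually_mono)
    finally show ?case using C by (simp add: SS.emeasure_space_1)
  next
    case (Suc n)
    have "(\<integral>\<^sup>+s. ennreal ((norm (V (Suc (Suc n)) s - V (Suc n) s))\<^sup>2) \<partial>?SS) =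
        (\<integral>\<^sup>+s. (\<lambda>(s, \<omega>). ennreal ((norm (\<Phi> (V (Suc n) s, \<omega>) - \<Phi> (V n s, \<omega>)))\<^sup>2)) (stl s, shd s) \<partial>?SS)"
      by (simp add: V_def)
    also have "\<dots> = (\<integral>\<^sup>+s. \<integral>\<^sup>+\<omega>. (\<lambda>(s, \<omega>). ennreal ((norm (\<Phi> (V (Suc n) s, \<omega>) - \<Phi> (V n s, \<omega>)))\<^sup>2)) (s, \<omega>) \<partial>P \<partial>?SS)"
      by (rule nn_integral_stream_shift) measurable
    also have "\<dots> \<le> (\<integral>\<^sup>+s. ennreal (\<rho>\<^sup>2) * ennreal ((norm (V (Suc n) s - V n s))\<^sup>2) \<partial>?SS)"
    proof (rule nn_integral_mono)
      fix s assume s: "s \<in> space ?SS"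
      have "(\<integral>\<^sup>+\<omega>. ennreal ((norm (\<Phi> (V (Suc n) s, \<omega>) - \<Phi> (V n s, \<omega>)))\<^sup>2) \<partial>P) =
          (\<integral>\<^sup>+\<omega>. ennreal ((norm (Z (V (Suc n) s) \<omega> - Z (V n s) \<omega>))\<^sup>2) \<partial>P)"
      proof (rule nn_integral_cong_AE)
        show "AE \<omega> in P. ennreal ((norm (\<Phi> (V (Suc n) s, \<omega>) - \<Phi> (V n s, \<omega>)))\<^sup>2) =
            ennreal ((norm (Z (V (Suc n) s) \<omega> - Z (V n s) \<omega>))\<^sup>2)"
          using \<Phi>_Z[OF VS[OF s, of "Suc n"]] \<Phi>_Z[OF VS[OF s, of n]] by eventually_elim simp
      qed
      also have "\<dots> \<le> ennreal ((\<rho> * norm (V (Suc n) s - V n s))\<^sup>2)" by (intro contraction VS s)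
      finally show "(\<integral>\<^sup>+\<omega>. (\<lambda>(s, \<omega>). ennreal ((norm (\<Phi> (V (Suc n) s, \<omega>) - \<Phi> (V n s, \<omega>)))\<^sup>2)) (s, \<omega>) \<partial>P)
          \<le> ennreal (\<rho>\<^sup>2) * ennreal ((norm (V (Suc n) s - V n s))\<^sup>2)"
        by (simp add: power_mult_distrib ennreal_mult)
    qed
    also have "\<dots> = ennreal (\<rho>\<^sup>2) * (\<integral>\<^sup>+s. ennreal ((norm (V (Suc n) s - V n s))\<^sup>2) \<partial>?SS)"
      by (rule nn_integral_cmult) measurable
    also have "\<dots> \<le> ennreal (\<rho>\<^sup>2) * ennreal (C * (\<rho> ^ n)\<^sup>2)" by (intro mult_left_mono Suc.IH) simp
    also have "\<dots> = ennreal (C * (\<rho> ^ Suc n)\<^sup>2)"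
      using C(2) by (simp add: ennreal_mult[symmetric] power_mult_distrib mult_ac)
    finally show ?case .
  qed
  have conv: "AE s in ?SS. convergent (\<lambda>n. V n s)"
    by (rule AE_convergent_of_nn_integral_le[OF _ \<rho> C(2) step]) measurable
  \<comment> \<open>The law of this limit is the invariant measure.\<close>
  define W where "W s = (if Cauchy (\<lambda>n. V n s) then lim (\<lambda>n. V n s) else x0)" for s
  have W: "W \<in> ?SS \<rightarrow>\<^sub>M X" unfolding W_def by (rule measurable_if_lim[OF V])
  have WS: "W s \<in> S" if "s \<in> space ?SS" for s
    using measurable_space[OF W that] by (simp add: space_X)
  have VW: "AE s in ?SS. (\<lambda>n. V n s) \<longlonglongrightarrow> W s"
    using conv by eventually_elim (simp add: W_def Cauchy_convergent_iff convergent_LIMSEQ_iff)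
  have lim: "(\<lambda>n. \<integral>s. g (V n s) \<partial>?SS) \<longlonglongrightarrow> (\<integral>s. g (W s) \<partial>?SS)" if g: "test L g" for g L
  proof (rule integral_dominated_convergence[where w = "\<lambda>_. 1"])
    show "(\<lambda>s. g (W s)) \<in> borel_measurable ?SS" "(\<lambda>s. g (V n s)) \<in> borel_measurable ?SS" for n
      using measurable_compose[OF W test_measurable[OF g]] measurable_compose[OF V test_measurable[OF g]] by auto
    show "AE s in ?SS. norm (g (V n s)) \<le> 1" for n
      using VS g by (intro AE_I2) (auto simp: test_def)
    show "AE s in ?SS. (\<lambda>n. g (V n s)) \<longlonglongrightarrow> g (W s)"
      using VW AE_space
    proof eventually_elim
      fix s assume s: "(\<lambda>n. V n s) \<longlonglongrightarrow> W s" "s \<in> space ?SS"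
      have "continuous_on S g" using g by (auto simp: test_def intro: lipschitz_on_continuous_on)
      then show "(\<lambda>n. g (V n s)) \<longlonglongrightarrow> g (W s)"
        using s VS WS by (intro continuous_on_tendsto_compose[of S g]) auto
    qed
  qed auto
  \<comment> \<open>The outermost map is independent of what is inside it, so in law one more
    backward step is one more application of the kernel. Letting \<open>n\<close> tend to infinity
    on both sides gives invariance.\<close>
  have eq: "(\<integral>s. g (V (Suc n) s) \<partial>?SS) = (\<integral>s. transition g (V n s) \<partial>?SS)" if g: "test L g" for g L n
  proof -
    note [measurable] = test_measurable[OF g]
    have "ennreal (\<integral>s. g (V (Suc n) s) \<partial>?SS) = (\<integral>\<^sup>+s. (\<lambda>(s, \<omega>). ennreal (g (\<Phi> (V n s, \<omega>)))) (stl s, shd s) \<partial>?SS)"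
      using test_nn_integral[OF g SS.prob_space_axioms V[of "Suc n"]] by (simp add: V_def)
    also have "\<dots> = (\<integral>\<^sup>+s. \<integral>\<^sup>+\<omega>. (\<lambda>(s, \<omega>). ennreal (g (\<Phi> (V n s, \<omega>)))) (s, \<omega>) \<partial>P \<partial>?SS)"
      by (rule nn_integral_stream_shift) measurable
    also have "\<dots> = (\<integral>\<^sup>+s. ennreal (transition g (V n s)) \<partial>?SS)"
    proof (rule nn_integral_cong)
      fix s assume s: "s \<in> space ?SS"
      have "(\<integral>\<^sup>+\<omega>. ennreal (g (\<Phi> (V n s, \<omega>))) \<partial>P) = (\<integral>\<^sup>+\<omega>. ennreal (g (Z (V n s) \<omega>)) \<partial>P)"
        using \<Phi>_Z[OF VS[OF s, of n]] by (intro nn_integral_cong_AE) (auto elim!: eventually_mono)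
      also have "\<dots> = ennreal (transition g (V n s))"
        unfolding transition_def by (intro test_nn_integral[OF g] prob_space_axioms Z_measurable VS s)
      finally show "(\<integral>\<^sup>+\<omega>. (\<lambda>(s, \<omega>). ennreal (g (\<Phi> (V n s, \<omega>)))) (s, \<omega>) \<partial>P) = ennreal (transition g (V n s))" by simp
    qed
    also have "\<dots> = ennreal (\<integral>s. transition g (V n s) \<partial>?SS)"
      by (rule test_nn_integral[OF test_transition[OF g] SS.prob_space_axioms V])
    finally show ?thesis
      using g test_transition[OF g] VS
      by (subst (asm) ennreal_inj) (auto simp: test_def intro!: Bochner_Integration.integral_nonneg)
  qed
  have "distr ?SS X W \<in> space (prob_algebra X)"
    using SS.prob_space_distr[OF W] by (simp add: space_prob_algebra)
  then have "invariant_measure X kernel (distr ?SS X W)"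
  proof (rule invariant_measureI)
    fix g L assume g: "test L g"
    have "(\<integral>s. transition g (W s) \<partial>?SS) = (\<integral>s. g (W s) \<partial>?SS)"
      using LIMSEQ_unique[OF lim[OF test_transition[OF g]]] LIMSEQ_Suc[OF lim[OF g]] by (simp add: eq[OF g])
    then show "(\<integral>x. transition g x \<partial>distr ?SS X W) = (\<integral>x. g x \<partial>distr ?SS X W)"
      using W test_measurable[OF g] test_measurable[OF test_transition[OF g]] by (simp add: integral_distr)
  qed
  then show ?thesis by blast
qed

theorem ex1_invariant_measure: "\<exists>!\<pi>. invariant_measure X kernel \<pi>"
  using invariant_measure_exists invariant_measure_unique by blast

end

subsection \<open>Random series with independent coefficients\<close>

lemma power2_norm_add_scaleR:
  fixes u v :: "'h::real_inner"
  shows "(norm (u + t *\<^sub>R v))\<^sup>2 = (norm u)\<^sup>2 + (2 * (t * (u \<bullet> v)) + (norm v)\<^sup>2 * t\<^sup>2)"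
  unfolding power2_norm_eq_inner
  by (simp add: inner_add_left inner_add_right inner_commute[of v u] power2_eq_square algebra_simps)

text \<open>A finite Ito isometry: independent centred coefficients are orthogonal, so all cross
  terms vanish. The square is expanded into products of two real coefficients, which yields
  integrability along with the value.\<close>

lemma (in prob_space) expectation_norm_series:
  fixes \<xi> :: "nat \<Rightarrow> 'a \<Rightarrow> real" and d :: "nat \<Rightarrow> 'h::real_inner"
  assumes i: "\<And>j. integrable M (\<xi> j)" and i2: "\<And>j. integrable M (\<lambda>\<omega>. (\<xi> j \<omega>)\<^sup>2)"
    and mean: "\<And>j. expectation (\<xi> j) = 0" and var: "\<And>j. expectation (\<lambda>\<omega>. (\<xi> j \<omega>)\<^sup>2) = v"
    and indep: "indep_vars (\<lambda>_. borel) \<xi> UNIV"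
  shows "integrable M (\<lambda>\<omega>. (norm (a + (\<Sum>j<n. \<xi> j \<omega> *\<^sub>R d j)))\<^sup>2)"
    and "expectation (\<lambda>\<omega>. (norm (a + (\<Sum>j<n. \<xi> j \<omega> *\<^sub>R d j)))\<^sup>2) = (norm a)\<^sup>2 + v * (\<Sum>j<n. (norm (d j))\<^sup>2)"
proof (induction n)
  case 0
  {
    case 1 show ?case by simp
  next
    case 2 show ?case by (simp add: prob_space)
  }
next
  case (Suc n)
  let ?A = "\<lambda>\<omega>. a + (\<Sum>j<n. \<xi> j \<omega> *\<^sub>R d j)"
  have prod: "integrable M (\<lambda>\<omega>. \<xi> n \<omega> * \<xi> j \<omega>)" "expectation (\<lambda>\<omega>. \<xi> n \<omega> * \<xi> j \<omega>) = 0" if "j < n" for j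
  proof -
    have iv: "indep_vars (\<lambda>_. borel) \<xi> {n, j}" by (rule indep_vars_subset[OF indep]) simp
    have "integrable M (\<lambda>\<omega>. \<Prod>i\<in>{n, j}. \<xi> i \<omega>)" by (rule indep_vars_integrable[OF _ iv i]) simp
    then show "integrable M (\<lambda>\<omega>. \<xi> n \<omega> * \<xi> j \<omega>)" using that by simp
    have "expectation (\<lambda>\<omega>. \<Prod>i\<in>{n, j}. \<xi> i \<omega>) = (\<Prod>i\<in>{n, j}. expectation (\<xi> i))"
      by (rule indep_vars_lebesgue_integral[OF _ iv i]) simp
    then show "expectation (\<lambda>\<omega>. \<xi> n \<omega> * \<xi> j \<omega>) = 0" using that by (simp add: mean)
  qed
  \<comment> \<open>Only products of the new coefficient with an earlier one occur; their indices
    differ, so independence applies.\<close>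
  have cross_eq: "\<xi> n \<omega> * (?A \<omega> \<bullet> d n) = (a \<bullet> d n) * \<xi> n \<omega> + (\<Sum>j<n. (d j \<bullet> d n) * (\<xi> n \<omega> * \<xi> j \<omega>))" for \<omega>
    by (simp add: inner_add_left inner_sum_left sum_distrib_left distrib_left mult_ac)
  have cross1: "integrable M (\<lambda>\<omega>. \<xi> n \<omega> * (?A \<omega> \<bullet> d n))"
    unfolding cross_eq using i prod(1) by (intro Bochner_Integration.integrable_add Bochner_Integration.integrable_sum integrable_mult_right) auto
  have cross2: "expectation (\<lambda>\<omega>. \<xi> n \<omega> * (?A \<omega> \<bullet> d n)) = 0"
    unfolding cross_eq using i prod mean by (subst Bochner_Integration.integral_add) (auto simp: Bochner_Integration.integral_sum)
  note cross = cross1 cross2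
  have eq: "(norm (a + (\<Sum>j<Suc n. \<xi> j \<omega> *\<^sub>R d j)))\<^sup>2 =
      (norm (?A \<omega>))\<^sup>2 + (2 * (\<xi> n \<omega> * (?A \<omega> \<bullet> d n)) + (norm (d n))\<^sup>2 * (\<xi> n \<omega>)\<^sup>2)" for \<omega>
    using power2_norm_add_scaleR[of "?A \<omega>" "\<xi> n \<omega>" "d n"] by (simp only: sum.lessThan_Suc add.assoc)
  have I: "integrable M (\<lambda>\<omega>. 2 * (\<xi> n \<omega> * (?A \<omega> \<bullet> d n)) + (norm (d n))\<^sup>2 * (\<xi> n \<omega>)\<^sup>2)"
    using cross i2 by simp
  {
    case 1 show ?case unfolding eq by (rule Bochner_Integration.integrable_add[OF Suc.IH(1) I])
  next
    case 2
    have "expectation (\<lambda>\<omega>. 2 * (\<xi> n \<omega> * (?A \<omega> \<bullet> d n)) + (norm (d n))\<^sup>2 * (\<xi> n \<omega>)\<^sup>2) = (norm (d n))\<^sup>2 * v"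
      using cross i2 by (simp add: var)
    then show ?case
      unfolding eq Bochner_Integration.integral_add[OF Suc.IH(1) I] Suc.IH(2) by (simp add: algebra_simps)
  }
qed

text \<open>Young's inequality with weights \<open>1 + \<epsilon>\<close> and
  \<open>1 + 1 / \<epsilon>\<close>: the second term vanishes in the limit, then \<epsilon> tends to
  0. This keeps the constant \<open>C\<close> exact; a lost factor 2 would ruin the contraction for
  small steps.\<close>

lemma nn_integral_norm_limit_le:
  fixes Y :: "'a \<Rightarrow> 'h::{real_inner, second_countable_topology}"
  assumes [measurable]: "\<And>n. f n \<in> borel_measurable M" "Y \<in> borel_measurable M" and C: "0 \<le> C"
    and lim: "(\<lambda>n. \<integral>\<^sup>+\<omega>. ennreal ((norm (f n \<omega> - Y \<omega>))\<^sup>2) \<partial>M) \<longlonglongrightarrow> 0"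
    and le: "\<And>n. (\<integral>\<^sup>+\<omega>. ennreal ((norm (f n \<omega>))\<^sup>2) \<partial>M) \<le> ennreal C"
  shows "(\<integral>\<^sup>+\<omega>. ennreal ((norm (Y \<omega>))\<^sup>2) \<partial>M) \<le> ennreal C"
proof -
  have main: "(\<integral>\<^sup>+\<omega>. ennreal ((norm (Y \<omega>))\<^sup>2) \<partial>M) \<le> ennreal ((1 + \<epsilon>) * C)" if \<epsilon>: "0 < \<epsilon>" for \<epsilon>
  proof -
    have pt: "(norm y)\<^sup>2 \<le> (1 + \<epsilon>) * (norm x)\<^sup>2 + (1 + 1 / \<epsilon>) * (norm (x - y))\<^sup>2" for x y :: 'h
    proof -
      define p q where "p = norm x" and "q = norm (x - y)"
      have "norm y \<le> p + q" unfolding p_def q_def by (metis norm_minus_commute norm_triangle_sub)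
      then have "(norm y)\<^sup>2 \<le> (p + q)\<^sup>2" by (intro power_mono) auto
      also have "\<dots> \<le> (1 + \<epsilon>) * p\<^sup>2 + (1 + 1 / \<epsilon>) * q\<^sup>2"
      proof -
        have "0 \<le> (\<epsilon> * p - q)\<^sup>2 / \<epsilon>" using \<epsilon> by simp
        also have "(\<epsilon> * p - q)\<^sup>2 / \<epsilon> = \<epsilon> * p\<^sup>2 - 2 * p * q + q\<^sup>2 / \<epsilon>"
          using \<epsilon> by (simp add: power2_eq_square field_simps)
        finally show ?thesis by (simp add: power2_eq_square algebra_simps)
      qed
      finally show ?thesis by (simp add: p_def q_def)
    qed
    have "(\<integral>\<^sup>+\<omega>. ennreal ((norm (Y \<omega>))\<^sup>2) \<partial>M) \<le>
        ennreal ((1 + \<epsilon>) * C) + ennreal (1 + 1 / \<epsilon>) * (\<integral>\<^sup>+\<omega>. ennreal ((norm (f n \<omega> - Y \<omega>))\<^sup>2) \<partial>M)" for n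
    proof -
      have "(\<integral>\<^sup>+\<omega>. ennreal ((norm (Y \<omega>))\<^sup>2) \<partial>M) \<le>
          (\<integral>\<^sup>+\<omega>. ennreal (1 + \<epsilon>) * ennreal ((norm (f n \<omega>))\<^sup>2) + ennreal (1 + 1 / \<epsilon>) * ennreal ((norm (f n \<omega> - Y \<omega>))\<^sup>2) \<partial>M)"
        using pt \<epsilon> by (intro nn_integral_mono) (simp flip: ennreal_mult ennreal_plus)
      also have "\<dots> = ennreal (1 + \<epsilon>) * (\<integral>\<^sup>+\<omega>. ennreal ((norm (f n \<omega>))\<^sup>2) \<partial>M) +
          ennreal (1 + 1 / \<epsilon>) * (\<integral>\<^sup>+\<omega>. ennreal ((norm (f n \<omega> - Y \<omega>))\<^sup>2) \<partial>M)"
        by (subst nn_integral_add) (auto simp: nn_integral_cmult)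
      also have "\<dots> \<le> ennreal (1 + \<epsilon>) * ennreal C +
          ennreal (1 + 1 / \<epsilon>) * (\<integral>\<^sup>+\<omega>. ennreal ((norm (f n \<omega> - Y \<omega>))\<^sup>2) \<partial>M)"
        by (intro add_right_mono mult_left_mono le) simp
      also have "ennreal (1 + \<epsilon>) * ennreal C = ennreal ((1 + \<epsilon>) * C)"
        using C \<epsilon> by (intro ennreal_mult[symmetric]) auto
      finally show ?thesis .
    qed
    moreover have "(\<lambda>n. ennreal ((1 + \<epsilon>) * C) + ennreal (1 + 1 / \<epsilon>) * (\<integral>\<^sup>+\<omega>. ennreal ((norm (f n \<omega> - Y \<omega>))\<^sup>2) \<partial>M))
        \<longlonglongrightarrow> ennreal ((1 + \<epsilon>) * C) + ennreal (1 + 1 / \<epsilon>) * 0"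
      by (intro tendsto_add tendsto_const ennreal_tendsto_cmult lim) simp
    ultimately show ?thesis by (intro tendsto_lowerbound[of _ _ sequentially]) auto
  qed
  have "(\<lambda>m. ennreal ((1 + 1 / Suc m) * C)) \<longlonglongrightarrow> ennreal ((1 + 0) * C)"
    by (intro tendsto_ennrealI tendsto_intros lim_inverse_n' LIMSEQ_Suc)
  then have "(\<lambda>m. ennreal ((1 + 1 / Suc m) * C)) \<longlonglongrightarrow> ennreal C" by simp
  then show ?thesis
    by (rule tendsto_lowerbound) (auto intro!: always_eventually main)
qed

text \<open>The weight \<open>w\<close> is there to carry the indicator of an event of the past in
  the Markov property.\<close>

lemma (in prob_space) tendsto_expectation_Lipschitz:
  fixes Y :: "'a \<Rightarrow> 'h::{banach, second_countable_topology}" and G :: "'h \<Rightarrow> real" and w :: "'a \<Rightarrow> real"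
  assumes m [measurable]: "\<And>n. f n \<in> borel_measurable M" "Y \<in> borel_measurable M" "w \<in> borel_measurable M"
    and w: "\<And>\<omega>. 0 \<le> w \<omega>" "\<And>\<omega>. w \<omega> \<le> 1"
    and lim: "(\<lambda>n. \<integral>\<^sup>+\<omega>. ennreal ((norm (f n \<omega> - Y \<omega>))\<^sup>2) \<partial>M) \<longlonglongrightarrow> 0"
    and G: "L-lipschitz_on UNIV G" "\<And>x. 0 \<le> G x" "\<And>x. G x \<le> 1"
  shows "(\<lambda>n. expectation (\<lambda>\<omega>. w \<omega> * G (f n \<omega>))) \<longlonglongrightarrow> expectation (\<lambda>\<omega>. w \<omega> * G (Y \<omega>))"
proof (rule tendsto_L1_int)
  have [measurable]: "G \<in> borel_measurable borel"
    using lipschitz_on_continuous_on[OF G(1)] by (rule borel_measurable_continuous_onI)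
  have L: "0 \<le> L" using lipschitz_on_nonneg[OF G(1)] .
  show "integrable M (\<lambda>\<omega>. w \<omega> * G (f n \<omega>))" for n
    using w G by (intro integrable_const_bound[of _ 1]) (auto simp: mult_le_one)
  show "integrable M (\<lambda>\<omega>. w \<omega> * G (Y \<omega>))"
    using w G by (intro integrable_const_bound[of _ 1]) (auto simp: mult_le_one)
  define \<delta> where "\<delta> n = (\<integral>\<^sup>+\<omega>. ennreal ((norm (f n \<omega> - Y \<omega>))\<^sup>2) \<partial>M)" for n
  \<comment> \<open>The mean square error may be infinite for finitely many \<open>n\<close>, so the
    estimate can only be claimed eventually.\<close>
  have ev: "eventually (\<lambda>n. \<delta> n < 1) sequentially"
    using order_tendstoD(2)[OF lim, of 1] by (simp add: \<delta>_def)
  have "(\<lambda>n. enn2real (\<delta> n)) \<longlonglongrightarrow> enn2real 0"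
    using lim by (intro tendsto_enn2real) (auto simp: \<delta>_def)
  then have "(\<lambda>n. sqrt (enn2real (\<delta> n))) \<longlonglongrightarrow> sqrt 0" by (intro tendsto_real_sqrt) simp
  then have "(\<lambda>n. ennreal (L * sqrt (enn2real (\<delta> n)))) \<longlonglongrightarrow> ennreal (L * sqrt 0)"
    by (intro tendsto_ennrealI tendsto_mult tendsto_const)
  then have lim0: "(\<lambda>n. ennreal (L * sqrt (enn2real (\<delta> n)))) \<longlonglongrightarrow> 0" by simp
  have "eventually (\<lambda>n. (\<integral>\<^sup>+\<omega>. norm (w \<omega> * G (f n \<omega>) - w \<omega> * G (Y \<omega>)) \<partial>M) \<le> ennreal (L * sqrt (enn2real (\<delta> n)))) sequentially"
    using ev
  proof eventually_elim
    fix n assume "\<delta> n < 1"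
    then have "\<delta> n < top" by (rule order_less_trans) simp
    then have fin: "\<delta> n = ennreal ((sqrt (enn2real (\<delta> n)))\<^sup>2)" by simp
    have "(\<integral>\<^sup>+\<omega>. norm (w \<omega> * G (f n \<omega>) - w \<omega> * G (Y \<omega>)) \<partial>M) \<le> (\<integral>\<^sup>+\<omega>. ennreal L * ennreal (norm (f n \<omega> - Y \<omega>)) \<partial>M)"
    proof (rule nn_integral_mono)
      fix \<omega>
      have "norm (w \<omega> * G (f n \<omega>) - w \<omega> * G (Y \<omega>)) = w \<omega> * \<bar>G (f n \<omega>) - G (Y \<omega>)\<bar>"
        using w(1)[of \<omega>] by (simp add: abs_mult flip: right_diff_distrib)
      also have "\<dots> \<le> 1 * (L * norm (f n \<omega> - Y \<omega>))"
        using lipschitz_onD[OF G(1), of "f n \<omega>" "Y \<omega>"] w[of \<omega>]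
        by (intro mult_mono) (auto simp: dist_real_def dist_norm)
      finally show "ennreal (norm (w \<omega> * G (f n \<omega>) - w \<omega> * G (Y \<omega>))) \<le> ennreal L * ennreal (norm (f n \<omega> - Y \<omega>))"
        using L by (simp flip: ennreal_mult add: ennreal_leI)
    qed
    also have "\<dots> = ennreal L * (\<integral>\<^sup>+\<omega>. ennreal (norm (f n \<omega> - Y \<omega>)) \<partial>M)" by (rule nn_integral_cmult) measurable
    also have "\<dots> \<le> ennreal L * ennreal (sqrt (enn2real (\<delta> n)))"
    proof (rule mult_left_mono[OF expectation_le_L2])
      show "(\<integral>\<^sup>+\<omega>. ennreal ((norm (f n \<omega> - Y \<omega>))\<^sup>2) \<partial>M) \<le> ennreal ((sqrt (enn2real (\<delta> n)))\<^sup>2)"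
        unfolding \<delta>_def[symmetric] by (rule eq_refl[OF fin])
    qed auto
    finally show "(\<integral>\<^sup>+\<omega>. norm (w \<omega> * G (f n \<omega>) - w \<omega> * G (Y \<omega>)) \<partial>M) \<le> ennreal (L * sqrt (enn2real (\<delta> n)))"
      using L by (simp add: ennreal_mult)
  qed
  then show "(\<lambda>n. \<integral>\<^sup>+\<omega>. norm (w \<omega> * G (f n \<omega>) - w \<omega> * G (Y \<omega>)) \<partial>M) \<longlonglongrightarrow> 0"
    by (intro tendsto_sandwich[OF _ _ tendsto_const lim0]) auto
qed

subsection \<open>An abstract semi-implicit scheme\<close>

locale euler_scheme = prob_space P for P :: "'w measure" +
  fixes Fil :: "real \<Rightarrow> 'w measure" and \<beta> :: "nat \<Rightarrow> real \<Rightarrow> 'w \<Rightarrow> real"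
    and S :: "'h::{real_inner, banach, second_countable_topology} set" and dom :: "'h set"
    and res :: "'h \<Rightarrow> 'h" and b :: "nat \<Rightarrow> 'h \<Rightarrow> 'h" and \<tau> c K :: real
  assumes filtered: "filtered_prob_space P Fil" and wiener: "wiener_coordinates P Fil \<beta>"
    and closed_S: "closed S" and S_ne: "S \<noteq> {}"
    and pos: "0 < \<tau>" "0 < c" "0 \<le> K" and contr: "c\<^sup>2 * (1 + \<tau> * K\<^sup>2) < 1"
    and res_expand: "\<And>w w'. w \<in> dom \<Longrightarrow> w' \<in> dom \<Longrightarrow> norm (w - w') \<le> c * norm (res w - res w')"
    and b_summable: "\<And>x. x \<in> S \<Longrightarrow> summable (\<lambda>j. (norm (b j x))\<^sup>2)"
    and b_Lipschitz: "\<And>x y. x \<in> S \<Longrightarrow> y \<in> S \<Longrightarrow> (\<Sum>j. (norm (b j x - b j y))\<^sup>2) \<le> (K * norm (x - y))\<^sup>2"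
begin

definition \<xi> :: "nat \<Rightarrow> nat \<Rightarrow> 'w \<Rightarrow> real" where
  "\<xi> k j \<omega> = \<beta> j (real (Suc k) * \<tau>) \<omega> - \<beta> j (real k * \<tau>) \<omega>"

abbreviation Fk :: "nat \<Rightarrow> 'w measure" where "Fk k \<equiv> Fil (real k * \<tau>)"

abbreviation XS :: "'h measure" where "XS \<equiv> restrict_space borel S"

text \<open>The state \<open>u\<close> may be random: a constant \<open>u\<close> yields the kernel,
  and a solution at time \<open>k\<close> yields the chain. The noise \<open>N\<close> is fixed only
  up to a null set, as a mean square limit.\<close>

definition one_step :: "nat \<Rightarrow> ('w \<Rightarrow> 'h) \<Rightarrow> ('w \<Rightarrow> 'h) \<Rightarrow> bool" where
  "one_step k u w \<longleftrightarrow> (\<exists>N. N \<in> borel_measurable P \<and>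
     (\<lambda>n. \<integral>\<^sup>+\<omega>. ennreal ((norm ((\<Sum>j<n. \<xi> k j \<omega> *\<^sub>R b j (u \<omega>)) - N \<omega>))\<^sup>2) \<partial>P) \<longlonglongrightarrow> 0 \<and>
     (AE \<omega> in P. w \<omega> \<in> dom \<and> res (w \<omega>) = u \<omega> + N \<omega>))"

lemma space_XS: "space XS = S" by (simp add: space_restrict_space)

lemma XS_borel: "f \<in> M \<rightarrow>\<^sub>M XS \<Longrightarrow> f \<in> borel_measurable M"
  by (rule measurable_compose[of f M XS "\<lambda>x. x", simplified]) (auto intro: measurable_restrict_space1)

lemma subalg: "subalgebra P (Fk k)"
  using filtered pos by (simp add: filtered_prob_space_def)

lemma brownian: "brownian_motion P Fil (\<beta> j)"
  using wiener by (simp add: wiener_coordinates_def)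

lemma times: "0 \<le> real k * \<tau>" "real k * \<tau> < real (Suc k) * \<tau>" "real (Suc k) * \<tau> - real k * \<tau> = \<tau>"
  using pos by (auto simp: algebra_simps)

lemma \<beta>_measurable: "0 \<le> t \<Longrightarrow> \<beta> j t \<in> borel_measurable P"
  using brownian[of j] filtered measurable_from_subalg[of P "Fil t" "\<beta> j t" borel]
  by (auto simp: brownian_motion_def filtered_prob_space_def)

lemma \<xi>_measurable [measurable]: "\<xi> k j \<in> borel_measurable P"
  unfolding \<xi>_def using pos by (intro borel_measurable_diff \<beta>_measurable) auto

lemma \<xi>_distributed: "distributed P lborel (\<xi> k j) (normal_density 0 (sqrt \<tau>))"
proof -
  have "\<forall>s t. 0 \<le> s \<and> s < t \<longrightarrow>
      distributed P lborel (\<lambda>\<omega>. \<beta> j t \<omega> - \<beta> j s \<omega>) (normal_density 0 (sqrt (t - s)))"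
    using brownian[of j] by (auto simp: brownian_motion_def)
  from this[rule_format, of "real k * \<tau>" "real (Suc k) * \<tau>", OF conjI[OF times(1,2)]]
  show ?thesis unfolding times(3) \<xi>_def[abs_def] .
qed

lemma \<xi>_mean: "expectation (\<xi> k j) = 0"
  by (rule normal_distributed_expectation[OF _ \<xi>_distributed]) (simp add: pos)

lemma \<xi>_integrable: "integrable P (\<xi> k j)"
  using integrable_normal_moment_nz_1[of "sqrt \<tau>" 0] pos
  by (intro distributed_integrable_var[OF \<xi>_distributed]) auto

lemma \<xi>_square_integrable: "integrable P (\<lambda>\<omega>. (\<xi> k j \<omega>)\<^sup>2)"
  using integrable_normal_moment[of "sqrt \<tau>" 0 2] pos
  by (subst distributed_integrable[OF \<xi>_distributed, symmetric]) auto

lemma \<xi>_variance: "expectation (\<lambda>\<omega>. (\<xi> k j \<omega>)\<^sup>2) = \<tau>"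
  using normal_distributed_variance[OF _ \<xi>_distributed] pos by (simp add: \<xi>_mean)

lemma \<xi>_indep: "indep_vars (\<lambda>_. borel) (\<xi> k) UNIV"
proof -
  have t: "real k * \<tau> \<in> {0..}" "real (Suc k) * \<tau> \<in> {0..}" using pos by auto
  let ?X = "\<lambda>j \<omega>. \<lambda>t\<in>{0..}. \<beta> j t \<omega>" and ?Y = "\<lambda>(j :: nat) f. f (real (Suc k) * \<tau>) - f (real k * \<tau>) :: real"
  have X: "indep_vars (\<lambda>_. PiM {0..} (\<lambda>_. borel)) ?X UNIV"
    using wiener by (simp add: wiener_coordinates_def)
  have Y: "?Y j \<in> PiM {0..} (\<lambda>_. borel) \<rightarrow>\<^sub>M borel" for j
    using t by (intro borel_measurable_diff measurable_component_singleton)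
  have "indep_vars (\<lambda>_. borel) (\<lambda>j \<omega>. ?Y j (?X j \<omega>)) UNIV"
    by (rule indep_vars_compose2[OF X Y])
  then show ?thesis using t by (simp add: \<xi>_def[abs_def])
qed

section \<open>The law of the noise coordinates and their independence of the past\<close>

abbreviation seq_borel :: "(nat \<Rightarrow> real) measure" where "seq_borel \<equiv> PiM UNIV (\<lambda>_. borel)"

text \<open>The law does not depend on the step \<open>k\<close>; this is the time homogeneity of
  the scheme. The image under the identity only turns a measure built on \<open>lborel\<close> into
  one on \<open>borel\<close>.\<close>

definition noise_law :: "(nat \<Rightarrow> real) measure" where
  "noise_law = PiM UNIV (\<lambda>_. distr (density lborel (normal_density 0 (sqrt \<tau>))) borel (\<lambda>x. x))"

lemma \<Xi>_measurable: "(\<lambda>\<omega> j. \<xi> k j \<omega>) \<in> P \<rightarrow>\<^sub>M seq_borel"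
  by (rule measurable_PiM_single'[where f = "\<xi> k"]) auto

lemma distr_\<Xi>: "distr P seq_borel (\<lambda>\<omega> j. \<xi> k j \<omega>) = noise_law"
proof -
  have "distr P borel (\<xi> k j) = distr (density lborel (normal_density 0 (sqrt \<tau>))) borel (\<lambda>x. x)" for j
  proof -
    have "distr P borel (\<xi> k j) = distr (distr P lborel (\<xi> k j)) borel (\<lambda>x. x)"
      by (subst distr_distr) (auto simp: comp_def)
    then show ?thesis by (simp add: distributed_distr_eq_density[OF \<xi>_distributed])
  qed
  then show ?thesis
    using \<xi>_indep[of k] indep_vars_iff_distr_eq_PiM[where I = UNIV and M' = "\<lambda>_. borel" and X = "\<xi> k"]
    by (simp add: noise_law_def restrict_def)
qed

lemma sets_noise_law [simp, measurable_cong]: "sets noise_law = sets seq_borel"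
  by (simp flip: distr_\<Xi>[of 0])

lemma prob_space_noise_law: "prob_space noise_law"
  using prob_space_distr[OF \<Xi>_measurable[of 0]] by (simp add: distr_\<Xi>)

text \<open>The freezing lemma: given the past, the whole coordinate sequence is integrated out with
  its own law. It uses the joint independence of all coordinates from the past, not just that of
  each one.\<close>

lemma nn_integral_past_noise:
  assumes h: "h \<in> borel_measurable (Fk k \<Otimes>\<^sub>M seq_borel)"
  shows "(\<integral>\<^sup>+\<omega>. h (\<omega>, \<lambda>j. \<xi> k j \<omega>) \<partial>P) = (\<integral>\<^sup>+\<omega>. \<integral>\<^sup>+z. h (\<omega>, z) \<partial>noise_law \<partial>P)"
proof -
  have sp: "space (Fk k) = space P" and sb: "sets (Fk k) \<subseteq> sets P"
    using subalg[of k] by (auto simp: subalgebra_def)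
  have id: "(\<lambda>\<omega>. \<omega>) \<in> P \<rightarrow>\<^sub>M Fk k"
    using sp sb sets.sets_into_space by (auto simp: measurable_def)
  interpret N: prob_space noise_law by (rule prob_space_noise_law)
  have m: "(\<lambda>\<omega>. (\<omega>, \<lambda>j. \<xi> k j \<omega>)) \<in> P \<rightarrow>\<^sub>M Fk k \<Otimes>\<^sub>M seq_borel"
    by (intro measurable_Pair id \<Xi>_measurable)
  let ?V = "sets (vimage_algebra (space P) (\<lambda>\<omega> j. \<xi> k j \<omega>) seq_borel)"
  have indep: "indep_set (sets (Fk k)) ?V"
    using wiener times[of k] by (simp add: wiener_coordinates_def \<xi>_def)
  interpret D: prob_space "distr P (Fk k) (\<lambda>\<omega>. \<omega>)" by (rule prob_space_distr[OF id])
  \<comment> \<open>The image under the identity restricts \<open>P\<close> to the past, so that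
    independence becomes a product measure.\<close>
  have eq: "distr P (Fk k) (\<lambda>\<omega>. \<omega>) \<Otimes>\<^sub>M noise_law = distr P (Fk k \<Otimes>\<^sub>M seq_borel) (\<lambda>\<omega>. (\<omega>, \<lambda>j. \<xi> k j \<omega>))"
  proof (rule pair_measure_eqI)
    show "sigma_finite_measure (distr P (Fk k) (\<lambda>\<omega>. \<omega>))" "sigma_finite_measure noise_law" ..
    show "sets (distr P (Fk k) (\<lambda>\<omega>. \<omega>) \<Otimes>\<^sub>M noise_law) = sets (distr P (Fk k \<Otimes>\<^sub>M seq_borel) (\<lambda>\<omega>. (\<omega>, \<lambda>j. \<xi> k j \<omega>)))"
      by (simp cong: sets_pair_measure_cong)
    fix A B assume "A \<in> sets (distr P (Fk k) (\<lambda>\<omega>. \<omega>))" "B \<in> sets noise_law"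
    then have A: "A \<in> sets (Fk k)" and B: "B \<in> sets seq_borel" by simp_all
    have AP: "A \<in> events" "A \<subseteq> space P" using A sb sets.sets_into_space by auto
    let ?B = "(\<lambda>\<omega> j. \<xi> k j \<omega>) -` B \<inter> space P"
    have "prob (A \<inter> ?B) = prob A * prob ?B"
      by (rule indep_setD[OF indep A in_vimage_algebra[OF B]])
    then have "emeasure P (A \<inter> ?B) = emeasure P A * emeasure P ?B"
      by (simp add: emeasure_eq_measure ennreal_mult)
    moreover have "(\<lambda>\<omega>. \<omega>) -` A \<inter> space P = A" using AP by auto
    moreover have "(\<lambda>\<omega>. (\<omega>, \<lambda>j. \<xi> k j \<omega>)) -` (A \<times> B) \<inter> space P = A \<inter> ?B" using AP by auto
    ultimately show "emeasure (distr P (Fk k) (\<lambda>\<omega>. \<omega>)) A * emeasure noise_law B =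
        emeasure (distr P (Fk k \<Otimes>\<^sub>M seq_borel) (\<lambda>\<omega>. (\<omega>, \<lambda>j. \<xi> k j \<omega>))) (A \<times> B)"
      using A B by (simp add: emeasure_distr[OF id] emeasure_distr[OF m] emeasure_distr[OF \<Xi>_measurable]
          flip: distr_\<Xi>[of k])
  qed
  have h': "h \<in> borel_measurable (distr P (Fk k) (\<lambda>\<omega>. \<omega>) \<Otimes>\<^sub>M noise_law)"
    using h by (simp cong: measurable_cong_sets sets_pair_measure_cong)
  have h'': "h \<in> borel_measurable (Fk k \<Otimes>\<^sub>M noise_law)"
    using h by (simp cong: measurable_cong_sets sets_pair_measure_cong)
  have "(\<integral>\<^sup>+\<omega>. h (\<omega>, \<lambda>j. \<xi> k j \<omega>) \<partial>P) = (\<integral>\<^sup>+p. h p \<partial>(distr P (Fk k) (\<lambda>\<omega>. \<omega>) \<Otimes>\<^sub>M noise_law))"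
    unfolding eq using h by (simp add: nn_integral_distr[OF m])
  also have "\<dots> = (\<integral>\<^sup>+\<omega>. \<integral>\<^sup>+z. h (\<omega>, z) \<partial>noise_law \<partial>distr P (Fk k) (\<lambda>\<omega>. \<omega>))"
    by (rule N.nn_integral_fst[OF h', symmetric])
  also have "\<dots> = (\<integral>\<^sup>+\<omega>. \<integral>\<^sup>+z. h (\<omega>, z) \<partial>noise_law \<partial>P)"
    using N.borel_measurable_nn_integral_fst[OF h''] by (subst nn_integral_distr[OF id]) auto
  finally show ?thesis .
qed

section \<open>Mean square estimates for a single step\<close>

lemma b_diff_summable:
  assumes "x \<in> S" "y \<in> S"
  shows "summable (\<lambda>j. (norm (b j x - b j y))\<^sup>2)"
proof (rule summable_comparison_test')
  show "summable (\<lambda>j. 2 * (norm (b j x))\<^sup>2 + 2 * (norm (b j y))\<^sup>2)"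
    by (intro summable_add summable_mult b_summable assms)
  fix j
  have "(norm (b j x - b j y))\<^sup>2 \<le> (norm (b j x) + norm (b j y))\<^sup>2"
    by (intro power_mono norm_triangle_ineq4) simp
  also have "\<dots> \<le> 2 * (norm (b j x))\<^sup>2 + 2 * (norm (b j y))\<^sup>2"
    using sum_squares_bound[of "norm (b j x)" "norm (b j y)"] by (simp add: power2_sum)
  finally show "norm ((norm (b j x - b j y))\<^sup>2) \<le> 2 * (norm (b j x))\<^sup>2 + 2 * (norm (b j y))\<^sup>2" by simp
qed

lemma b_measurable: "b j \<in> borel_measurable XS"
proof (rule borel_measurable_continuous_on_restrict, rule lipschitz_on_continuous_on)
  show "K-lipschitz_on S (b j)"
  proof (rule lipschitz_onI)
    fix x y assume xy: "x \<in> S" "y \<in> S"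
    have "(norm (b j x - b j y))\<^sup>2 \<le> (\<Sum>j. (norm (b j x - b j y))\<^sup>2)"
      using sum_le_suminf[OF b_diff_summable[OF xy], of "{j}"] by simp
    also have "\<dots> \<le> (K * norm (x - y))\<^sup>2" by (rule b_Lipschitz[OF xy])
    finally show "dist (b j x) (b j y) \<le> K * dist x y"
      unfolding dist_norm by (rule power2_le_imp_le) (use pos in simp)
  qed (use pos in simp)
qed

text \<open>The finite isometry passes to the limit with its sharp constant. The deterministic shift
  \<open>a\<close> is kept inside the norm, because it is orthogonal to the centred noise and so
  produces no cross term.\<close>

lemma nn_integral_noise_le:
  fixes d :: "nat \<Rightarrow> 'h"
  assumes d: "summable (\<lambda>j. (norm (d j))\<^sup>2)" and N: "N \<in> borel_measurable P"
    and lim: "(\<lambda>n. \<integral>\<^sup>+\<omega>. ennreal ((norm ((\<Sum>j<n. \<xi> k j \<omega> *\<^sub>R d j) - N \<omega>))\<^sup>2) \<partial>P) \<longlonglongrightarrow> 0"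
  shows "(\<integral>\<^sup>+\<omega>. ennreal ((norm (a + N \<omega>))\<^sup>2) \<partial>P) \<le> ennreal ((norm a)\<^sup>2 + \<tau> * (\<Sum>j. (norm (d j))\<^sup>2))"
proof (rule nn_integral_norm_limit_le[where f = "\<lambda>n \<omega>. a + (\<Sum>j<n. \<xi> k j \<omega> *\<^sub>R d j)"])
  note [measurable] = N
  show "(\<lambda>\<omega>. a + N \<omega>) \<in> borel_measurable P" by measurable
  show "(\<lambda>\<omega>. a + (\<Sum>j<n. \<xi> k j \<omega> *\<^sub>R d j)) \<in> borel_measurable P" for n by measurable
  show "0 \<le> (norm a)\<^sup>2 + \<tau> * (\<Sum>j. (norm (d j))\<^sup>2)" using pos d by (simp add: suminf_nonneg)
  show "(\<lambda>n. \<integral>\<^sup>+\<omega>. ennreal ((norm (a + (\<Sum>j<n. \<xi> k j \<omega> *\<^sub>R d j) - (a + N \<omega>)))\<^sup>2) \<partial>P) \<longlonglongrightarrow> 0"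
    using lim by simp
  fix n
  note e = expectation_norm_series[where \<xi> = "\<xi> k" and v = \<tau> and a = a and n = n and d = d,
      OF \<xi>_integrable \<xi>_square_integrable \<xi>_mean \<xi>_variance \<xi>_indep]
  have "(\<integral>\<^sup>+\<omega>. ennreal ((norm (a + (\<Sum>j<n. \<xi> k j \<omega> *\<^sub>R d j)))\<^sup>2) \<partial>P) =
      ennreal ((norm a)\<^sup>2 + \<tau> * (\<Sum>j<n. (norm (d j))\<^sup>2))"
    using nn_integral_eq_integral[OF e(1)] by (simp add: e(2))
  also have "\<dots> \<le> ennreal ((norm a)\<^sup>2 + \<tau> * (\<Sum>j. (norm (d j))\<^sup>2))"
    using pos by (intro ennreal_leI add_left_mono mult_left_mono sum_le_suminf d) auto
  finally show "(\<integral>\<^sup>+\<omega>. ennreal ((norm (a + (\<Sum>j<n. \<xi> k j \<omega> *\<^sub>R d j)))\<^sup>2) \<partial>P) \<le> \<dots>" .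
qed

text \<open>Linearity of the noise term. The crude factor 2 is affordable here, since only
  convergence to 0 is claimed.\<close>

lemma noise_limit_diff:
  fixes d d' :: "nat \<Rightarrow> 'h"
  assumes [measurable]: "N \<in> borel_measurable P" "N' \<in> borel_measurable P"
    and l: "(\<lambda>n. \<integral>\<^sup>+\<omega>. ennreal ((norm ((\<Sum>j<n. \<xi> k j \<omega> *\<^sub>R d j) - N \<omega>))\<^sup>2) \<partial>P) \<longlonglongrightarrow> 0"
    and l': "(\<lambda>n. \<integral>\<^sup>+\<omega>. ennreal ((norm ((\<Sum>j<n. \<xi> k j \<omega> *\<^sub>R d' j) - N' \<omega>))\<^sup>2) \<partial>P) \<longlonglongrightarrow> 0"
  shows "(\<lambda>n. \<integral>\<^sup>+\<omega>. ennreal ((norm ((\<Sum>j<n. \<xi> k j \<omega> *\<^sub>R (d j - d' j)) - (N \<omega> - N' \<omega>)))\<^sup>2) \<partial>P) \<longlonglongrightarrow> 0"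
proof -
  let ?a = "\<lambda>n \<omega>. (\<Sum>j<n. \<xi> k j \<omega> *\<^sub>R d j) - N \<omega>" and ?b = "\<lambda>n \<omega>. (\<Sum>j<n. \<xi> k j \<omega> *\<^sub>R d' j) - N' \<omega>"
  have "(\<lambda>n. 2 * (\<integral>\<^sup>+\<omega>. ennreal ((norm (?a n \<omega>))\<^sup>2) \<partial>P) + 2 * (\<integral>\<^sup>+\<omega>. ennreal ((norm (?b n \<omega>))\<^sup>2) \<partial>P)) \<longlonglongrightarrow> 2 * 0 + 2 * 0"
    by (intro tendsto_add ennreal_tendsto_cmult l l') auto
  then have lim: "(\<lambda>n. 2 * (\<integral>\<^sup>+\<omega>. ennreal ((norm (?a n \<omega>))\<^sup>2) \<partial>P) + 2 * (\<integral>\<^sup>+\<omega>. ennreal ((norm (?b n \<omega>))\<^sup>2) \<partial>P)) \<longlonglongrightarrow> 0"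
    by simp
  have "(\<integral>\<^sup>+\<omega>. ennreal ((norm ((\<Sum>j<n. \<xi> k j \<omega> *\<^sub>R (d j - d' j)) - (N \<omega> - N' \<omega>)))\<^sup>2) \<partial>P) \<le>
      2 * (\<integral>\<^sup>+\<omega>. ennreal ((norm (?a n \<omega>))\<^sup>2) \<partial>P) + 2 * (\<integral>\<^sup>+\<omega>. ennreal ((norm (?b n \<omega>))\<^sup>2) \<partial>P)" for n
  proof -
    have pt: "ennreal ((norm (u - v))\<^sup>2) \<le> 2 * ennreal ((norm u)\<^sup>2) + 2 * ennreal ((norm v)\<^sup>2)" for u v :: 'h
    proof -
      have "(norm (u - v))\<^sup>2 \<le> (norm u + norm v)\<^sup>2" by (intro power_mono norm_triangle_ineq4) simp
      also have "\<dots> \<le> 2 * (norm u)\<^sup>2 + 2 * (norm v)\<^sup>2"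
        using sum_squares_bound[of "norm u" "norm v"] by (simp add: power2_sum)
      finally have "ennreal ((norm (u - v))\<^sup>2) \<le> ennreal (2 * (norm u)\<^sup>2 + 2 * (norm v)\<^sup>2)" by (rule ennreal_leI)
      then show ?thesis by (simp add: ennreal_plus ennreal_mult)
    qed
    have eq: "(\<Sum>j<n. \<xi> k j \<omega> *\<^sub>R (d j - d' j)) - (N \<omega> - N' \<omega>) = ?a n \<omega> - ?b n \<omega>" for \<omega>
      by (simp add: scaleR_diff_right sum_subtractf)
    have "(\<integral>\<^sup>+\<omega>. ennreal ((norm ((\<Sum>j<n. \<xi> k j \<omega> *\<^sub>R (d j - d' j)) - (N \<omega> - N' \<omega>)))\<^sup>2) \<partial>P) \<le>
        (\<integral>\<^sup>+\<omega>. 2 * ennreal ((norm (?a n \<omega>))\<^sup>2) + 2 * ennreal ((norm (?b n \<omega>))\<^sup>2) \<partial>P)"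
      unfolding eq by (intro nn_integral_mono pt)
    also have "\<dots> = 2 * (\<integral>\<^sup>+\<omega>. ennreal ((norm (?a n \<omega>))\<^sup>2) \<partial>P) + 2 * (\<integral>\<^sup>+\<omega>. ennreal ((norm (?b n \<omega>))\<^sup>2) \<partial>P)"
      by (subst nn_integral_add) (auto simp: nn_integral_cmult)
    finally show ?thesis .
  qed
  then show ?thesis by (intro tendsto_sandwich[OF _ _ tendsto_const lim] always_eventually) auto
qed

text \<open>Lipschitz constant in mean square of one step: \<open>c\<close> comes from inverting the
  residual, \<open>1 + \<tau> * K\<^sup>2\<close> from the noise.\<close>

definition rate :: real where "rate = sqrt (c\<^sup>2 * (1 + \<tau> * K\<^sup>2))"

lemma rate: "0 < rate" "rate < 1" "rate\<^sup>2 = c\<^sup>2 * (1 + \<tau> * K\<^sup>2)"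
proof -
  have p: "0 < c\<^sup>2 * (1 + \<tau> * K\<^sup>2)" using pos by (intro mult_pos_pos) (auto simp: add_pos_nonneg)
  then show "0 < rate" "rate\<^sup>2 = c\<^sup>2 * (1 + \<tau> * K\<^sup>2)" by (auto simp: rate_def)
  show "rate < 1" unfolding rate_def using contr by simp
qed

text \<open>Subtracting the two equations leaves \<open>(x - y) + (N - N')\<close> as the residual
  difference. The residual bound is applied pathwise, and the noise estimate with shift
  \<open>x - y\<close> in mean.\<close>

lemma one_step_contraction:
  assumes xy: "x \<in> S" "y \<in> S" and w: "w \<in> borel_measurable P" "w' \<in> borel_measurable P"
    and s: "one_step k (\<lambda>_. x) w" "one_step k (\<lambda>_. y) w'"
  shows "(\<integral>\<^sup>+\<omega>. ennreal ((norm (w \<omega> - w' \<omega>))\<^sup>2) \<partial>P) \<le> ennreal ((rate * norm (x - y))\<^sup>2)"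
proof -
  obtain N where N: "N \<in> borel_measurable P"
    "(\<lambda>n. \<integral>\<^sup>+\<omega>. ennreal ((norm ((\<Sum>j<n. \<xi> k j \<omega> *\<^sub>R b j x) - N \<omega>))\<^sup>2) \<partial>P) \<longlonglongrightarrow> 0"
    "AE \<omega> in P. w \<omega> \<in> dom \<and> res (w \<omega>) = x + N \<omega>"
    using s(1) by (auto simp: one_step_def)
  obtain N' where N': "N' \<in> borel_measurable P"
    "(\<lambda>n. \<integral>\<^sup>+\<omega>. ennreal ((norm ((\<Sum>j<n. \<xi> k j \<omega> *\<^sub>R b j y) - N' \<omega>))\<^sup>2) \<partial>P) \<longlonglongrightarrow> 0"
    "AE \<omega> in P. w' \<omega> \<in> dom \<and> res (w' \<omega>) = y + N' \<omega>"
    using s(2) by (auto simp: one_step_def)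
  note [measurable] = N(1) N'(1) w
  have "(\<integral>\<^sup>+\<omega>. ennreal ((norm (w \<omega> - w' \<omega>))\<^sup>2) \<partial>P) \<le>
      (\<integral>\<^sup>+\<omega>. ennreal (c\<^sup>2) * ennreal ((norm ((x - y) + (N \<omega> - N' \<omega>)))\<^sup>2) \<partial>P)"
  proof (rule nn_integral_mono_AE, use N(3) N'(3) in eventually_elim)
    fix \<omega> assume "w \<omega> \<in> dom \<and> res (w \<omega>) = x + N \<omega>" "w' \<omega> \<in> dom \<and> res (w' \<omega>) = y + N' \<omega>"
    then have "norm (w \<omega> - w' \<omega>) \<le> c * norm ((x - y) + (N \<omega> - N' \<omega>))"
      using res_expand[of "w \<omega>" "w' \<omega>"] by (simp add: algebra_simps)
    then have "(norm (w \<omega> - w' \<omega>))\<^sup>2 \<le> (c * norm ((x - y) + (N \<omega> - N' \<omega>)))\<^sup>2"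
      by (rule power_mono) simp
    then show "ennreal ((norm (w \<omega> - w' \<omega>))\<^sup>2) \<le> ennreal (c\<^sup>2) * ennreal ((norm ((x - y) + (N \<omega> - N' \<omega>)))\<^sup>2)"
      by (simp add: power_mult_distrib flip: ennreal_mult)
  qed
  also have "\<dots> = ennreal (c\<^sup>2) * (\<integral>\<^sup>+\<omega>. ennreal ((norm ((x - y) + (N \<omega> - N' \<omega>)))\<^sup>2) \<partial>P)"
    by (rule nn_integral_cmult) measurable
  also have "\<dots> \<le> ennreal (c\<^sup>2) * ennreal ((norm (x - y))\<^sup>2 + \<tau> * (\<Sum>j. (norm (b j x - b j y))\<^sup>2))"
    by (rule mult_left_mono[OF nn_integral_noise_le[OF b_diff_summable[OF xy] borel_measurable_diff[OF N(1) N'(1)]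
          noise_limit_diff[OF N(1) N'(1) N(2) N'(2)]]]) simp
  also have "\<dots> \<le> ennreal (c\<^sup>2) * ennreal ((norm (x - y))\<^sup>2 + \<tau> * (K * norm (x - y))\<^sup>2)"
    using pos by (intro mult_left_mono ennreal_leI add_left_mono b_Lipschitz xy) auto
  also have "\<dots> = ennreal (c\<^sup>2 * ((norm (x - y))\<^sup>2 + \<tau> * (K * norm (x - y))\<^sup>2))"
    using pos by (intro ennreal_mult[symmetric]) auto
  also have "c\<^sup>2 * ((norm (x - y))\<^sup>2 + \<tau> * (K * norm (x - y))\<^sup>2) = (rate * norm (x - y))\<^sup>2"
    by (simp add: power_mult_distrib rate(3) algebra_simps)
  finally show ?thesis .
qed

text \<open>The contraction with both starting points equal has right side 0.\<close>

lemma one_step_unique: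
  assumes x: "x \<in> S" and w: "w \<in> borel_measurable P" "w' \<in> borel_measurable P"
    and s: "one_step k (\<lambda>_. x) w" "one_step k (\<lambda>_. x) w'"
  shows "AE \<omega> in P. w \<omega> = w' \<omega>"
proof -
  note [measurable] = w
  have "(\<integral>\<^sup>+\<omega>. ennreal ((norm (w \<omega> - w' \<omega>))\<^sup>2) \<partial>P) = 0"
    using one_step_contraction[OF x x w s] by simp
  then have "AE \<omega> in P. ennreal ((norm (w \<omega> - w' \<omega>))\<^sup>2) = 0"
    by (subst (asm) nn_integral_0_iff_AE) auto
  then show ?thesis by eventually_elim simp
qed

text \<open>The residual bound compares only two points of \<open>dom\<close>, so a reference point
  \<open>z\<close> in it is needed. One exists because the solution lies in \<open>dom\<close> with
  probability one.\<close>

lemma one_step_moment: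
  assumes x: "x \<in> S" and w: "w \<in> borel_measurable P" and s: "one_step k (\<lambda>_. x) w"
  shows "(\<integral>\<^sup>+\<omega>. ennreal ((norm (w \<omega> - x))\<^sup>2) \<partial>P) < \<infinity>"
proof -
  obtain N where N: "N \<in> borel_measurable P"
    "(\<lambda>n. \<integral>\<^sup>+\<omega>. ennreal ((norm ((\<Sum>j<n. \<xi> k j \<omega> *\<^sub>R b j x) - N \<omega>))\<^sup>2) \<partial>P) \<longlonglongrightarrow> 0"
    "AE \<omega> in P. w \<omega> \<in> dom \<and> res (w \<omega>) = x + N \<omega>"
    using s by (auto simp: one_step_def)
  note [measurable] = N(1) w
  have "dom \<noteq> {}"
  proof
    assume "dom = {}"
    then have "AE \<omega> in P. False" using N(3) by simp
    then show False by (simp add: AE_False)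
  qed
  then obtain z where z: "z \<in> dom" by blast
  let ?a = "x - res z"
  have "(\<integral>\<^sup>+\<omega>. ennreal ((norm (w \<omega> - x))\<^sup>2) \<partial>P) \<le>
      (\<integral>\<^sup>+\<omega>. ennreal (2 * c\<^sup>2) * ennreal ((norm (?a + N \<omega>))\<^sup>2) + ennreal (2 * (norm (z - x))\<^sup>2) \<partial>P)"
  proof (rule nn_integral_mono_AE, use N(3) in eventually_elim)
    fix \<omega> assume "w \<omega> \<in> dom \<and> res (w \<omega>) = x + N \<omega>"
    then have "norm (w \<omega> - z) \<le> c * norm (?a + N \<omega>)"
      using res_expand[of "w \<omega>" z] z by (simp add: algebra_simps)
    then have "norm (w \<omega> - x) \<le> c * norm (?a + N \<omega>) + norm (z - x)"
      using norm_triangle_ineq[of "w \<omega> - z" "z - x"] by simp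
    then have "(norm (w \<omega> - x))\<^sup>2 \<le> (c * norm (?a + N \<omega>) + norm (z - x))\<^sup>2" by (rule power_mono) simp
    also have "\<dots> \<le> 2 * (c * norm (?a + N \<omega>))\<^sup>2 + 2 * (norm (z - x))\<^sup>2"
      using sum_squares_bound[of "c * norm (?a + N \<omega>)" "norm (z - x)"] by (simp add: power2_sum)
    finally show "ennreal ((norm (w \<omega> - x))\<^sup>2) \<le>
        ennreal (2 * c\<^sup>2) * ennreal ((norm (?a + N \<omega>))\<^sup>2) + ennreal (2 * (norm (z - x))\<^sup>2)"
      by (simp add: power_mult_distrib ennreal_leI flip: ennreal_mult ennreal_plus)
  qed
  also have "\<dots> = ennreal (2 * c\<^sup>2) * (\<integral>\<^sup>+\<omega>. ennreal ((norm (?a + N \<omega>))\<^sup>2) \<partial>P) + ennreal (2 * (norm (z - x))\<^sup>2)"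
    by (subst nn_integral_add) (auto simp: nn_integral_cmult emeasure_space_1)
  also have "\<dots> \<le> ennreal (2 * c\<^sup>2) * ennreal ((norm ?a)\<^sup>2 + \<tau> * (\<Sum>j. (norm (b j x))\<^sup>2)) + ennreal (2 * (norm (z - x))\<^sup>2)"
    by (intro add_right_mono mult_left_mono nn_integral_noise_le[OF b_summable[OF x] N(1,2)]) simp
  also have "\<dots> < \<infinity>" by (simp add: ennreal_mult_less_top)
  finally show ?thesis .
qed

end

section \<open>The transition kernel and the Markov property\<close>

text \<open>Solvability concerns deterministic starting points and the first time step only. For
  later steps and random states, a solution is always given.\<close>

locale solvable_euler_scheme = euler_scheme P Fil \<beta> S dom res b \<tau> c K
  for P :: "'w measure" and Fil :: "real \<Rightarrow> 'w measure" and \<beta> :: "nat \<Rightarrow> real \<Rightarrow> 'w \<Rightarrow> real"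
    and S :: "'h::{real_inner, banach, second_countable_topology} set" and dom :: "'h set"
    and res :: "'h \<Rightarrow> 'h" and b :: "nat \<Rightarrow> 'h \<Rightarrow> 'h" and \<tau> c K :: real +
  assumes solvable: "\<And>x. x \<in> S \<Longrightarrow> \<exists>w. w \<in> P \<rightarrow>\<^sub>M restrict_space borel S \<and> one_step 0 (\<lambda>_. x) w"
begin

text \<open>Chosen separately for each \<open>x\<close>, so nothing is known about its dependence on
  \<open>x\<close> beyond the mean square Lipschitz bound.\<close>

definition Z :: "'h \<Rightarrow> 'w \<Rightarrow> 'h" where
  "Z x = (SOME w. w \<in> P \<rightarrow>\<^sub>M XS \<and> one_step 0 (\<lambda>_. x) w)"

lemma Z: "x \<in> S \<Longrightarrow> Z x \<in> P \<rightarrow>\<^sub>M XS" "x \<in> S \<Longrightarrow> one_step 0 (\<lambda>_. x) (Z x)"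
  using someI_ex[OF solvable[of x]] by (simp_all add: Z_def)

definition base_point :: 'h where "base_point = (SOME x. x \<in> S)"

lemma base_point: "base_point \<in> S"
  using S_ne unfolding base_point_def by (auto intro: someI)

sublocale contractive_random_map P S Z rate base_point
proof
  show "closed S" by (rule closed_S)
  show "base_point \<in> S" by (rule base_point)
  show "0 < rate" "rate < 1" by (rule rate)+
  show "Z x \<in> P \<rightarrow>\<^sub>M XS" if "x \<in> S" for x using Z(1)[OF that] .
  show "(\<integral>\<^sup>+\<omega>. ennreal ((norm (Z x \<omega> - Z y \<omega>))\<^sup>2) \<partial>P) \<le> ennreal ((rate * norm (x - y))\<^sup>2)"
    if "x \<in> S" "y \<in> S" for x y
    using that by (intro one_step_contraction[where k = 0] Z XS_borel)
  show "(\<integral>\<^sup>+\<omega>. ennreal ((norm (Z base_point \<omega> - base_point))\<^sup>2) \<partial>P) < \<infinity>"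
    by (intro one_step_moment[where k = 0] Z XS_borel base_point)
qed

lemma distr_one_step:
  assumes "x \<in> S" "w \<in> P \<rightarrow>\<^sub>M XS" "one_step 0 (\<lambda>_. x) w"
  shows "distr P XS w = kernel x"
  unfolding kernel_def
proof (rule distr_cong_AE)
  show "AE \<omega> in P. w \<omega> = Z x \<omega>"
    by (rule one_step_unique[OF assms(1) XS_borel[OF assms(2)] XS_borel[OF Z(1)[OF assms(1)]]
        assms(3) Z(2)[OF assms(1)]])
qed (use assms Z(1) in auto)

text \<open>The resolvent of the scheme is Lipschitz but possibly only partially defined. A test
  function composed with it extends to a Lipschitz function on the whole space.\<close>

lemma test_of_resolvent:
  assumes g: "L-lipschitz_on UNIV g" "\<And>x. 0 \<le> g x" "\<And>x. g x \<le> (1 :: real)"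
  obtains G where "(L * c)-lipschitz_on UNIV G" "\<And>x. 0 \<le> G x" "\<And>x. G x \<le> 1"
    "\<And>w. w \<in> dom \<Longrightarrow> G (res w) = g w"
proof -
  have inj: "inj_on res dom"
    by (rule inj_onI) (use res_expand in fastforce)
  have "(L * c)-lipschitz_on (res ` dom) (g \<circ> inv_into dom res)"
  proof (rule lipschitz_onI)
    fix y y' assume "y \<in> res ` dom" "y' \<in> res ` dom"
    then obtain w w' where w: "w \<in> dom" "y = res w" "w' \<in> dom" "y' = res w'" by blast
    have "dist (g w) (g w') \<le> L * dist w w'" by (rule lipschitz_onD[OF g(1)]) auto
    also have "\<dots> \<le> L * (c * norm (y - y'))"
      using res_expand[OF w(1,3)] lipschitz_on_nonneg[OF g(1)]
      by (intro mult_left_mono) (auto simp: w dist_norm)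
    finally show "dist ((g \<circ> inv_into dom res) y) ((g \<circ> inv_into dom res) y') \<le> L * c * dist y y'"
      using w by (simp add: inv_into_f_f[OF inj] dist_norm)
  qed (use lipschitz_on_nonneg[OF g(1)] pos in simp)
  then obtain G where G: "(L * c)-lipschitz_on UNIV G" "\<And>x. 0 \<le> G x" "\<And>x. G x \<le> 1"
    "\<And>y. y \<in> res ` dom \<Longrightarrow> G y = (g \<circ> inv_into dom res) y"
    by (rule lipschitz_extension_bounded) (use g in auto)
  show ?thesis
    by (rule that[OF G(1-3)]) (simp add: G(4) inv_into_f_f[OF inj])
qed

text \<open>The identification of \<open>Z x\<close> holds off a null set that depends on
  \<open>x\<close>, so \<open>u\<close> cannot simply be substituted for \<open>x\<close>. Cutting
  the noise after \<open>n\<close> coordinates gives an explicit jointly measurable expression to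
  which freezing applies. The limit is then taken twice: along the random state \<open>u\<close>,
  and for each frozen \<open>x\<close>.\<close>

lemma one_step_Markov:
  assumes u: "u \<in> Fk k \<rightarrow>\<^sub>M XS" and w: "w \<in> P \<rightarrow>\<^sub>M XS" and s: "one_step k u w"
    and g: "L-lipschitz_on UNIV g" "\<And>x. 0 \<le> g x" "\<And>x. g x \<le> (1 :: real)" and E: "E \<in> sets (Fk k)"
  shows "expectation (\<lambda>\<omega>. indicator E \<omega> * g (w \<omega>)) = expectation (\<lambda>\<omega>. indicator E \<omega> * transition g (u \<omega>))"
proof -
  interpret N: prob_space noise_law by (rule prob_space_noise_law)
  obtain G where G: "(L * c)-lipschitz_on UNIV G" "\<And>x. 0 \<le> G x" "\<And>x. G x \<le> 1"
    "\<And>w. w \<in> dom \<Longrightarrow> G (res w) = g w"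
    using test_of_resolvent[OF g] by blast
  have [measurable]: "G \<in> borel_measurable borel"
    using lipschitz_on_continuous_on[OF G(1)] by (rule borel_measurable_continuous_onI)
  have EP [measurable]: "E \<in> events" using E subalg[of k] by (auto simp: subalgebra_def)
  have uP: "u \<in> P \<rightarrow>\<^sub>M XS" by (rule measurable_from_subalg[OF subalg u])
  have uS: "u \<omega> \<in> S" if "\<omega> \<in> space P" for \<omega> using measurable_space[OF uP that] by (simp add: space_XS)
  note [measurable] = b_measurable
  have bu [measurable]: "(\<lambda>\<omega>. b j (u \<omega>)) \<in> borel_measurable P" for j
    by (rule measurable_compose[OF uP b_measurable])
  note [measurable] = XS_borel[OF uP] XS_borel[OF w]
  \<comment> \<open>The right side of the step equation with the noise truncated after
    \<open>n\<close> coordinates, as a function of state and noise.\<close>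
  define A where "A n x z = x + (\<Sum>j<n. z j *\<^sub>R b j x)" for n and x :: 'h and z :: "nat \<Rightarrow> real"
  have A: "(\<lambda>p. A n (fst p) (snd p)) \<in> borel_measurable (XS \<Otimes>\<^sub>M seq_borel)" for n
  proof -
    have 1: "(\<lambda>p. fst p) \<in> borel_measurable (XS \<Otimes>\<^sub>M seq_borel)" by (rule XS_borel) measurable
    have 2: "(\<lambda>p. b j (fst p)) \<in> borel_measurable (XS \<Otimes>\<^sub>M seq_borel)" for j
      by (rule measurable_compose[OF measurable_fst b_measurable])
    have 3: "(\<lambda>p. snd p j) \<in> borel_measurable (XS \<Otimes>\<^sub>M seq_borel)" for j
      by (rule measurable_compose[OF measurable_snd measurable_component_singleton]) simp
    show ?thesis unfolding A_def
      by (intro borel_measurable_add 1 borel_measurable_sum borel_measurable_scaleR 2 3)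
  qed
  define h where "h n x = (\<integral>z. G (A n x z) \<partial>noise_law)" for n x
  have Ax [measurable]: "(\<lambda>z. A n x z) \<in> borel_measurable seq_borel" for n x
    unfolding A_def by measurable
  have h_nn: "(\<integral>\<^sup>+z. ennreal (G (A n x z)) \<partial>noise_law) = ennreal (h n x)" for n x
    unfolding h_def using G
    by (intro nn_integral_eq_integral N.integrable_const_bound[of _ 1]) (auto cong: measurable_cong_sets)
  have h01: "0 \<le> h n x" "h n x \<le> 1" for n x
  proof -
    show "0 \<le> h n x" unfolding h_def using G by simp
    have "ennreal (h n x) \<le> (\<integral>\<^sup>+z. 1 \<partial>noise_law)"
      unfolding h_nn[symmetric] using G by (intro nn_integral_mono) (simp add: ennreal_le_1)
    then show "h n x \<le> 1" by (simp add: N.emeasure_space_1 ennreal_le_1)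
  qed
  \<comment> \<open>The step index is free on the right. Step 0 connects \<open>h\<close> with
    \<open>Z\<close>, although the noise in question belongs to step \<open>k\<close>.\<close>
  have hE: "h n x = expectation (\<lambda>\<omega>. G (A n x (\<lambda>j. \<xi> k' j \<omega>)))" for n x k'
  proof -
    have "h n x = (\<integral>z. G (A n x z) \<partial>distr P seq_borel (\<lambda>\<omega> j. \<xi> k' j \<omega>))"
      unfolding h_def distr_\<Xi>[of k'] ..
    also have "\<dots> = expectation (\<lambda>\<omega>. G (A n x (\<lambda>j. \<xi> k' j \<omega>)))"
      by (rule integral_distr[OF \<Xi>_measurable]) measurable
    finally show ?thesis .
  qed
  have h_tendsto: "(\<lambda>n. h n x) \<longlonglongrightarrow> transition g x" if x: "x \<in> S" for x
  proof -
    obtain M where M: "M \<in> borel_measurable P"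
      "(\<lambda>n. \<integral>\<^sup>+\<omega>. ennreal ((norm ((\<Sum>j<n. \<xi> 0 j \<omega> *\<^sub>R b j x) - M \<omega>))\<^sup>2) \<partial>P) \<longlonglongrightarrow> 0"
      "AE \<omega> in P. Z x \<omega> \<in> dom \<and> res (Z x \<omega>) = x + M \<omega>"
      using Z(2)[OF x] by (auto simp: one_step_def)
    note [measurable] = M(1) Z_borel[OF x]
    have [measurable]: "g \<in> borel_measurable borel"
      using lipschitz_on_continuous_on[OF g(1)] by (rule borel_measurable_continuous_onI)
    have "(\<lambda>n. expectation (\<lambda>\<omega>. 1 * G (A n x (\<lambda>j. \<xi> 0 j \<omega>)))) \<longlonglongrightarrow> expectation (\<lambda>\<omega>. 1 * G (x + M \<omega>))"
    proof (rule tendsto_expectation_Lipschitz[OF _ _ _ _ _ _ G(1-3)])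
      show "(\<lambda>n. \<integral>\<^sup>+\<omega>. ennreal ((norm (A n x (\<lambda>j. \<xi> 0 j \<omega>) - (x + M \<omega>)))\<^sup>2) \<partial>P) \<longlonglongrightarrow> 0"
        using M(2) by (simp add: A_def)
      show "(\<lambda>\<omega>. A n x (\<lambda>j. \<xi> 0 j \<omega>)) \<in> borel_measurable P" for n unfolding A_def by measurable
    qed auto
    moreover have "expectation (\<lambda>\<omega>. 1 * G (x + M \<omega>)) = transition g x"
      unfolding transition_def
    proof (rule integral_cong_AE)
      \<comment> \<open>Almost surely \<open>x + M \<omega>\<close> is the residual of
        \<open>Z x \<omega>\<close>, a point where the extension \<open>G\<close> returns the value
        of \<open>g\<close>.\<close>
      show "AE \<omega> in P. 1 * G (x + M \<omega>) = g (Z x \<omega>)"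
        using M(3) by eventually_elim (metis G(4) mult_1)
    qed measurable
    ultimately show ?thesis by (simp add: hE[of _ _ 0])
  qed
  obtain N where N: "N \<in> borel_measurable P"
    "(\<lambda>n. \<integral>\<^sup>+\<omega>. ennreal ((norm ((\<Sum>j<n. \<xi> k j \<omega> *\<^sub>R b j (u \<omega>)) - N \<omega>))\<^sup>2) \<partial>P) \<longlonglongrightarrow> 0"
    "AE \<omega> in P. w \<omega> \<in> dom \<and> res (w \<omega>) = u \<omega> + N \<omega>"
    using s by (auto simp: one_step_def)
  note [measurable] = N(1)
  have hm: "h n \<in> borel_measurable XS" for n
  proof -
    have "(\<lambda>p. G (A n (fst p) (snd p))) \<in> borel_measurable (XS \<Otimes>\<^sub>M noise_law)"
      using A by (subst measurable_cong_sets[OF sets_pair_measure_cong[OF refl sets_noise_law] refl]) measurable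
    then have "case_prod (\<lambda>x z. G (A n x z)) \<in> borel_measurable (XS \<Otimes>\<^sub>M noise_law)"
      by (simp add: case_prod_beta')
    then show ?thesis unfolding h_def by (rule N.borel_measurable_lebesgue_integral)
  qed
  have hu [measurable]: "(\<lambda>\<omega>. h n (u \<omega>)) \<in> borel_measurable P" for n
    by (rule measurable_compose[OF uP hm])
  \<comment> \<open>Event and state belong to the past, so the truncated noise is integrated out
    with both frozen.\<close>
  have approx: "expectation (\<lambda>\<omega>. indicator E \<omega> * G (A n (u \<omega>) (\<lambda>j. \<xi> k j \<omega>))) =
      expectation (\<lambda>\<omega>. indicator E \<omega> * h n (u \<omega>))" for n
  proof -
    define H where "H p = indicator E (fst p) * ennreal (G (A n (u (fst p)) (snd p)))" for p
    have Au: "(\<lambda>p. A n (u (fst p)) (snd p)) \<in> borel_measurable (Fk k \<Otimes>\<^sub>M seq_borel)"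
    proof -
      have "(\<lambda>p. (u (fst p), snd p)) \<in> Fk k \<Otimes>\<^sub>M seq_borel \<rightarrow>\<^sub>M XS \<Otimes>\<^sub>M seq_borel"
        by (intro measurable_Pair measurable_snd measurable_compose[OF measurable_fst u])
      from measurable_compose[OF this A] show ?thesis by simp
    qed
    have H: "H \<in> borel_measurable (Fk k \<Otimes>\<^sub>M seq_borel)"
    proof -
      note [measurable] = Au
      have "(\<lambda>\<omega>. indicator E \<omega> :: ennreal) \<in> borel_measurable (Fk k)" using E by simp
      from measurable_compose[OF measurable_fst this]
      have [measurable]: "(\<lambda>p. indicator E (fst p) :: ennreal) \<in> borel_measurable (Fk k \<Otimes>\<^sub>M seq_borel)" .
      show ?thesis unfolding H_def by measurable
    qed
    have AP [measurable]: "(\<lambda>\<omega>. A n (u \<omega>) (\<lambda>j. \<xi> k j \<omega>)) \<in> borel_measurable P" unfolding A_def by measurable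
    have i1: "integrable P (\<lambda>\<omega>. indicator E \<omega> * G (A n (u \<omega>) (\<lambda>j. \<xi> k j \<omega>)))"
      using G by (intro integrable_const_bound[of _ 1]) (auto simp: indicator_def)
    have i2: "integrable P (\<lambda>\<omega>. indicator E \<omega> * h n (u \<omega>))"
      using h01 by (intro integrable_const_bound[of _ 1]) (auto simp: indicator_def)
    have "ennreal (expectation (\<lambda>\<omega>. indicator E \<omega> * G (A n (u \<omega>) (\<lambda>j. \<xi> k j \<omega>)))) =
        (\<integral>\<^sup>+\<omega>. ennreal (indicator E \<omega> * G (A n (u \<omega>) (\<lambda>j. \<xi> k j \<omega>))) \<partial>P)"
      using G by (intro nn_integral_eq_integral[symmetric] i1) auto
    also have "\<dots> = (\<integral>\<^sup>+\<omega>. H (\<omega>, \<lambda>j. \<xi> k j \<omega>) \<partial>P)"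
      unfolding H_def using G by (intro nn_integral_cong) (simp add: indicator_def)
    also have "\<dots> = (\<integral>\<^sup>+\<omega>. \<integral>\<^sup>+z. H (\<omega>, z) \<partial>noise_law \<partial>P)" by (rule nn_integral_past_noise[OF H])
    also have "\<dots> = (\<integral>\<^sup>+\<omega>. ennreal (indicator E \<omega> * h n (u \<omega>)) \<partial>P)"
    proof (rule nn_integral_cong)
      fix \<omega>
      show "(\<integral>\<^sup>+z. H (\<omega>, z) \<partial>noise_law) = ennreal (indicator E \<omega> * h n (u \<omega>))"
        by (cases "\<omega> \<in> E") (simp_all add: H_def h_nn)
    qed
    also have "\<dots> = ennreal (expectation (\<lambda>\<omega>. indicator E \<omega> * h n (u \<omega>)))"
      using h01 by (intro nn_integral_eq_integral i2) auto
    finally show ?thesis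
      using G h01 by (subst (asm) ennreal_inj) (auto intro!: Bochner_Integration.integral_nonneg)
  qed
  have "(\<lambda>n. expectation (\<lambda>\<omega>. indicator E \<omega> * G (A n (u \<omega>) (\<lambda>j. \<xi> k j \<omega>)))) \<longlonglongrightarrow>
      expectation (\<lambda>\<omega>. indicator E \<omega> * G (u \<omega> + N \<omega>))"
  proof (rule tendsto_expectation_Lipschitz[OF _ _ _ _ _ _ G(1-3)])
    show "(\<lambda>n. \<integral>\<^sup>+\<omega>. ennreal ((norm (A n (u \<omega>) (\<lambda>j. \<xi> k j \<omega>) - (u \<omega> + N \<omega>)))\<^sup>2) \<partial>P) \<longlonglongrightarrow> 0"
      using N(2) by (simp add: A_def)
    show "(\<lambda>\<omega>. A n (u \<omega>) (\<lambda>j. \<xi> k j \<omega>)) \<in> borel_measurable P" for n unfolding A_def by measurable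
  qed (auto simp: indicator_def)
  moreover have "(\<lambda>n. expectation (\<lambda>\<omega>. indicator E \<omega> * h n (u \<omega>))) \<longlonglongrightarrow>
      expectation (\<lambda>\<omega>. indicator E \<omega> * transition g (u \<omega>))"
  proof (rule integral_dominated_convergence[where w = "\<lambda>_. 1"])
    show "AE \<omega> in P. (\<lambda>n. indicator E \<omega> * h n (u \<omega>)) \<longlonglongrightarrow> indicator E \<omega> * transition g (u \<omega>)"
      using uS by (intro AE_I2 tendsto_mult tendsto_const h_tendsto)
    show "AE \<omega> in P. norm (indicator E \<omega> * h n (u \<omega>)) \<le> 1" for n
      using h01 by (intro AE_I2) (auto simp: indicator_def)
    show "(\<lambda>\<omega>. indicator E \<omega> * transition g (u \<omega>)) \<in> borel_measurable P"
      using measurable_compose[OF uP test_measurable[OF test_transition[OF test_UNIV[OF g]]]] by measurable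
  qed auto
  ultimately have "expectation (\<lambda>\<omega>. indicator E \<omega> * G (u \<omega> + N \<omega>)) =
      expectation (\<lambda>\<omega>. indicator E \<omega> * transition g (u \<omega>))"
    unfolding approx by (rule LIMSEQ_unique)
  moreover have "expectation (\<lambda>\<omega>. indicator E \<omega> * g (w \<omega>)) = expectation (\<lambda>\<omega>. indicator E \<omega> * G (u \<omega> + N \<omega>))"
  proof (rule integral_cong_AE)
    have [measurable]: "g \<in> borel_measurable borel"
      using lipschitz_on_continuous_on[OF g(1)] by (rule borel_measurable_continuous_onI)
    show "(\<lambda>\<omega>. indicator E \<omega> * g (w \<omega>)) \<in> borel_measurable P" by measurable
    show "AE \<omega> in P. indicator E \<omega> * g (w \<omega>) = indicator E \<omega> * G (u \<omega> + N \<omega>)"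
      using N(3) by eventually_elim (metis G(4))
  qed measurable
  ultimately show ?thesis by simp
qed

text \<open>Indicators are not Lipschitz, so the identity for test functions is read as equality of
  two finite measures: the law of \<open>w\<close> on the event \<open>E\<close>, and the law of
  \<open>u\<close> on \<open>E\<close> pushed through the kernel.\<close>

lemma one_step_Markov_sets:
  assumes u: "u \<in> Fk k \<rightarrow>\<^sub>M XS" and w: "w \<in> P \<rightarrow>\<^sub>M XS" and s: "one_step k u w"
    and E: "E \<in> sets (Fk k)" and A: "A \<in> sets XS"
  shows "expectation (\<lambda>\<omega>. indicator E \<omega> * indicator A (w \<omega>)) =
    expectation (\<lambda>\<omega>. indicator E \<omega> * measure (kernel (u \<omega>)) A)"
proof -
  have EP [measurable]: "E \<in> events" using E subalg[of k] by (auto simp: subalgebra_def)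
  have uP [measurable]: "u \<in> P \<rightarrow>\<^sub>M XS" by (rule measurable_from_subalg[OF subalg u])
  note [measurable] = w A
  have uS: "u \<omega> \<in> S" if "\<omega> \<in> space P" for \<omega> using measurable_space[OF uP that] by (simp add: space_XS)
  \<comment> \<open>\<open>P\<close> restricted to the event \<open>E\<close>; its mass may be below
    1, or 0.\<close>
  let ?D = "density P (indicator E)"
  have D: "f \<in> ?D \<rightarrow>\<^sub>M XS" if "f \<in> P \<rightarrow>\<^sub>M XS" for f using that by simp
  define \<mu> where "\<mu> = distr ?D XS u"
  have s\<mu>: "sets \<mu> = sets XS" by (simp add: \<mu>_def)
  have k\<mu>: "kernel \<in> \<mu> \<rightarrow>\<^sub>M subprob_algebra XS"
    using measurable_prob_algebraD[OF kernel_measurable] measurable_cong_sets[OF s\<mu> refl] by blast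
  have ne: "space \<mu> \<noteq> {}" using S_ne by (simp add: \<mu>_def space_XS)
  have "distr ?D XS w = \<mu> \<bind> kernel"
  proof (rule measure_eqI_lipschitz[OF S_borel])
    show "sets (\<mu> \<bind> kernel) = sets XS" by (rule sets_bind[OF _ ne]) simp
    have "emeasure ?D (space P) = emeasure P E"
      using sets.sets_into_space[OF EP]
      by (simp add: emeasure_density indicator_inter_arith[symmetric] Int_absorb2)
    then have "finite_measure ?D" by (intro finite_measureI) simp
    then show "finite_measure (distr ?D XS w)" by (rule finite_measure.finite_measure_distr[OF _ D[OF w]])
    fix g :: "'h \<Rightarrow> real" and L assume g: "L-lipschitz_on UNIV g" "\<And>x. 0 \<le> g x" "\<And>x. g x \<le> 1"
    have t: "test L g" by (rule test_UNIV[OF g])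
    have [measurable]: "g \<in> borel_measurable XS" "transition g \<in> borel_measurable XS"
      using test_measurable[OF t] test_measurable[OF test_transition[OF t]] by auto
    have tr: "0 \<le> transition g x" "transition g x \<le> 1" if "x \<in> S" for x
      using test_transition[OF t] that by (auto simp: test_def)
    have i1: "integrable P (\<lambda>\<omega>. indicator E \<omega> * g (w \<omega>))"
      using g by (intro integrable_const_bound[of _ 1]) (auto simp: indicator_def)
    have i2: "integrable P (\<lambda>\<omega>. indicator E \<omega> * transition g (u \<omega>))"
      using tr uS by (intro integrable_const_bound[of _ 1]) (auto simp: indicator_def)
    have "(\<integral>\<^sup>+x. ennreal (g x) \<partial>distr ?D XS w) = (\<integral>\<^sup>+\<omega>. indicator E \<omega> * ennreal (g (w \<omega>)) \<partial>P)"
      by (subst nn_integral_distr[OF D[OF w]]) (auto simp: nn_integral_density)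
    also have "\<dots> = (\<integral>\<^sup>+\<omega>. ennreal (indicator E \<omega> * g (w \<omega>)) \<partial>P)"
      by (intro nn_integral_cong) (simp add: indicator_def)
    also have "\<dots> = ennreal (expectation (\<lambda>\<omega>. indicator E \<omega> * g (w \<omega>)))"
      using g by (intro nn_integral_eq_integral i1) auto
    also have "\<dots> = ennreal (expectation (\<lambda>\<omega>. indicator E \<omega> * transition g (u \<omega>)))"
      by (simp only: one_step_Markov[OF u w s g E])
    also have "\<dots> = (\<integral>\<^sup>+\<omega>. ennreal (indicator E \<omega> * transition g (u \<omega>)) \<partial>P)"
      using tr uS by (intro nn_integral_eq_integral[symmetric] i2) auto
    also have "\<dots> = (\<integral>\<^sup>+\<omega>. indicator E \<omega> * ennreal (transition g (u \<omega>)) \<partial>P)"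
      by (intro nn_integral_cong) (simp add: indicator_def)
    also have "\<dots> = (\<integral>\<^sup>+x. ennreal (transition g x) \<partial>\<mu>)"
      unfolding \<mu>_def by (subst nn_integral_distr[OF D[OF uP]]) (auto simp: nn_integral_density)
    also have "\<dots> = (\<integral>\<^sup>+x. \<integral>\<^sup>+y. ennreal (g y) \<partial>kernel x \<partial>\<mu>)"
      by (intro nn_integral_cong nn_integral_kernel[OF t, symmetric]) (simp add: \<mu>_def space_XS)
    also have "\<dots> = (\<integral>\<^sup>+x. ennreal (g x) \<partial>(\<mu> \<bind> kernel))"
      by (rule nn_integral_bind[OF _ k\<mu>, symmetric]) measurable
    finally show "(\<integral>\<^sup>+x. ennreal (g x) \<partial>distr ?D XS w) = (\<integral>\<^sup>+x. ennreal (g x) \<partial>(\<mu> \<bind> kernel))" .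
  qed simp
  then have "emeasure (distr ?D XS w) A = (\<integral>\<^sup>+x. emeasure (kernel x) A \<partial>\<mu>)"
    by (simp add: emeasure_bind[OF ne k\<mu> A])
  moreover have [measurable]: "(\<lambda>x. emeasure (kernel x) A) \<in> borel_measurable XS"
    by (rule measurable_emeasure_kernel[OF measurable_prob_algebraD[OF kernel_measurable] A])
  moreover have "emeasure (distr ?D XS w) A = (\<integral>\<^sup>+\<omega>. ennreal (indicator E \<omega> * indicator A (w \<omega>)) \<partial>P)"
  proof -
    have "emeasure (distr ?D XS w) A = (\<integral>\<^sup>+x. indicator A x \<partial>distr ?D XS w)" by simp
    also have "\<dots> = (\<integral>\<^sup>+\<omega>. indicator E \<omega> * indicator A (w \<omega>) \<partial>P)"
      by (subst nn_integral_distr[OF D[OF w]]) (auto simp: nn_integral_density)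
    also have "\<dots> = (\<integral>\<^sup>+\<omega>. ennreal (indicator E \<omega> * indicator A (w \<omega>)) \<partial>P)"
      by (intro nn_integral_cong) (simp add: indicator_def)
    finally show ?thesis .
  qed
  moreover have "(\<integral>\<^sup>+x. emeasure (kernel x) A \<partial>\<mu>) = (\<integral>\<^sup>+\<omega>. ennreal (indicator E \<omega> * measure (kernel (u \<omega>)) A) \<partial>P)"
  proof -
    have "(\<integral>\<^sup>+x. emeasure (kernel x) A \<partial>\<mu>) = (\<integral>\<^sup>+\<omega>. indicator E \<omega> * emeasure (kernel (u \<omega>)) A \<partial>P)"
      unfolding \<mu>_def by (subst nn_integral_distr[OF D[OF uP]]) (auto simp: nn_integral_density)
    also have "\<dots> = (\<integral>\<^sup>+\<omega>. ennreal (indicator E \<omega> * measure (kernel (u \<omega>)) A) \<partial>P)"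
    proof (rule nn_integral_cong)
      fix \<omega> assume "\<omega> \<in> space P"
      then interpret k: prob_space "kernel (u \<omega>)" by (intro kernel_prob uS)
      show "indicator E \<omega> * emeasure (kernel (u \<omega>)) A = ennreal (indicator E \<omega> * measure (kernel (u \<omega>)) A)"
        by (simp add: k.emeasure_eq_measure indicator_def)
    qed
    finally show ?thesis .
  qed
  ultimately have eq: "(\<integral>\<^sup>+\<omega>. ennreal (indicator E \<omega> * indicator A (w \<omega>)) \<partial>P) =
      (\<integral>\<^sup>+\<omega>. ennreal (indicator E \<omega> * measure (kernel (u \<omega>)) A) \<partial>P)" by simp
  have km [measurable]: "(\<lambda>\<omega>. measure (kernel (u \<omega>)) A) \<in> borel_measurable P"
    by (rule measurable_compose[OF uP measurable_compose[OF kernel_measurable measurable_measure_prob_algebra[OF A]]])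
  have "integral\<^sup>L P (\<lambda>\<omega>. indicator E \<omega> * indicator A (w \<omega>)) = enn2real (\<integral>\<^sup>+\<omega>. ennreal (indicator E \<omega> * indicator A (w \<omega>)) \<partial>P)"
    by (rule integral_eq_nn_integral) auto
  also have "\<dots> = integral\<^sup>L P (\<lambda>\<omega>. indicator E \<omega> * measure (kernel (u \<omega>)) A)"
    unfolding eq by (rule integral_eq_nn_integral[symmetric]) auto
  finally show ?thesis .
qed

lemma markov_chain_if_one_step:
  assumes u: "\<And>k. u k \<in> Fk k \<rightarrow>\<^sub>M XS" and s: "\<And>k. one_step k (u k) (u (Suc k))"
  shows "markov_chain P Fk XS kernel u"
  unfolding markov_chain_def
proof (intro conjI allI ballI kernel_measurable u)
  fix k A assume A: "A \<in> sets XS"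
  have uP: "u k \<in> P \<rightarrow>\<^sub>M XS" for k by (rule measurable_from_subalg[OF subalg u])
  interpret finite_measure_subalgebra P "Fk k"
    by (simp add: finite_measure_subalgebra_def finite_measure_subalgebra_axioms_def subalg finite_measure_axioms)
  note [measurable] = uP A
  have m: "(\<lambda>\<omega>. measure (kernel (u k \<omega>)) A) \<in> borel_measurable (Fk k)"
    by (rule measurable_compose[OF u measurable_compose[OF kernel_measurable measurable_measure_prob_algebra[OF A]]])
  have [measurable]: "(\<lambda>\<omega>. measure (kernel (u k \<omega>)) A) \<in> borel_measurable P"
    by (rule measurable_from_subalg[OF subalg m])
  show "AE \<omega> in P. real_cond_exp P (Fk k) (\<lambda>\<omega>'. indicator A (u (Suc k) \<omega>')) \<omega> = measure (kernel (u k \<omega>)) A"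
  proof (rule real_cond_exp_charact[OF _ _ _ m])
    fix E assume "E \<in> sets (Fk k)"
    from one_step_Markov_sets[OF u uP s this A]
    show "(\<integral>\<omega>\<in>E. indicator A (u (Suc k) \<omega>) \<partial>P) = (\<integral>\<omega>\<in>E. measure (kernel (u k \<omega>)) A \<partial>P)"
      by (simp add: set_lebesgue_integral_def)
  next
    show "integrable P (\<lambda>\<omega>. indicator A (u (Suc k) \<omega>) :: real)"
      by (intro integrable_const_bound[of _ 1]) auto
  next
    have "AE \<omega> in P. norm (measure (kernel (u k \<omega>)) A) \<le> 1"
    proof (rule AE_I2)
      fix \<omega> assume "\<omega> \<in> space P"
      then have "u k \<omega> \<in> S" using measurable_space[OF uP] by (simp add: space_XS)
      then interpret k: prob_space "kernel (u k \<omega>)" by (rule kernel_prob)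
      show "norm (measure (kernel (u k \<omega>)) A) \<le> 1" by simp
    qed
    then show "integrable P (\<lambda>\<omega>. measure (kernel (u k \<omega>)) A)"
      by (intro integrable_const_bound[of _ 1]) auto
  qed
qed

end

subsection \<open>The Maxwell scheme\<close>

text \<open>The members of the sequence vanish off \<Theta>, so the mass of the limit there is at
  most its squared distance to any of them.\<close>

lemma L2_on_closed:
  assumes [measurable]: "\<Theta> \<in> sets lebesgue"
  shows "closed (L2_on \<Theta> :: 'b::euclidean_space L2 set)"
  unfolding closed_sequential_limits
proof (intro allI impI, elim conjE)
  fix v :: "nat \<Rightarrow> 'b L2" and l assume v: "\<forall>n. v n \<in> L2_on \<Theta>" and lim: "v \<longlonglongrightarrow> l"
  let ?I = "\<integral>\<^sup>+x. indicator (- \<Theta>) x * ennreal ((norm (L2_fun l x))\<^sup>2) \<partial>lebesgue"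
  have le: "?I \<le> ennreal ((norm (l - v n))\<^sup>2)" for n
    unfolding norm_L2_fun
  proof (rule nn_integral_mono_AE)
    have "AE x in lebesgue. x \<notin> \<Theta> \<longrightarrow> L2_fun (v n) x = 0" using v by (simp add: L2_on_def)
    then show "AE x in lebesgue. indicator (- \<Theta>) x * ennreal ((norm (L2_fun l x))\<^sup>2) \<le> ennreal ((norm (L2_fun (l - v n) x))\<^sup>2)"
      using L2_fun_diff[of l "v n"] by eventually_elim (auto simp: indicator_def)
  qed
  have "(\<lambda>n. ennreal ((norm (l - v n))\<^sup>2)) \<longlonglongrightarrow> ennreal ((norm (l - l))\<^sup>2)"
    by (intro tendsto_intros lim)
  then have "?I \<le> ennreal ((norm (l - l))\<^sup>2)"
    by (rule tendsto_lowerbound) (auto intro!: always_eventually le)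
  then have "?I = 0" by simp
  then have "AE x in lebesgue. indicator (- \<Theta>) x * ennreal ((norm (L2_fun l x))\<^sup>2) = 0"
    by (subst (asm) nn_integral_0_iff_AE) measurable
  then have "AE x in lebesgue. x \<notin> \<Theta> \<longrightarrow> L2_fun l x = 0"
    by eventually_elim (auto simp: indicator_def split: if_splits)
  then show "l \<in> L2_on \<Theta>" by (simp add: L2_on_def)
qed

lemma zero_in_L2_on: "0 \<in> L2_on \<Theta>"
proof -
  have "AE x in lebesgue. L2_fun (0 :: 'a L2) x = 0"
    unfolding zero_L2_def by (rule L2_fun_abs[OF square_integrable_zero])
  then show ?thesis unfolding L2_on_def by (auto elim: eventually_mono)
qed

lemma HH_closed: "\<Theta> \<in> sets lebesgue \<Longrightarrow> closed (HH \<Theta>)"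
  unfolding HH_def by (intro closed_Times L2_on_closed)

lemma zero_in_HH: "0 \<in> HH \<Theta>"
  by (simp add: HH_def zero_prod_def zero_in_L2_on)

lemma maxwell_dom_subset_HH: "maxwell_dom \<Theta> \<subseteq> HH \<Theta>"
  by (auto simp: maxwell_dom_def HH_def H0_curl_def H_curl_def has_weak_curl_def)

text \<open>The vanishing tangential trace of the electric components makes each pairing of one
  electric with one magnetic field symmetric, and the four pairings cancel. The differences are
  expanded into single fields first because \<open>weak_curl\<close> is a choice operator.\<close>

lemma maxwell_skew:
  assumes "u \<in> maxwell_dom \<Theta>" "v \<in> maxwell_dom \<Theta>"
  shows "(maxwell \<Theta> u - maxwell \<Theta> v) \<bullet> (u - v) = 0"
proof -
  obtain E H E' H' where uv: "u = (E, H)" "v = (E', H')" by (metis surj_pair)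
  have sym: "weak_curl \<Theta> p \<bullet> q = weak_curl \<Theta> q \<bullet> p" if "p \<in> {E, E'}" "q \<in> {H, H'}" for p q
  proof -
    have "p \<in> H0_curl \<Theta>" "q \<in> H_curl \<Theta>"
      using that assms by (auto simp: uv maxwell_dom_def)
    then show ?thesis by (auto simp: H0_curl_def tangential_trace_def inner_commute)
  qed
  show ?thesis
    using sym[of E H] sym[of E H'] sym[of E' H] sym[of E' H']
    by (simp add: uv maxwell_def inner_prod_def inner_diff_left inner_diff_right)
qed

text \<open>All implicit terms of the scheme on one side: a step reads residual of the new state
  equals old state plus noise.\<close>

definition maxwell_residual ::
  "R3 set \<Rightarrow> (field_pair \<Rightarrow> field_pair) \<Rightarrow> real \<Rightarrow> real \<Rightarrow> field_pair \<Rightarrow> field_pair" where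
  "maxwell_residual \<Theta> F \<sigma>0 \<tau> w = w - \<tau> *\<^sub>R maxwell \<Theta> w + (\<sigma>0 * \<tau>) *\<^sub>R w - \<tau> *\<^sub>R F w"

text \<open>Energy estimate: the residual difference is tested against \<open>w - w'\<close>. The
  Maxwell part drops out, the one-sided bound controls the nonlinearity, and Cauchy-Schwarz leaves
  one factor to cancel.\<close>

lemma maxwell_residual_expand:
  assumes F: "\<And>u v. u \<in> HH \<Theta> \<Longrightarrow> v \<in> HH \<Theta> \<Longrightarrow> (u - v) \<bullet> (F u - F v) \<le> \<alpha> * (norm (u - v))\<^sup>2"
    and \<tau>: "0 < \<tau>" "\<alpha> < \<sigma>0" and w: "w \<in> maxwell_dom \<Theta>" "w' \<in> maxwell_dom \<Theta>"
  shows "norm (w - w') \<le> 1 / (1 + (\<sigma>0 - \<alpha>) * \<tau>) *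
    norm (maxwell_residual \<Theta> F \<sigma>0 \<tau> w - maxwell_residual \<Theta> F \<sigma>0 \<tau> w')"
proof -
  define d m f where "d = w - w'" and "m = maxwell \<Theta> w - maxwell \<Theta> w'" and "f = F w - F w'"
  let ?r = "maxwell_residual \<Theta> F \<sigma>0 \<tau> w - maxwell_residual \<Theta> F \<sigma>0 \<tau> w'"
  let ?a = "1 + (\<sigma>0 - \<alpha>) * \<tau>"
  have a: "0 < ?a" using \<tau> by (simp add: add_pos_pos)
  have S: "w \<in> HH \<Theta>" "w' \<in> HH \<Theta>" using w maxwell_dom_subset_HH by auto
  have r: "?r = d - \<tau> *\<^sub>R m + (\<sigma>0 * \<tau>) *\<^sub>R d - \<tau> *\<^sub>R f"
    by (simp add: maxwell_residual_def scaleR_diff_right d_def m_def f_def)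
  have "m \<bullet> d = 0" unfolding m_def d_def by (rule maxwell_skew[OF w])
  then have "?r \<bullet> d = (1 + \<sigma>0 * \<tau>) * (norm d)\<^sup>2 - \<tau> * (d \<bullet> f)"
    unfolding r by (simp add: inner_diff_left inner_add_left inner_commute[of f d] power2_norm_eq_inner algebra_simps)
  moreover have "\<tau> * (d \<bullet> f) \<le> \<tau> * (\<alpha> * (norm d)\<^sup>2)"
    using mult_left_mono[OF F[OF S], of \<tau>] \<tau> by (simp add: d_def f_def)
  ultimately have "?r \<bullet> d \<ge> (1 + \<sigma>0 * \<tau>) * (norm d)\<^sup>2 - \<tau> * (\<alpha> * (norm d)\<^sup>2)" by simp
  then have "?a * (norm d)\<^sup>2 \<le> ?r \<bullet> d" by (simp add: algebra_simps)
  also have "\<dots> \<le> norm ?r * norm d" by (rule norm_cauchy_schwarz)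
  finally have "(?a * norm d) * norm d \<le> norm ?r * norm d" by (simp add: power2_eq_square)
  then have "?a * norm d \<le> norm ?r"
    by (cases "norm d = 0") (auto dest: mult_right_le_imp_le)
  then show ?thesis using a by (simp add: d_def pos_le_divide_eq mult.commute)
qed

text \<open>The assumed gap gives \<open>K\<^sup>2 < 2 * a\<close>, and
  \<open>1 + 2 * a * \<tau>\<close> is the linear part of \<open>(1 + a * \<tau>)\<^sup>2\<close>.
  In the application \<open>a\<close> is \<open>\<sigma>0 - \<alpha>F\<close>.\<close>

lemma contraction_constant:
  fixes K a \<tau> :: real
  assumes "0 < \<tau>" "1 / 2 + 2 * K\<^sup>2 < a"
  shows "(1 / (1 + a * \<tau>))\<^sup>2 * (1 + \<tau> * K\<^sup>2) < 1"
proof -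
  have a: "0 < a" using assms(2) zero_le_power2[of K] by linarith
  have "K\<^sup>2 < 2 * a" using assms(2) zero_le_power2[of K] by linarith
  then have "1 + \<tau> * K\<^sup>2 < 1 + \<tau> * (2 * a)" using assms(1) by simp
  also have "\<dots> \<le> (1 + a * \<tau>)\<^sup>2"
    using zero_le_power2[of "a * \<tau>"] by (simp add: power2_sum mult_ac)
  finally have "1 + \<tau> * K\<^sup>2 < (1 + a * \<tau>)\<^sup>2" .
  moreover have "0 < (1 + a * \<tau>)\<^sup>2" using a assms(1) by (intro zero_less_power) (simp add: add_pos_pos)
  ultimately show ?thesis by (simp add: power_divide pos_divide_less_eq)
qed

section \<open>Passage from the abstract kernel to the kernel of the scheme\<close>

text \<open>The kernel of the scheme is identified with the abstract one on the state space only, so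
  both notions are transferred along agreement there.\<close>

lemma markov_chain_cong:
  assumes mc: "markov_chain P G X \<kappa> u" and eq: "\<And>x. x \<in> space X \<Longrightarrow> \<kappa> x = \<kappa>' x"
    and sub: "\<And>k. subalgebra P (G k)"
  shows "markov_chain P G X \<kappa>' u"
  unfolding markov_chain_def
proof (intro conjI allI ballI)
  show "\<kappa>' \<in> X \<rightarrow>\<^sub>M prob_algebra X"
    using mc measurable_cong[of X \<kappa> \<kappa>'] eq by (simp add: markov_chain_def)
  show u: "u k \<in> G k \<rightarrow>\<^sub>M X" for k using mc by (simp add: markov_chain_def)
  fix k A assume A: "A \<in> sets X"
  then have "AE \<omega> in P. real_cond_exp P (G k) (\<lambda>\<omega>'. indicator A (u (Suc k) \<omega>')) \<omega> = measure (\<kappa> (u k \<omega>)) A"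
    using mc by (simp add: markov_chain_def)
  then show "AE \<omega> in P. real_cond_exp P (G k) (\<lambda>\<omega>'. indicator A (u (Suc k) \<omega>')) \<omega> = measure (\<kappa>' (u k \<omega>)) A"
    using AE_space
  proof eventually_elim
    case (elim \<omega>)
    then have "u k \<omega> \<in> space X"
      using measurable_space[OF u] sub[of k] by (simp add: subalgebra_def)
    then show ?case using elim eq by simp
  qed
qed

lemma invariant_measure_cong:
  assumes eq: "\<And>x. x \<in> space X \<Longrightarrow> \<kappa> x = \<kappa>' x"
  shows "invariant_measure X \<kappa> \<pi> \<longleftrightarrow> invariant_measure X \<kappa>' \<pi>"
proof -
  have "(\<integral>\<^sup>+x. emeasure (\<kappa> x) A \<partial>\<pi>) = (\<integral>\<^sup>+x. emeasure (\<kappa>' x) A \<partial>\<pi>)"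
    if "\<pi> \<in> space (prob_algebra X)" for A
    using that sets_eq_imp_space_eq[of \<pi> X] by (intro nn_integral_cong) (simp add: space_prob_algebra eq)
  then show ?thesis by (auto simp: invariant_measure_def)
qed

text \<open>Existence of solutions is a premise: from \<open>u0\<close> for the chain itself, and
  from every point of \<open>HH \<Theta>\<close> because the kernel is read off from deterministic
  starts. The Markov property in the conclusion certifies that \<open>euler_kernel\<close> is the
  transition kernel of \<open>u\<close>.\<close>

theorem proposition3p4:
  fixes \<Theta> :: "R3 set"
    and P :: "'w measure" and Fil :: "real \<Rightarrow> 'w measure"
    and Q :: "real L2 \<Rightarrow> real L2" and e :: "nat \<Rightarrow> real L2"
    and \<beta> :: "nat \<Rightarrow> real \<Rightarrow> 'w \<Rightarrow> real"
    and Je Jm Jer Jmr :: "R3 \<Rightarrow> R3 \<Rightarrow> R3 \<Rightarrow> R3"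
    and u0 :: "'w \<Rightarrow> field_pair"
    and \<sigma>0 \<alpha>F \<alpha>B :: real
  defines "F \<equiv> F_op \<Theta> Je Jm" and "B \<equiv> B_op \<Theta> Jer Jmr"
  assumes domain: "open \<Theta>" "connected \<Theta>" "\<Theta> \<noteq> {}" "bounded \<Theta>"
    and filtered: "filtered_prob_space P Fil"
    and Q: "covariance_operator (L2_on \<Theta>) Q"
    and e: "orthonormal_basis (L2_on \<Theta>) e"
    and noise: "wiener_coordinates P Fil \<beta>"
    and F_maps: "F_well_defined \<Theta> Je Jm"
    and B_maps: "B_well_defined \<Theta> Q e Jer Jmr"
    and u0: "u0 \<in> measurable (Fil 0) (HH_borel \<Theta>)" "integrable P (\<lambda>\<omega>. (norm (u0 \<omega>))\<^sup>2)"
    and F_one_sided: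
      "\<forall>u\<in>HH \<Theta>. \<forall>v\<in>HH \<Theta>. (u - v) \<bullet> (F u - F v) \<le> \<alpha>F * (norm (u - v))\<^sup>2"
    and B_Lipschitz:
      "\<forall>u\<in>HH \<Theta>. \<forall>v\<in>HH \<Theta>. HS_norm \<Theta> Q e (\<lambda>w. B u w - B v w) \<le> \<alpha>B * norm (u - v)"
    and \<sigma>0: "\<sigma>0 > max (1 + 2 * \<alpha>F) ((norm (F 0))\<^sup>2) / 2
                   + 2 * (max \<alpha>B (HS_norm \<Theta> Q e (B 0)))\<^sup>2"
  shows "\<exists>\<Delta>0>0. \<forall>\<Delta>t. 0 < \<Delta>t \<and> \<Delta>t < \<Delta>0 \<longrightarrow>
    (\<forall>u. euler_solution \<Theta> P Fil Q e \<beta> F B \<sigma>0 \<Delta>t u0 u \<and>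
         (\<forall>x\<in>HH \<Theta>. \<exists>v. euler_solution \<Theta> P Fil Q e \<beta> F B \<sigma>0 \<Delta>t (\<lambda>_. x) v) \<longrightarrow>
       markov_chain P (\<lambda>k. Fil (real k * \<Delta>t)) (HH_borel \<Theta>)
         (euler_kernel \<Theta> P Fil Q e \<beta> F B \<sigma>0 \<Delta>t) u \<and>
       (\<exists>!\<pi>. invariant_measure (HH_borel \<Theta>) (euler_kernel \<Theta> P Fil Q e \<beta> F B \<sigma>0 \<Delta>t) \<pi>))"
proof (intro exI[of _ 1] conjI[OF zero_less_one] allI impI, elim conjE)
  \<comment> \<open>The threshold 1 is a free choice: \<open>contraction_constant\<close> covers
    every positive step.\<close>
  fix \<tau> :: real and u
  assume \<tau>: "0 < \<tau>" "\<tau> < 1" and u: "euler_solution \<Theta> P Fil Q e \<beta> F B \<sigma>0 \<tau> u0 u"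
    and ex: "\<forall>x\<in>HH \<Theta>. \<exists>v. euler_solution \<Theta> P Fil Q e \<beta> F B \<sigma>0 \<tau> (\<lambda>_. x) v"
  define b where "b j x = B x (op_sqrt (L2_on \<Theta>) Q (e j))" for j x
  \<comment> \<open>The maximum is a valid Lipschitz constant, since it dominates
    \<open>\<alpha>B\<close>, and it is nonnegative, since it dominates a norm.\<close>
  define K where "K = max \<alpha>B (HS_norm \<Theta> Q e (B 0))"
  have summ: "summable (\<lambda>j. (norm (b j x))\<^sup>2)" if "x \<in> HH \<Theta>" for x
    using B_maps that by (simp add: B_well_defined_def Hilbert_Schmidt_def b_def B_def)
  have "0 \<le> HS_norm \<Theta> Q e (B 0)"
    using summ[OF zero_in_HH] by (auto simp: HS_norm_def b_def intro!: suminf_nonneg)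
  then have K: "0 \<le> K" by (simp add: K_def)
  \<comment> \<open>The first maximum is bounded below by its entry
    \<open>1 + 2 * \<alpha>F\<close>. Halved, this gives the summand 1/2 and an
    \<open>\<alpha>F\<close> that moves to the other side.\<close>
  have gap: "1 / 2 + 2 * K\<^sup>2 < \<sigma>0 - \<alpha>F"
  proof -
    have "(1 + 2 * \<alpha>F) / 2 \<le> max (1 + 2 * \<alpha>F) ((norm (F 0))\<^sup>2) / 2"
      by (intro divide_right_mono max.cobounded1) simp
    from order.strict_trans1[OF add_right_mono[OF this] \<sigma>0]
    show ?thesis by (simp add: K_def add_divide_distrib)
  qed
  then have gap0: "\<alpha>F < \<sigma>0" using zero_le_power2[of K] by linarith
  have prob: "prob_space P" using filtered by (simp add: filtered_prob_space_def)
  have S: "closed (HH \<Theta>)" using domain(1) by (intro HH_closed sets_completionI_sets) simp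
  interpret euler_scheme P Fil \<beta> "HH \<Theta>" "maxwell_dom \<Theta>" "maxwell_residual \<Theta> F \<sigma>0 \<tau>" b \<tau>
    "1 / (1 + (\<sigma>0 - \<alpha>F) * \<tau>)" K
  proof (intro euler_scheme.intro prob euler_scheme_axioms.intro)
    show "HH \<Theta> \<noteq> {}" using zero_in_HH by blast
    show "0 < 1 / (1 + (\<sigma>0 - \<alpha>F) * \<tau>)" using \<tau> gap0 by (simp add: add_pos_pos)
    show "(1 / (1 + (\<sigma>0 - \<alpha>F) * \<tau>))\<^sup>2 * (1 + \<tau> * K\<^sup>2) < 1"
      by (rule contraction_constant[OF \<tau>(1) gap])
    show "norm (w - w') \<le> 1 / (1 + (\<sigma>0 - \<alpha>F) * \<tau>) *
        norm (maxwell_residual \<Theta> F \<sigma>0 \<tau> w - maxwell_residual \<Theta> F \<sigma>0 \<tau> w')"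
      if "w \<in> maxwell_dom \<Theta>" "w' \<in> maxwell_dom \<Theta>" for w w'
      using F_one_sided \<tau>(1) gap0 that by (intro maxwell_residual_expand) auto
    show "(\<Sum>j. (norm (b j x - b j y))\<^sup>2) \<le> (K * norm (x - y))\<^sup>2" if "x \<in> HH \<Theta>" "y \<in> HH \<Theta>" for x y
    proof (rule sqrt_le_D)
      have "sqrt (\<Sum>j. (norm (b j x - b j y))\<^sup>2) \<le> \<alpha>B * norm (x - y)"
        using B_Lipschitz that by (simp add: HS_norm_def b_def)
      also have "\<dots> \<le> K * norm (x - y)" by (intro mult_right_mono) (simp_all add: K_def)
      finally show "sqrt (\<Sum>j. (norm (b j x - b j y))\<^sup>2) \<le> K * norm (x - y)" .
    qed
  qed (use filtered noise S \<tau> K summ in auto)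
  have sol: "v 0 = \<eta>" "v k \<in> Fk k \<rightarrow>\<^sub>M XS" "one_step k (v k) (v (Suc k))"
    if v: "euler_solution \<Theta> P Fil Q e \<beta> F B \<sigma>0 \<tau> \<eta> v" for \<eta> v k
  proof -
    show "v 0 = \<eta>" using v by (simp add: euler_solution_def)
    show "v k \<in> Fk k \<rightarrow>\<^sub>M XS" using v by (simp add: euler_solution_def HH_borel_def)
    obtain N where N: "applied_to_increment \<Theta> P Q e \<beta> (\<lambda>\<omega>. B (v k \<omega>)) (real k * \<tau>) (real (Suc k) * \<tau>) N"
      "AE \<omega> in P. v (Suc k) \<omega> \<in> maxwell_dom \<Theta> \<and>
           v (Suc k) \<omega> - v k \<omega> =
             \<tau> *\<^sub>R maxwell \<Theta> (v (Suc k) \<omega>) - (\<sigma>0 * \<tau>) *\<^sub>R v (Suc k) \<omega>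
             + \<tau> *\<^sub>R F (v (Suc k) \<omega>) + N \<omega>"
      using v unfolding euler_solution_def by blast
    show "one_step k (v k) (v (Suc k))"
      unfolding one_step_def
    proof (intro exI[of _ N] conjI)
      show "N \<in> borel_measurable P"
        using N(1) by (intro XS_borel) (simp add: applied_to_increment_def HH_borel_def)
      show "(\<lambda>n. \<integral>\<^sup>+\<omega>. ennreal ((norm ((\<Sum>j<n. \<xi> k j \<omega> *\<^sub>R b j (v k \<omega>)) - N \<omega>))\<^sup>2) \<partial>P) \<longlonglongrightarrow> 0"
        using N(1) by (simp add: applied_to_increment_def \<xi>_def b_def)
      show "AE \<omega> in P. v (Suc k) \<omega> \<in> maxwell_dom \<Theta> \<and>
          maxwell_residual \<Theta> F \<sigma>0 \<tau> (v (Suc k) \<omega>) = v k \<omega> + N \<omega>"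
        using N(2) by eventually_elim (simp add: maxwell_residual_def algebra_simps)
    qed
  qed
  have start: "v 1 \<in> P \<rightarrow>\<^sub>M XS" "one_step 0 (\<lambda>_. x) (v 1)"
    if "euler_solution \<Theta> P Fil Q e \<beta> F B \<sigma>0 \<tau> (\<lambda>_. x) v" for x v
    using measurable_from_subalg[OF subalg sol(2)[OF that, of 1]] sol(1)[OF that] sol(3)[OF that, of 0]
    by simp_all
  interpret solvable_euler_scheme P Fil \<beta> "HH \<Theta>" "maxwell_dom \<Theta>" "maxwell_residual \<Theta> F \<sigma>0 \<tau>" b \<tau>
    "1 / (1 + (\<sigma>0 - \<alpha>F) * \<tau>)" K
  proof
    show "\<exists>w. w \<in> P \<rightarrow>\<^sub>M XS \<and> one_step 0 (\<lambda>_. x) w" if "x \<in> HH \<Theta>" for x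
      using ex that start by blast
  qed
  \<comment> \<open>All solutions from \<open>x\<close> share their law at time 1, because a step is
    unique up to a null set. Hence the definite description in \<open>euler_kernel\<close> denotes
    that law, whatever choice was made in \<open>Z\<close>.\<close>
  have kern: "kernel x = euler_kernel \<Theta> P Fil Q e \<beta> F B \<sigma>0 \<tau> x" if "x \<in> space XS" for x
  proof -
    have x: "x \<in> HH \<Theta>" using that by (simp add: space_XS)
    obtain v where v: "euler_solution \<Theta> P Fil Q e \<beta> F B \<sigma>0 \<tau> (\<lambda>_. x) v" using ex x by blast
    have law: "distr P XS (w 1) = kernel x" if "euler_solution \<Theta> P Fil Q e \<beta> F B \<sigma>0 \<tau> (\<lambda>_. x) w" for w
      by (rule distr_one_step[OF x start(1)[OF that] start(2)[OF that]])
    show ?thesis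
      unfolding euler_kernel_def HH_borel_def
    proof (rule the_equality[symmetric])
      show "\<exists>u. euler_solution \<Theta> P Fil Q e \<beta> F B \<sigma>0 \<tau> (\<lambda>_. x) u \<and> kernel x = distr P XS (u 1)"
        using v law[OF v] by (intro exI[of _ v]) simp
      show "\<mu> = kernel x" if "\<exists>u. euler_solution \<Theta> P Fil Q e \<beta> F B \<sigma>0 \<tau> (\<lambda>_. x) u \<and> \<mu> = distr P XS (u 1)" for \<mu>
        using that law by blast
    qed
  qed
  have "markov_chain P Fk XS (euler_kernel \<Theta> P Fil Q e \<beta> F B \<sigma>0 \<tau>) u"
    by (rule markov_chain_cong[OF markov_chain_if_one_step[OF sol(2)[OF u] sol(3)[OF u]] kern subalg])
  moreover have "\<exists>!\<pi>. invariant_measure XS (euler_kernel \<Theta> P Fil Q e \<beta> F B \<sigma>0 \<tau>) \<pi>"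
    using ex1_invariant_measure invariant_measure_cong[of XS kernel, OF kern] by simp
  ultimately show "markov_chain P Fk (HH_borel \<Theta>) (euler_kernel \<Theta> P Fil Q e \<beta> F B \<sigma>0 \<tau>) u \<and>
      (\<exists>!\<pi>. invariant_measure (HH_borel \<Theta>) (euler_kernel \<Theta> P Fil Q e \<beta> F B \<sigma>0 \<tau>) \<pi>)"
    unfolding HH_borel_def by (rule conjI)
qed

end
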